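(* Let $\Gamma=(\mathcal{C},\mathcal{X},H,I,\eta,\epsilon,\mathcal{E},\mathcal{F})$ be an admissible Galois structure on a finitely complete pointed category $\mathcal{C}$, with $H$ the inclusion of a full reflective subcategory $\mathcal{X}$, such that monadic extensions are pullback-stable, every object of $\mathcal{C}$ admits a weakly universal normal extension into it, and for every object $E$ of $\mathcal{C}$ the morphism $I(E)\to 0$ is in $\mathcal{F}$. Let $\pi_1(-,I)\colon\mathcal{C}\to\mathcal{X}$ be the (underlying object of the) fundamental group functor and let $\delta\colon \pi_1(-,I)\circ\mathrm{Cod}\Rightarrow \mathrm{Ker}$ be the natural transformation $\delta=\iota\circ\kappa$ of functors $\mathsf{NExt}_\Gamma(\mathcal{C})\to\mathcal{X}$. Then $(\pi_1(-,I),\delta)$ is a (right) Kan extension of $\mathrm{Ker}\colon \mathsf{NExt}_\Gamma(\mathcal{C})\to\mathcal{X}$ along $\mathrm{Cod}\colon\mathsf{NExt}_\Gamma(\mathcal{C})\to\mathcal{C}$; that is, for every functor $F\colon\mathcal{C}\to\mathcal{X}$ and every natural transformation $\gamma\colon F\circ\mathrm{Cod}\Rightarrow\mathrm{Ker}$ there is a unique natural transformation $\alpha\colon F\Rightarrow\pi_1(-,I)$ with $\delta\circ\alpha_{\mathrm{Cod}}=\gamma$.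
   Context: **Galois structures.** A Galois structure $\Gamma=(\mathcal{C},\mathcal{X},H,I,\eta,\epsilon,\mathcal{E},\mathcal{F})$ on a category $\mathcal{C}$ is an adjunction $I\dashv H$, $I\colon\mathcal{C}\to\mathcal{X}$, $H\colon\mathcal{X}\to\mathcal{C}$, with unit $\eta\colon 1_{\mathcal{C}}\Rightarrow HI$ and counit $\epsilon\colon IH\Rightarrow 1_{\mathcal{X}}$, together with classes of morphisms $\mathcal{E}$ in $\mathcal{C}$ and $\mathcal{F}$ in $\mathcal{X}$ such that: (i) both contain all isomorphisms; (ii) both are pullback-stable (the pullback of a morphism in the class along any morphism exists and is in the class); (iii) both are closed under composition; (iv) $H(\mathcal{F})\subseteq\mathcal{E}$; (v) $I(\mathcal{E})\subseteq\mathcal{F}$. Morphisms in $\mathcal{E}$ are called fibrations. $(\mathcal{E}\downarrow B)$ denotes the full subcategory of the slice category $(\mathcal{C}\downarrow B)$ on morphisms in $\mathcal{E}$, and similarly $(\mathcal{F}\downarrow X)$. For $B\in\mathcal{C}$ let $H^B\colon(\mathcal{F}\downarrow I(B))\to(\mathcal{E}\downarrow B)$ send $g$ to the pullback of $H(g)$ along $\eta_B\colon B\to HI(B)$; $\Gamma$ is admissible when all $H^B$ are full and faithful. A trivial covering is a fibration $f\colon A\to B$ for which the naturality square of $\eta$ at $f$ (i.e. $HI(f)\circ\eta_A=\eta_B\circ f$) is a pullback. A monadic extension is a fibration $p\colon E\to B$ such that the pullback functor $p^*\colon(\mathcal{E}\downarrow B)\to(\mathcal{E}\downarrow E)$ is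 monadic. A normal extension is a monadic extension $p$ such that $p^*(p)$ is a trivial covering, i.e. a monadic extension whose kernel pair projections are trivial coverings. $\mathsf{NExt}_\Gamma(\mathcal{C})$ is the full subcategory of the category of arrows of $\mathcal{C}$ on the normal extensions, so a morphism $p\to p'$ is a pair $(f,b)$ with $p'f=bp$. $\mathrm{Cod}\colon\mathsf{NExt}_\Gamma(\mathcal{C})\to\mathcal{C}$ is the codomain functor, and $\mathrm{Ker}$ is the kernel functor; the kernel of a normal extension lies in $\mathcal{X}$. As $H$ is a full inclusion, it is suppressed from notation, so $\eta_E\colon E\to I(E)$. **Galois group.** For a normal extension $p\colon E\to B$ with kernel pair $d,c\colon\mathrm{Eq}(p)\rightrightarrows E$, the image under $I$ of the groupoid $\mathrm{Eq}(p)$ is an internal groupoid in $\mathcal{X}$ (by admissibility $I$ preserves pullbacks along trivial coverings), the Galois groupoid. The Galois group $\mathrm{Gal}_\Gamma(p,0)$ is the internal group in $\mathcal{X}$ with underlying object $\mathrm{Ker}(I(d))\cap\mathrm{Ker}(I(c))\subseteq I(\mathrm{Eq}(p))$, with the induced multiplication. This defines a functor $\mathrm{Gal}_\Gamma(-,0)$ from $\mathsf{NExt}_\Gamma(\mathcal{C})$ to the category $\mathsf{Gp}(\mathcal{X})$ of internal groups in $\mathcal{X}$. It is known that its underlying object is canonically isomorphic to $\mathrm{Ker}(p)\cap\mathrm{Ker}(\eta_E)$ (via the restriction of $\eta_{\mathrm{Eq}(p)}\circ\langle 0,\ker p\rangle\colon\mathrm{Ker}(p)\to I(\mathrm{Eq}(p))$).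 The inclusions $\mathrm{Ker}(p)\cap\mathrm{Ker}(\eta_E)\to\mathrm{Ker}(p)$ thus give a componentwise monic natural transformation $\iota$ from the underlying object functor of $\mathrm{Gal}_\Gamma(-,0)$ to $\mathrm{Ker}$. **Fundamental group.** A normal extension $u\colon U\to B$ is weakly universal if for every normal extension $p\colon E\to B$ there is $e\colon U\to E$ with $p\circ e=u$. Morphisms of normal extensions with the same codomain component induce the same morphism of Galois groups. The fundamental group is $\pi_1(B,I)=\mathrm{Gal}_\Gamma(u,0)$ for a (chosen) weakly universal normal extension $u$ of $B$; on $f\colon A\to B$, $\pi_1(f,I)=\mathrm{Gal}_\Gamma((g,f),0)$ for any morphism $(g,f)\colon v\to u$ between the weakly universal normal extensions $v$ of $A$ and $u$ of $B$. The same notation $\pi_1(-,I)\colon\mathcal{C}\to\mathcal{X}$ is used for its underlying object functor. The natural transformation $\kappa\colon\pi_1(-,I)\circ\mathrm{Cod}\Rightarrow\mathrm{Gal}_\Gamma(-,0)$ has components $\kappa_p=\mathrm{Gal}_\Gamma((h,1_B),0)\colon\mathrm{Gal}_\Gamma(u,0)\to\mathrm{Gal}_\Gamma(p,0)$ for $p\colon E\to B$ normal, $u$ the weakly universal normal extension of $B$ and any $h\colon U\to E$ with $ph=u$. In the claim, $\kappa$ stands for the underlying natural transformation of functors to $\mathcal{X}$. *)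

theory Defs
  imports Main "HOL-Library.FuncSet"
begin

section \<open>Categories, functors, natural transformations\<close>

record ('o, 'a) cat =
  Obj :: "'o set"
  Arr :: "'a set"
  Dom :: "'a \<Rightarrow> 'o"
  Cod :: "'a \<Rightarrow> 'o"
  Ide :: "'o \<Rightarrow> 'a"
  Comp :: "'a \<Rightarrow> 'a \<Rightarrow> 'a"  (infixr "\<cdot>\<index>" 70)

definition hom :: "('o, 'a) cat \<Rightarrow> 'o \<Rightarrow> 'o \<Rightarrow> 'a set" where
  "hom C a b = {f \<in> Arr C. Dom C f = a \<and> Cod C f = b}"

definition is_category :: "('o, 'a) cat \<Rightarrow> bool" where
  "is_category C \<longleftrightarrow>
     (\<forall>f\<in>Arr C. Dom C f \<in> Obj C \<and> Cod C f \<in> Obj C) \<and>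
     (\<forall>a\<in>Obj C. Ide C a \<in> hom C a a) \<and>
     (\<forall>f\<in>Arr C. \<forall>g\<in>Arr C. Cod C f = Dom C g \<longrightarrow> g \<cdot>\<^bsub>C\<^esub> f \<in> hom C (Dom C f) (Cod C g)) \<and>
     (\<forall>f\<in>Arr C. f \<cdot>\<^bsub>C\<^esub> Ide C (Dom C f) = f \<and> Ide C (Cod C f) \<cdot>\<^bsub>C\<^esub> f = f) \<and>
     (\<forall>f\<in>Arr C. \<forall>g\<in>Arr C. \<forall>h\<in>Arr C. Cod C f = Dom C g \<and> Cod C g = Dom C h \<longrightarrow>
        h \<cdot>\<^bsub>C\<^esub> (g \<cdot>\<^bsub>C\<^esub> f) = (h \<cdot>\<^bsub>C\<^esub> g) \<cdot>\<^bsub>C\<^esub> f)"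

definition inverse_arrows :: "('o, 'a) cat \<Rightarrow> 'a \<Rightarrow> 'a \<Rightarrow> bool" where
  "inverse_arrows C f g \<longleftrightarrow> f \<in> Arr C \<and> g \<in> hom C (Cod C f) (Dom C f) \<and>
     g \<cdot>\<^bsub>C\<^esub> f = Ide C (Dom C f) \<and> f \<cdot>\<^bsub>C\<^esub> g = Ide C (Cod C f)"

definition is_iso :: "('o, 'a) cat \<Rightarrow> 'a \<Rightarrow> bool" where
  "is_iso C f \<longleftrightarrow> (\<exists>g. inverse_arrows C f g)"

definition inv_arr :: "('o, 'a) cat \<Rightarrow> 'a \<Rightarrow> 'a" where
  "inv_arr C f = (THE g. inverse_arrows C f g)"

record ('o, 'a, 'p, 'b) func =
  FObj :: "'o \<Rightarrow> 'p"
  FArr :: "'a \<Rightarrow> 'b"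

definition is_functor :: "('o, 'a) cat \<Rightarrow> ('p, 'b) cat \<Rightarrow> ('o, 'a, 'p, 'b) func \<Rightarrow> bool" where
  "is_functor A B F \<longleftrightarrow> is_category A \<and> is_category B \<and>
     (\<forall>a\<in>Obj A. FObj F a \<in> Obj B) \<and>
     (\<forall>f\<in>Arr A. FArr F f \<in> hom B (FObj F (Dom A f)) (FObj F (Cod A f))) \<and>
     (\<forall>a\<in>Obj A. FArr F (Ide A a) = Ide B (FObj F a)) \<and>
     (\<forall>f\<in>Arr A. \<forall>g\<in>Arr A. Cod A f = Dom A g \<longrightarrow>
        FArr F (g \<cdot>\<^bsub>A\<^esub> f) = FArr F g \<cdot>\<^bsub>B\<^esub> FArr F f)"

definition id_functor :: "('o, 'a, 'o, 'a) func" where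
  "id_functor = \<lparr>FObj = (\<lambda>a. a), FArr = (\<lambda>f. f)\<rparr>"

definition comp_functor ::
  "('p, 'b, 'q, 'c) func \<Rightarrow> ('o, 'a, 'p, 'b) func \<Rightarrow> ('o, 'a, 'q, 'c) func" where
  "comp_functor G F = \<lparr>FObj = (\<lambda>a. FObj G (FObj F a)), FArr = (\<lambda>f. FArr G (FArr F f))\<rparr>"

definition is_full :: "('o, 'a) cat \<Rightarrow> ('p, 'b) cat \<Rightarrow> ('o, 'a, 'p, 'b) func \<Rightarrow> bool" where
  "is_full A B F \<longleftrightarrow> (\<forall>a\<in>Obj A. \<forall>b\<in>Obj A. \<forall>h\<in>hom B (FObj F a) (FObj F b).
     \<exists>f\<in>hom A a b. FArr F f = h)"

definition is_faithful :: "('o, 'a) cat \<Rightarrow> ('p, 'b) cat \<Rightarrow> ('o, 'a, 'p, 'b) func \<Rightarrow> bool" where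
  "is_faithful A B F \<longleftrightarrow> (\<forall>a\<in>Obj A. \<forall>b\<in>Obj A. \<forall>f\<in>hom A a b. \<forall>g\<in>hom A a b.
     FArr F f = FArr F g \<longrightarrow> f = g)"

text \<open>Components are extensional (\<open>undefined\<close> outside the objects of the source), so that
  equality of natural transformations is equality of functions.\<close>

definition is_nat_trans :: "('o, 'a) cat \<Rightarrow> ('p, 'b) cat \<Rightarrow> ('o, 'a, 'p, 'b) func \<Rightarrow>
    ('o, 'a, 'p, 'b) func \<Rightarrow> ('o \<Rightarrow> 'b) \<Rightarrow> bool" where
  "is_nat_trans A B F G \<tau> \<longleftrightarrow> is_functor A B F \<and> is_functor A B G \<and>
     \<tau> \<in> extensional (Obj A) \<and>
     (\<forall>a\<in>Obj A. \<tau> a \<in> hom B (FObj F a) (FObj G a)) \<and>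
     (\<forall>f\<in>Arr A. FArr G f \<cdot>\<^bsub>B\<^esub> \<tau> (Dom A f) = \<tau> (Cod A f) \<cdot>\<^bsub>B\<^esub> FArr F f)"

definition is_nat_iso :: "('o, 'a) cat \<Rightarrow> ('p, 'b) cat \<Rightarrow> ('o, 'a, 'p, 'b) func \<Rightarrow>
    ('o, 'a, 'p, 'b) func \<Rightarrow> ('o \<Rightarrow> 'b) \<Rightarrow> bool" where
  "is_nat_iso A B F G \<tau> \<longleftrightarrow> is_nat_trans A B F G \<tau> \<and> (\<forall>a\<in>Obj A. is_iso B (\<tau> a))"

definition vcomp :: "('o, 'a) cat \<Rightarrow> ('p, 'b) cat \<Rightarrow> ('o \<Rightarrow> 'b) \<Rightarrow> ('o \<Rightarrow> 'b) \<Rightarrow> 'o \<Rightarrow> 'b" where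
  "vcomp A B \<tau> \<sigma> = (\<lambda>a\<in>Obj A. \<tau> a \<cdot>\<^bsub>B\<^esub> \<sigma> a)"

definition whisker :: "('o, 'a) cat \<Rightarrow> ('p \<Rightarrow> 'c) \<Rightarrow> ('o, 'a, 'p, 'b) func \<Rightarrow> 'o \<Rightarrow> 'c" where
  "whisker A \<alpha> K = (\<lambda>a\<in>Obj A. \<alpha> (FObj K a))"

definition is_adjunction :: "('o, 'a) cat \<Rightarrow> ('p, 'b) cat \<Rightarrow> ('o, 'a, 'p, 'b) func \<Rightarrow>
    ('p, 'b, 'o, 'a) func \<Rightarrow> ('o \<Rightarrow> 'a) \<Rightarrow> ('p \<Rightarrow> 'b) \<Rightarrow> bool" where
  "is_adjunction A B L R \<eta> \<epsilon> \<longleftrightarrow>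
     is_functor A B L \<and> is_functor B A R \<and>
     is_nat_trans A A id_functor (comp_functor R L) \<eta> \<and>
     is_nat_trans B B (comp_functor L R) id_functor \<epsilon> \<and>
     (\<forall>a\<in>Obj A. \<epsilon> (FObj L a) \<cdot>\<^bsub>B\<^esub> FArr L (\<eta> a) = Ide B (FObj L a)) \<and>
     (\<forall>b\<in>Obj B. FArr R (\<epsilon> b) \<cdot>\<^bsub>A\<^esub> \<eta> (FObj R b) = Ide A (FObj R b))"

definition is_equivalence :: "('o, 'a) cat \<Rightarrow> ('p, 'b) cat \<Rightarrow> ('o, 'a, 'p, 'b) func \<Rightarrow> bool" where
  "is_equivalence A B F \<longleftrightarrow> is_functor A B F \<and>
     (\<exists>G \<sigma> \<tau>. is_functor B A G \<and>
        is_nat_iso A A id_functor (comp_functor G F) \<sigma> \<and>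
        is_nat_iso B B (comp_functor F G) id_functor \<tau>)"

text \<open>\<open>(R, \<delta>)\<close> is a right Kan extension of \<open>F : A \<rightarrow> D\<close> along \<open>K : A \<rightarrow> B\<close>, with
  \<open>\<delta> : R \<circ> K \<Rightarrow> F\<close>.\<close>

definition is_right_kan_extension :: "('o, 'a) cat \<Rightarrow> ('p, 'b) cat \<Rightarrow> ('q, 'c) cat \<Rightarrow>
    ('o, 'a, 'p, 'b) func \<Rightarrow> ('o, 'a, 'q, 'c) func \<Rightarrow> ('p, 'b, 'q, 'c) func \<Rightarrow>
    ('o \<Rightarrow> 'c) \<Rightarrow> bool" where
  "is_right_kan_extension A B D K F R \<delta> \<longleftrightarrow>
     is_functor A B K \<and> is_functor A D F \<and> is_functor B D R \<and>
     is_nat_trans A D (comp_functor R K) F \<delta> \<and>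
     (\<forall>S \<gamma>. is_functor B D S \<and> is_nat_trans A D (comp_functor S K) F \<gamma> \<longrightarrow>
        (\<exists>!\<alpha>. is_nat_trans B D S R \<alpha> \<and> vcomp A D \<delta> (whisker A \<alpha> K) = \<gamma>))"


section \<open>Subcategories, slice and arrow categories\<close>

definition full_subcat :: "('o, 'a) cat \<Rightarrow> 'o set \<Rightarrow> ('o, 'a) cat" where
  "full_subcat C S = C\<lparr>Obj := Obj C \<inter> S,
     Arr := {f \<in> Arr C. Dom C f \<in> S \<and> Cod C f \<in> S}\<rparr>"

definition is_full_subcategory :: "('o, 'a) cat \<Rightarrow> ('o, 'a) cat \<Rightarrow> bool" where
  "is_full_subcategory X C \<longleftrightarrow> is_category X \<and> is_category C \<and>
     Obj X \<subseteq> Obj C \<and>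
     Arr X = {f \<in> Arr C. Dom C f \<in> Obj X \<and> Cod C f \<in> Obj X} \<and>
     (\<forall>f\<in>Arr X. Dom X f = Dom C f \<and> Cod X f = Cod C f) \<and>
     (\<forall>a\<in>Obj X. Ide X a = Ide C a) \<and>
     (\<forall>f\<in>Arr X. \<forall>g\<in>Arr X. Cod X f = Dom X g \<longrightarrow> g \<cdot>\<^bsub>X\<^esub> f = g \<cdot>\<^bsub>C\<^esub> f)"

definition is_inclusion :: "('o, 'a) cat \<Rightarrow> ('o, 'a, 'o, 'a) func \<Rightarrow> bool" where
  "is_inclusion X H \<longleftrightarrow> (\<forall>a\<in>Obj X. FObj H a = a) \<and> (\<forall>f\<in>Arr X. FArr H f = f)"

text \<open>A morphism in a slice category (and below in other categories of structured objects) is a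
  triple of source, underlying morphism, and target, so that source and target are determined.\<close>

definition slice :: "('o, 'a) cat \<Rightarrow> 'o \<Rightarrow> ('a, 'a \<times> 'a \<times> 'a) cat" where
  "slice C B = \<lparr>
     Obj = {f \<in> Arr C. Cod C f = B},
     Arr = {(f, h, g). f \<in> Arr C \<and> Cod C f = B \<and> g \<in> Arr C \<and> Cod C g = B \<and>
              h \<in> hom C (Dom C f) (Dom C g) \<and> g \<cdot>\<^bsub>C\<^esub> h = f},
     Dom = (\<lambda>(f, h, g). f),
     Cod = (\<lambda>(f, h, g). g),
     Ide = (\<lambda>f. (f, Ide C (Dom C f), f)),
     Comp = (\<lambda>(g', k, l) (f, h, g). (f, k \<cdot>\<^bsub>C\<^esub> h, l))\<rparr>"

definition slice_in :: "('o, 'a) cat \<Rightarrow> 'a set \<Rightarrow> 'o \<Rightarrow> ('a, 'a \<times> 'a \<times> 'a) cat" where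
  "slice_in C M B = full_subcat (slice C B) M"

definition arrow_cat :: "('o, 'a) cat \<Rightarrow> ('a, 'a \<times> ('a \<times> 'a) \<times> 'a) cat" where
  "arrow_cat C = \<lparr>
     Obj = Arr C,
     Arr = {(p, (f, b), p'). p \<in> Arr C \<and> p' \<in> Arr C \<and>
              f \<in> hom C (Dom C p) (Dom C p') \<and> b \<in> hom C (Cod C p) (Cod C p') \<and>
              p' \<cdot>\<^bsub>C\<^esub> f = b \<cdot>\<^bsub>C\<^esub> p},
     Dom = (\<lambda>(p, fb, p'). p),
     Cod = (\<lambda>(p, fb, p'). p'),
     Ide = (\<lambda>p. (p, (Ide C (Dom C p), Ide C (Cod C p)), p)),
     Comp = (\<lambda>(q, (g, c), r) (p, (f, b), p'). (p, (g \<cdot>\<^bsub>C\<^esub> f, c \<cdot>\<^bsub>C\<^esub> b), r))\<rparr>"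


section \<open>Limits\<close>

definition is_cone :: "('o, 'a) cat \<Rightarrow> ('i, 'j) cat \<Rightarrow> ('i, 'j, 'o, 'a) func \<Rightarrow> 'o \<Rightarrow>
    ('i \<Rightarrow> 'a) \<Rightarrow> bool" where
  "is_cone C J D c \<pi> \<longleftrightarrow> c \<in> Obj C \<and>
     (\<forall>j\<in>Obj J. \<pi> j \<in> hom C c (FObj D j)) \<and>
     (\<forall>f\<in>Arr J. FArr D f \<cdot>\<^bsub>C\<^esub> \<pi> (Dom J f) = \<pi> (Cod J f))"

definition is_limit :: "('o, 'a) cat \<Rightarrow> ('i, 'j) cat \<Rightarrow> ('i, 'j, 'o, 'a) func \<Rightarrow> 'o \<Rightarrow>
    ('i \<Rightarrow> 'a) \<Rightarrow> bool" where
  "is_limit C J D c \<pi> \<longleftrightarrow> is_cone C J D c \<pi> \<and>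
     (\<forall>x \<xi>. is_cone C J D x \<xi> \<longrightarrow>
        (\<exists>!h. h \<in> hom C x c \<and> (\<forall>j\<in>Obj J. \<pi> j \<cdot>\<^bsub>C\<^esub> h = \<xi> j)))"

text \<open>Every finite category is isomorphic to one with natural numbers as objects and as morphisms.\<close>

definition finitely_complete :: "('o, 'a) cat \<Rightarrow> bool" where
  "finitely_complete C \<longleftrightarrow>
     (\<forall>(J :: (nat, nat) cat) D. finite (Obj J) \<and> finite (Arr J) \<and> is_functor J C D \<longrightarrow>
        (\<exists>c \<pi>. is_limit C J D c \<pi>))"

text \<open>\<open>is_pullback C f g p q\<close> says that \<open>f p = g q\<close> is a pullback square; thus \<open>q\<close> is the
  pullback of \<open>f\<close> along \<open>g\<close>.\<close>

definition is_pullback :: "('o, 'a) cat \<Rightarrow> 'a \<Rightarrow> 'a \<Rightarrow> 'a \<Rightarrow> 'a \<Rightarrow> bool" where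
  "is_pullback C f g p q \<longleftrightarrow>
     f \<in> Arr C \<and> g \<in> Arr C \<and> Cod C f = Cod C g \<and>
     p \<in> Arr C \<and> q \<in> Arr C \<and> Dom C p = Dom C q \<and> Cod C p = Dom C f \<and> Cod C q = Dom C g \<and>
     f \<cdot>\<^bsub>C\<^esub> p = g \<cdot>\<^bsub>C\<^esub> q \<and>
     (\<forall>x\<in>Arr C. \<forall>y\<in>Arr C. Dom C x = Dom C y \<and> Cod C x = Dom C f \<and> Cod C y = Dom C g \<and>
        f \<cdot>\<^bsub>C\<^esub> x = g \<cdot>\<^bsub>C\<^esub> y \<longrightarrow>
        (\<exists>!h. h \<in> hom C (Dom C x) (Dom C p) \<and> p \<cdot>\<^bsub>C\<^esub> h = x \<and> q \<cdot>\<^bsub>C\<^esub> h = y))"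

definition pb :: "('o, 'a) cat \<Rightarrow> 'a \<Rightarrow> 'a \<Rightarrow> 'a \<times> 'a" where
  "pb C f g = (SOME (p, q). is_pullback C f g p q)"

definition pb_fst :: "('o, 'a) cat \<Rightarrow> 'a \<Rightarrow> 'a \<Rightarrow> 'a" where
  "pb_fst C f g = fst (pb C f g)"

definition pb_snd :: "('o, 'a) cat \<Rightarrow> 'a \<Rightarrow> 'a \<Rightarrow> 'a" where
  "pb_snd C f g = snd (pb C f g)"

definition pb_tuple :: "('o, 'a) cat \<Rightarrow> 'a \<Rightarrow> 'a \<Rightarrow> 'a \<Rightarrow> 'a \<Rightarrow> 'a" where
  "pb_tuple C f g x y = (THE h. h \<in> hom C (Dom C x) (Dom C (pb_fst C f g)) \<and>
     pb_fst C f g \<cdot>\<^bsub>C\<^esub> h = x \<and> pb_snd C f g \<cdot>\<^bsub>C\<^esub> h = y)"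

definition pullback_stable :: "('o, 'a) cat \<Rightarrow> 'a set \<Rightarrow> bool" where
  "pullback_stable C M \<longleftrightarrow> (\<forall>f\<in>M. \<forall>g\<in>Arr C. Cod C f = Cod C g \<longrightarrow>
     (\<exists>p q. is_pullback C f g p q) \<and> (\<forall>p q. is_pullback C f g p q \<longrightarrow> q \<in> M))"

definition is_terminal :: "('o, 'a) cat \<Rightarrow> 'o \<Rightarrow> bool" where
  "is_terminal C t \<longleftrightarrow> t \<in> Obj C \<and> (\<forall>a\<in>Obj C. \<exists>!f. f \<in> hom C a t)"

definition is_initial :: "('o, 'a) cat \<Rightarrow> 'o \<Rightarrow> bool" where
  "is_initial C s \<longleftrightarrow> s \<in> Obj C \<and> (\<forall>a\<in>Obj C. \<exists>!f. f \<in> hom C s a)"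

definition is_zero_object :: "('o, 'a) cat \<Rightarrow> 'o \<Rightarrow> bool" where
  "is_zero_object C z \<longleftrightarrow> is_initial C z \<and> is_terminal C z"

definition pointed :: "('o, 'a) cat \<Rightarrow> bool" where
  "pointed C \<longleftrightarrow> (\<exists>z. is_zero_object C z)"

definition is_zero_arr :: "('o, 'a) cat \<Rightarrow> 'a \<Rightarrow> bool" where
  "is_zero_arr C f \<longleftrightarrow> f \<in> Arr C \<and> (\<exists>z g h. is_zero_object C z \<and>
     g \<in> hom C (Dom C f) z \<and> h \<in> hom C z (Cod C f) \<and> f = h \<cdot>\<^bsub>C\<^esub> g)"

definition zero_arr :: "('o, 'a) cat \<Rightarrow> 'o \<Rightarrow> 'o \<Rightarrow> 'a" where
  "zero_arr C a b = (THE f. f \<in> hom C a b \<and> is_zero_arr C f)"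

definition is_kernel :: "('o, 'a) cat \<Rightarrow> 'a \<Rightarrow> 'a \<Rightarrow> bool" where
  "is_kernel C f k \<longleftrightarrow> f \<in> Arr C \<and> k \<in> Arr C \<and> Cod C k = Dom C f \<and>
     is_zero_arr C (f \<cdot>\<^bsub>C\<^esub> k) \<and>
     (\<forall>x\<in>Arr C. Cod C x = Dom C f \<and> is_zero_arr C (f \<cdot>\<^bsub>C\<^esub> x) \<longrightarrow>
        (\<exists>!h. h \<in> hom C (Dom C x) (Dom C k) \<and> k \<cdot>\<^bsub>C\<^esub> h = x))"

definition ker_arr :: "('o, 'a) cat \<Rightarrow> 'a \<Rightarrow> 'a" where
  "ker_arr C f = (SOME k. is_kernel C f k)"


section \<open>Internal groups\<close>

definition is_product :: "('o, 'a) cat \<Rightarrow> 'o \<Rightarrow> 'o \<Rightarrow> 'a \<Rightarrow> 'a \<Rightarrow> bool" where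
  "is_product C a b p q \<longleftrightarrow> p \<in> Arr C \<and> q \<in> Arr C \<and> Dom C p = Dom C q \<and>
     Cod C p = a \<and> Cod C q = b \<and>
     (\<forall>x\<in>Arr C. \<forall>y\<in>Arr C. Dom C x = Dom C y \<and> Cod C x = a \<and> Cod C y = b \<longrightarrow>
        (\<exists>!h. h \<in> hom C (Dom C x) (Dom C p) \<and> p \<cdot>\<^bsub>C\<^esub> h = x \<and> q \<cdot>\<^bsub>C\<^esub> h = y))"

definition pr :: "('o, 'a) cat \<Rightarrow> 'o \<Rightarrow> 'o \<Rightarrow> 'a \<times> 'a" where
  "pr C a b = (SOME (p, q). is_product C a b p q)"

definition pr1 :: "('o, 'a) cat \<Rightarrow> 'o \<Rightarrow> 'o \<Rightarrow> 'a" where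
  "pr1 C a b = fst (pr C a b)"

definition pr2 :: "('o, 'a) cat \<Rightarrow> 'o \<Rightarrow> 'o \<Rightarrow> 'a" where
  "pr2 C a b = snd (pr C a b)"

definition prod_obj :: "('o, 'a) cat \<Rightarrow> 'o \<Rightarrow> 'o \<Rightarrow> 'o" where
  "prod_obj C a b = Dom C (pr1 C a b)"

definition tuple :: "('o, 'a) cat \<Rightarrow> 'a \<Rightarrow> 'a \<Rightarrow> 'a" where
  "tuple C x y = (THE h. h \<in> hom C (Dom C x) (prod_obj C (Cod C x) (Cod C y)) \<and>
     pr1 C (Cod C x) (Cod C y) \<cdot>\<^bsub>C\<^esub> h = x \<and> pr2 C (Cod C x) (Cod C y) \<cdot>\<^bsub>C\<^esub> h = y)"

definition one_obj :: "('o, 'a) cat \<Rightarrow> 'o" where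
  "one_obj C = (SOME t. is_terminal C t)"

definition to_one :: "('o, 'a) cat \<Rightarrow> 'o \<Rightarrow> 'a" where
  "to_one C a = (THE f. f \<in> hom C a (one_obj C))"

record ('o, 'a) internal_group =
  Carr :: 'o
  Mult :: 'a
  Unit :: 'a
  Inv :: 'a

definition is_internal_group :: "('o, 'a) cat \<Rightarrow> ('o, 'a) internal_group \<Rightarrow> bool" where
  "is_internal_group X G \<longleftrightarrow>
     (let c = Carr G; m = Mult G; e = Unit G; i = Inv G; id = Ide X c;
          c2 = prod_obj X c c;
          x = pr1 X c c \<cdot>\<^bsub>X\<^esub> pr1 X c2 c; y = pr2 X c c \<cdot>\<^bsub>X\<^esub> pr1 X c2 c; z = pr2 X c2 c;
          u = e \<cdot>\<^bsub>X\<^esub> to_one X c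
      in c \<in> Obj X \<and> m \<in> hom X c2 c \<and> e \<in> hom X (one_obj X) c \<and> i \<in> hom X c c \<and>
         m \<cdot>\<^bsub>X\<^esub> tuple X (m \<cdot>\<^bsub>X\<^esub> tuple X x y) z = m \<cdot>\<^bsub>X\<^esub> tuple X x (m \<cdot>\<^bsub>X\<^esub> tuple X y z) \<and>
         m \<cdot>\<^bsub>X\<^esub> tuple X u id = id \<and> m \<cdot>\<^bsub>X\<^esub> tuple X id u = id \<and>
         m \<cdot>\<^bsub>X\<^esub> tuple X i id = u \<and> m \<cdot>\<^bsub>X\<^esub> tuple X id i = u)"

definition Gp :: "('o, 'a) cat \<Rightarrow> (('o, 'a) internal_group,
    ('o, 'a) internal_group \<times> 'a \<times> ('o, 'a) internal_group) cat" where
  "Gp X = \<lparr>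
     Obj = {G. is_internal_group X G},
     Arr = {(G, h, G'). is_internal_group X G \<and> is_internal_group X G' \<and>
              h \<in> hom X (Carr G) (Carr G') \<and>
              h \<cdot>\<^bsub>X\<^esub> Mult G = Mult G' \<cdot>\<^bsub>X\<^esub>
                tuple X (h \<cdot>\<^bsub>X\<^esub> pr1 X (Carr G) (Carr G)) (h \<cdot>\<^bsub>X\<^esub> pr2 X (Carr G) (Carr G))},
     Dom = (\<lambda>(G, h, G'). G),
     Cod = (\<lambda>(G, h, G'). G'),
     Ide = (\<lambda>G. (G, Ide X (Carr G), G)),
     Comp = (\<lambda>(G', k, G'') (G, h, _). (G, k \<cdot>\<^bsub>X\<^esub> h, G''))\<rparr>"

definition underlying :: "(('o, 'a) internal_group,
    ('o, 'a) internal_group \<times> 'a \<times> ('o, 'a) internal_group, 'o, 'a) func" where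
  "underlying = \<lparr>FObj = Carr, FArr = (\<lambda>(G, h, G'). h)\<rparr>"


section \<open>Monadic functors\<close>

text \<open>The Eilenberg--Moore category of a monad \<open>(T, \<eta>, \<mu>)\<close> on \<open>B\<close>.\<close>

definition is_algebra :: "('p, 'b) cat \<Rightarrow> ('p, 'b, 'p, 'b) func \<Rightarrow> ('p \<Rightarrow> 'b) \<Rightarrow> ('p \<Rightarrow> 'b) \<Rightarrow>
    'p \<times> 'b \<Rightarrow> bool" where
  "is_algebra B T \<eta> \<mu> = (\<lambda>(x, a). x \<in> Obj B \<and> a \<in> hom B (FObj T x) x \<and>
     a \<cdot>\<^bsub>B\<^esub> \<eta> x = Ide B x \<and> a \<cdot>\<^bsub>B\<^esub> FArr T a = a \<cdot>\<^bsub>B\<^esub> \<mu> x)"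

definition EM :: "('p, 'b) cat \<Rightarrow> ('p, 'b, 'p, 'b) func \<Rightarrow> ('p \<Rightarrow> 'b) \<Rightarrow> ('p \<Rightarrow> 'b) \<Rightarrow>
    ('p \<times> 'b, ('p \<times> 'b) \<times> 'b \<times> ('p \<times> 'b)) cat" where
  "EM B T \<eta> \<mu> = \<lparr>
     Obj = {xa. is_algebra B T \<eta> \<mu> xa},
     Arr = {(xa, h, yb). is_algebra B T \<eta> \<mu> xa \<and> is_algebra B T \<eta> \<mu> yb \<and>
              h \<in> hom B (fst xa) (fst yb) \<and>
              h \<cdot>\<^bsub>B\<^esub> snd xa = snd yb \<cdot>\<^bsub>B\<^esub> FArr T h},
     Dom = (\<lambda>(xa, h, yb). xa),
     Cod = (\<lambda>(xa, h, yb). yb),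
     Ide = (\<lambda>xa. (xa, Ide B (fst xa), xa)),
     Comp = (\<lambda>(_, k, zc) (xa, h, _). (xa, k \<cdot>\<^bsub>B\<^esub> h, zc))\<rparr>"

definition comparison :: "('o, 'a) cat \<Rightarrow> ('o, 'a, 'p, 'b) func \<Rightarrow> ('o \<Rightarrow> 'a) \<Rightarrow>
    ('o, 'a, 'p \<times> 'b, ('p \<times> 'b) \<times> 'b \<times> ('p \<times> 'b)) func" where
  "comparison A U \<epsilon> = \<lparr>
     FObj = (\<lambda>a. (FObj U a, FArr U (\<epsilon> a))),
     FArr = (\<lambda>f. ((FObj U (Dom A f), FArr U (\<epsilon> (Dom A f))), FArr U f,
                  (FObj U (Cod A f), FArr U (\<epsilon> (Cod A f)))))\<rparr>"

definition is_monadic :: "('o, 'a) cat \<Rightarrow> ('p, 'b) cat \<Rightarrow> ('o, 'a, 'p, 'b) func \<Rightarrow> bool" where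
  "is_monadic A B U \<longleftrightarrow> (\<exists>L \<eta> \<epsilon>. is_adjunction B A L U \<eta> \<epsilon> \<and>
     is_equivalence A (EM B (comp_functor U L) \<eta> (\<lambda>b\<in>Obj B. FArr U (\<epsilon> (FObj L b))))
       (comparison A U \<epsilon>))"


section \<open>Galois structures\<close>

record ('o, 'a, 'p, 'b) galois =
  Base :: "('o, 'a) cat"
  Target :: "('p, 'b) cat"
  RightAdj :: "('p, 'b, 'o, 'a) func"
  LeftAdj :: "('o, 'a, 'p, 'b) func"
  EtaG :: "'o \<Rightarrow> 'a"
  EpsG :: "'p \<Rightarrow> 'b"
  FibE :: "'a set"
  FibF :: "'b set"

definition fibration_class :: "('o, 'a) cat \<Rightarrow> 'a set \<Rightarrow> bool" where
  "fibration_class C M \<longleftrightarrow> M \<subseteq> Arr C \<and> (\<forall>f. is_iso C f \<longrightarrow> f \<in> M) \<and>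
     pullback_stable C M \<and>
     (\<forall>f\<in>M. \<forall>g\<in>M. Cod C f = Dom C g \<longrightarrow> g \<cdot>\<^bsub>C\<^esub> f \<in> M)"

definition is_galois_structure :: "('o, 'a, 'p, 'b) galois \<Rightarrow> bool" where
  "is_galois_structure \<Gamma> \<longleftrightarrow>
     is_adjunction (Base \<Gamma>) (Target \<Gamma>) (LeftAdj \<Gamma>) (RightAdj \<Gamma>) (EtaG \<Gamma>) (EpsG \<Gamma>) \<and>
     fibration_class (Base \<Gamma>) (FibE \<Gamma>) \<and> fibration_class (Target \<Gamma>) (FibF \<Gamma>) \<and>
     FArr (RightAdj \<Gamma>) ` FibF \<Gamma> \<subseteq> FibE \<Gamma> \<and>
     FArr (LeftAdj \<Gamma>) ` FibE \<Gamma> \<subseteq> FibF \<Gamma>"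

text \<open>\<open>p\<^sup>*\<close>, sending \<open>f\<close> to its pullback along \<open>p\<close>.\<close>

definition pullback_functor :: "('o, 'a) cat \<Rightarrow> 'a \<Rightarrow> ('a, 'a \<times> 'a \<times> 'a, 'a, 'a \<times> 'a \<times> 'a) func"
  where
  "pullback_functor C p = \<lparr>
     FObj = (\<lambda>f. pb_snd C f p),
     FArr = (\<lambda>(f, h, g). (pb_snd C f p,
               pb_tuple C g p (h \<cdot>\<^bsub>C\<^esub> pb_fst C f p) (pb_snd C f p), pb_snd C g p))\<rparr>"

definition slice_functor :: "('p, 'b, 'o, 'a) func \<Rightarrow>
    ('b, 'b \<times> 'b \<times> 'b, 'a, 'a \<times> 'a \<times> 'a) func" where
  "slice_functor H = \<lparr>FObj = FArr H, FArr = (\<lambda>(f, h, g). (FArr H f, FArr H h, FArr H g))\<rparr>"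

definition HB :: "('o, 'a, 'p, 'b) galois \<Rightarrow> 'o \<Rightarrow> ('b, 'b \<times> 'b \<times> 'b, 'a, 'a \<times> 'a \<times> 'a) func"
  where
  "HB \<Gamma> B = comp_functor (pullback_functor (Base \<Gamma>) (EtaG \<Gamma> B)) (slice_functor (RightAdj \<Gamma>))"

definition admissible :: "('o, 'a, 'p, 'b) galois \<Rightarrow> bool" where
  "admissible \<Gamma> \<longleftrightarrow> (\<forall>B\<in>Obj (Base \<Gamma>).
     let S = slice_in (Target \<Gamma>) (FibF \<Gamma>) (FObj (LeftAdj \<Gamma>) B);
         T = slice_in (Base \<Gamma>) (FibE \<Gamma>) B
     in is_full S T (HB \<Gamma> B) \<and> is_faithful S T (HB \<Gamma> B))"

definition HI :: "('o, 'a, 'p, 'b) galois \<Rightarrow> ('o, 'a, 'o, 'a) func" where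
  "HI \<Gamma> = comp_functor (RightAdj \<Gamma>) (LeftAdj \<Gamma>)"

definition trivial_covering :: "('o, 'a, 'p, 'b) galois \<Rightarrow> 'a \<Rightarrow> bool" where
  "trivial_covering \<Gamma> f \<longleftrightarrow> f \<in> FibE \<Gamma> \<and>
     is_pullback (Base \<Gamma>) (FArr (HI \<Gamma>) f) (EtaG \<Gamma> (Cod (Base \<Gamma>) f))
       (EtaG \<Gamma> (Dom (Base \<Gamma>) f)) f"

definition monadic_extension :: "('o, 'a, 'p, 'b) galois \<Rightarrow> 'a \<Rightarrow> bool" where
  "monadic_extension \<Gamma> p \<longleftrightarrow> p \<in> FibE \<Gamma> \<and>
     is_monadic (slice_in (Base \<Gamma>) (FibE \<Gamma>) (Cod (Base \<Gamma>) p))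
       (slice_in (Base \<Gamma>) (FibE \<Gamma>) (Dom (Base \<Gamma>) p)) (pullback_functor (Base \<Gamma>) p)"

definition normal_extension :: "('o, 'a, 'p, 'b) galois \<Rightarrow> 'a \<Rightarrow> bool" where
  "normal_extension \<Gamma> p \<longleftrightarrow> monadic_extension \<Gamma> p \<and>
     trivial_covering \<Gamma> (FObj (pullback_functor (Base \<Gamma>) p) p)"

definition weakly_universal :: "('o, 'a, 'p, 'b) galois \<Rightarrow> 'a \<Rightarrow> bool" where
  "weakly_universal \<Gamma> u \<longleftrightarrow> normal_extension \<Gamma> u \<and>
     (\<forall>p. normal_extension \<Gamma> p \<and> Cod (Base \<Gamma>) p = Cod (Base \<Gamma>) u \<longrightarrow>
        (\<exists>e\<in>hom (Base \<Gamma>) (Dom (Base \<Gamma>) u) (Dom (Base \<Gamma>) p). p \<cdot>\<^bsub>Base \<Gamma>\<^esub> e = u))"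

definition NExt :: "('o, 'a, 'p, 'b) galois \<Rightarrow> ('a, 'a \<times> ('a \<times> 'a) \<times> 'a) cat" where
  "NExt \<Gamma> = full_subcat (arrow_cat (Base \<Gamma>)) {p. normal_extension \<Gamma> p}"

definition CodF :: "('o, 'a, 'p, 'b) galois \<Rightarrow> ('a, 'a \<times> ('a \<times> 'a) \<times> 'a, 'o, 'a) func" where
  "CodF \<Gamma> = \<lparr>FObj = Cod (Base \<Gamma>), FArr = (\<lambda>(p, (f, b), p'). b)\<rparr>"


section \<open>Kernels and Galois groups of normal extensions\<close>

text \<open>From here on \<open>Target \<Gamma>\<close> is a full reflective subcategory of \<open>Base \<Gamma>\<close> and \<open>RightAdj \<Gamma>\<close>
  its inclusion, which is suppressed. The subcategory need not be replete, so the kernel of a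
  normal extension is chosen among those whose domain is an object of \<open>Target \<Gamma>\<close>.\<close>

definition nker :: "('o, 'a, 'o, 'a) galois \<Rightarrow> 'a \<Rightarrow> 'a" where
  "nker \<Gamma> p = (SOME k. is_kernel (Base \<Gamma>) p k \<and> Dom (Base \<Gamma>) k \<in> Obj (Target \<Gamma>))"

definition KerF :: "('o, 'a, 'o, 'a) galois \<Rightarrow> ('a, 'a \<times> ('a \<times> 'a) \<times> 'a, 'o, 'a) func" where
  "KerF \<Gamma> = (let C = Base \<Gamma> in \<lparr>
     FObj = (\<lambda>p. Dom C (nker \<Gamma> p)),
     FArr = (\<lambda>(p, (f, b), p').
       THE m. m \<in> hom C (Dom C (nker \<Gamma> p)) (Dom C (nker \<Gamma> p')) \<and>
              nker \<Gamma> p' \<cdot>\<^bsub>C\<^esub> m = f \<cdot>\<^bsub>C\<^esub> nker \<Gamma> p)\<rparr>)"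

text \<open>The kernel pair \<open>Eq(p)\<close> as an internal groupoid with domain \<open>eq_d\<close> and codomain \<open>eq_c\<close>:
  in terms of elements, \<open>(x, y)\<close> is a morphism from \<open>x\<close> to \<open>y\<close>, and the composition
  \<open>eq_comp\<close> on the pullback of \<open>eq_c\<close> and \<open>eq_d\<close> sends \<open>((x, y), (y, z))\<close> to \<open>(x, z)\<close>.\<close>

definition eq_d :: "('o, 'a) cat \<Rightarrow> 'a \<Rightarrow> 'a" where
  "eq_d C p = pb_fst C p p"

definition eq_c :: "('o, 'a) cat \<Rightarrow> 'a \<Rightarrow> 'a" where
  "eq_c C p = pb_snd C p p"

definition eq_obj :: "('o, 'a) cat \<Rightarrow> 'a \<Rightarrow> 'o" where
  "eq_obj C p = Dom C (eq_d C p)"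

definition eq_unit :: "('o, 'a) cat \<Rightarrow> 'a \<Rightarrow> 'a" where
  "eq_unit C p = pb_tuple C p p (Ide C (Dom C p)) (Ide C (Dom C p))"

definition eq_inv :: "('o, 'a) cat \<Rightarrow> 'a \<Rightarrow> 'a" where
  "eq_inv C p = pb_tuple C p p (eq_c C p) (eq_d C p)"

definition eq_pr1 :: "('o, 'a) cat \<Rightarrow> 'a \<Rightarrow> 'a" where
  "eq_pr1 C p = pb_fst C (eq_c C p) (eq_d C p)"

definition eq_pr2 :: "('o, 'a) cat \<Rightarrow> 'a \<Rightarrow> 'a" where
  "eq_pr2 C p = pb_snd C (eq_c C p) (eq_d C p)"

definition eq_comp :: "('o, 'a) cat \<Rightarrow> 'a \<Rightarrow> 'a" where
  "eq_comp C p = pb_tuple C p p (eq_d C p \<cdot>\<^bsub>C\<^esub> eq_pr1 C p) (eq_c C p \<cdot>\<^bsub>C\<^esub> eq_pr2 C p)"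

definition eq_map :: "('o, 'a) cat \<Rightarrow> 'a \<Rightarrow> 'a \<Rightarrow> 'a \<Rightarrow> 'a" where
  "eq_map C p f p' = pb_tuple C p' p' (f \<cdot>\<^bsub>C\<^esub> eq_d C p) (f \<cdot>\<^bsub>C\<^esub> eq_c C p)"

text \<open>The inclusion of \<open>Ker(I(d)) \<inter> Ker(I(c))\<close> into \<open>I(Eq(p))\<close>, formed in \<open>Target \<Gamma>\<close>.\<close>

definition gal_incl :: "('o, 'a, 'o, 'a) galois \<Rightarrow> 'a \<Rightarrow> 'a" where
  "gal_incl \<Gamma> p = (let C = Base \<Gamma>; X = Target \<Gamma>; I = LeftAdj \<Gamma>;
       kd = ker_arr X (FArr I (eq_d C p)); kc = ker_arr X (FArr I (eq_c C p))
     in kd \<cdot>\<^bsub>X\<^esub> pb_fst X kd kc)"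

definition gal_obj :: "('o, 'a, 'o, 'a) galois \<Rightarrow> 'a \<Rightarrow> 'o" where
  "gal_obj \<Gamma> p = Dom (Target \<Gamma>) (gal_incl \<Gamma> p)"

text \<open>The multiplication is the restriction of the composition \<open>I(eq_comp)\<close>, since
  \<open>I(eq_pr1)\<close> and \<open>I(eq_pr2)\<close> exhibit the object of composable pairs of the Galois groupoid.\<close>

definition gal_mult :: "('o, 'a, 'o, 'a) galois \<Rightarrow> 'a \<Rightarrow> 'a" where
  "gal_mult \<Gamma> p = (let C = Base \<Gamma>; X = Target \<Gamma>; I = LeftAdj \<Gamma>;
       g = gal_obj \<Gamma> p; j = gal_incl \<Gamma> p;
       w = (THE w. w \<in> hom X (prod_obj X g g) (FObj I (Dom C (eq_pr1 C p))) \<and>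
              FArr I (eq_pr1 C p) \<cdot>\<^bsub>X\<^esub> w = j \<cdot>\<^bsub>X\<^esub> pr1 X g g \<and>
              FArr I (eq_pr2 C p) \<cdot>\<^bsub>X\<^esub> w = j \<cdot>\<^bsub>X\<^esub> pr2 X g g)
     in THE m. m \<in> hom X (prod_obj X g g) g \<and> j \<cdot>\<^bsub>X\<^esub> m = FArr I (eq_comp C p) \<cdot>\<^bsub>X\<^esub> w)"

definition gal_unit :: "('o, 'a, 'o, 'a) galois \<Rightarrow> 'a \<Rightarrow> 'a" where
  "gal_unit \<Gamma> p = (let C = Base \<Gamma>; X = Target \<Gamma>; I = LeftAdj \<Gamma>
     in THE e. e \<in> hom X (one_obj X) (gal_obj \<Gamma> p) \<and>
          gal_incl \<Gamma> p \<cdot>\<^bsub>X\<^esub> e =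
            FArr I (eq_unit C p) \<cdot>\<^bsub>X\<^esub> zero_arr X (one_obj X) (FObj I (Dom C p)))"

definition gal_inv :: "('o, 'a, 'o, 'a) galois \<Rightarrow> 'a \<Rightarrow> 'a" where
  "gal_inv \<Gamma> p = (let C = Base \<Gamma>; X = Target \<Gamma>; I = LeftAdj \<Gamma>
     in THE i. i \<in> hom X (gal_obj \<Gamma> p) (gal_obj \<Gamma> p) \<and>
          gal_incl \<Gamma> p \<cdot>\<^bsub>X\<^esub> i = FArr I (eq_inv C p) \<cdot>\<^bsub>X\<^esub> gal_incl \<Gamma> p)"

definition gal_group :: "('o, 'a, 'o, 'a) galois \<Rightarrow> 'a \<Rightarrow> ('o, 'a) internal_group" where
  "gal_group \<Gamma> p =
     \<lparr>Carr = gal_obj \<Gamma> p, Mult = gal_mult \<Gamma> p, Unit = gal_unit \<Gamma> p, Inv = gal_inv \<Gamma> p\<rparr>"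

definition gal_map :: "('o, 'a, 'o, 'a) galois \<Rightarrow> 'a \<Rightarrow> 'a \<Rightarrow> 'a \<Rightarrow> 'a" where
  "gal_map \<Gamma> p f p' = (let C = Base \<Gamma>; X = Target \<Gamma>; I = LeftAdj \<Gamma>
     in THE m. m \<in> hom X (gal_obj \<Gamma> p) (gal_obj \<Gamma> p') \<and>
          gal_incl \<Gamma> p' \<cdot>\<^bsub>X\<^esub> m = FArr I (eq_map C p f p') \<cdot>\<^bsub>X\<^esub> gal_incl \<Gamma> p)"

definition Gal :: "('o, 'a, 'o, 'a) galois \<Rightarrow> ('a, 'a \<times> ('a \<times> 'a) \<times> 'a,
    ('o, 'a) internal_group, ('o, 'a) internal_group \<times> 'a \<times> ('o, 'a) internal_group) func" where
  "Gal \<Gamma> = \<lparr>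
     FObj = gal_group \<Gamma>,
     FArr = (\<lambda>(p, (f, b), p'). (gal_group \<Gamma> p, gal_map \<Gamma> p f p', gal_group \<Gamma> p'))\<rparr>"

text \<open>The inclusion of \<open>Ker(p) \<inter> Ker(\<eta>\<^sub>E)\<close> into \<open>Ker(p)\<close>, for \<open>p : E \<rightarrow> B\<close>.\<close>

definition ker_eta_incl :: "('o, 'a, 'o, 'a) galois \<Rightarrow> 'a \<Rightarrow> 'a" where
  "ker_eta_incl \<Gamma> p = (let C = Base \<Gamma>
     in pb_fst C (nker \<Gamma> p) (ker_arr C (EtaG \<Gamma> (Dom C p))))"

text \<open>The canonical isomorphism from \<open>Ker(p) \<inter> Ker(\<eta>\<^sub>E)\<close> to the Galois group: the restriction of
  \<open>\<eta> \<circ> \<langle>0, ker p\<rangle> : Ker(p) \<rightarrow> I(Eq(p))\<close>.\<close>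

definition gal_canon :: "('o, 'a, 'o, 'a) galois \<Rightarrow> 'a \<Rightarrow> 'a" where
  "gal_canon \<Gamma> p = (let C = Base \<Gamma>; k = nker \<Gamma> p;
       t = pb_tuple C p p (zero_arr C (Dom C k) (Dom C p)) k
     in THE \<phi>. \<phi> \<in> hom C (Dom C (ker_eta_incl \<Gamma> p)) (gal_obj \<Gamma> p) \<and>
          gal_incl \<Gamma> p \<cdot>\<^bsub>C\<^esub> \<phi> =
            (EtaG \<Gamma> (eq_obj C p) \<cdot>\<^bsub>C\<^esub> t) \<cdot>\<^bsub>C\<^esub> ker_eta_incl \<Gamma> p)"

definition iota :: "('o, 'a, 'o, 'a) galois \<Rightarrow> 'a \<Rightarrow> 'a" where
  "iota \<Gamma> = (\<lambda>p\<in>Obj (NExt \<Gamma>).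
     ker_eta_incl \<Gamma> p \<cdot>\<^bsub>Base \<Gamma>\<^esub> inv_arr (Base \<Gamma>) (gal_canon \<Gamma> p))"


section \<open>The fundamental group\<close>

definition wuniv :: "('o, 'a, 'o, 'a) galois \<Rightarrow> 'o \<Rightarrow> 'a" where
  "wuniv \<Gamma> B = (SOME u. weakly_universal \<Gamma> u \<and> Cod (Base \<Gamma>) u = B)"

definition wuniv_lift :: "('o, 'a, 'o, 'a) galois \<Rightarrow> 'a \<Rightarrow> 'a" where
  "wuniv_lift \<Gamma> f = (let v = wuniv \<Gamma> (Dom (Base \<Gamma>) f); u = wuniv \<Gamma> (Cod (Base \<Gamma>) f)
     in SOME g. (v, (g, f), u) \<in> Arr (NExt \<Gamma>))"

definition fundamental_group :: "('o, 'a, 'o, 'a) galois \<Rightarrow> ('o, 'a,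
    ('o, 'a) internal_group, ('o, 'a) internal_group \<times> 'a \<times> ('o, 'a) internal_group) func" where
  "fundamental_group \<Gamma> = \<lparr>
     FObj = (\<lambda>B. FObj (Gal \<Gamma>) (wuniv \<Gamma> B)),
     FArr = (\<lambda>f. FArr (Gal \<Gamma>)
       (wuniv \<Gamma> (Dom (Base \<Gamma>) f), (wuniv_lift \<Gamma> f, f), wuniv \<Gamma> (Cod (Base \<Gamma>) f)))\<rparr>"

definition pi1 :: "('o, 'a, 'o, 'a) galois \<Rightarrow> ('o, 'a, 'o, 'a) func" where
  "pi1 \<Gamma> = comp_functor underlying (fundamental_group \<Gamma>)"

definition wuniv_over :: "('o, 'a, 'o, 'a) galois \<Rightarrow> 'a \<Rightarrow> 'a" where
  "wuniv_over \<Gamma> p = (let C = Base \<Gamma>; u = wuniv \<Gamma> (Cod C p)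
     in SOME h. h \<in> hom C (Dom C u) (Dom C p) \<and> p \<cdot>\<^bsub>C\<^esub> h = u)"

definition kappa :: "('o, 'a, 'o, 'a) galois \<Rightarrow> 'a \<Rightarrow> 'a" where
  "kappa \<Gamma> = (\<lambda>p\<in>Obj (NExt \<Gamma>). FArr underlying (FArr (Gal \<Gamma>)
     (wuniv \<Gamma> (Cod (Base \<Gamma>) p),
      (wuniv_over \<Gamma> p, Ide (Base \<Gamma>) (Cod (Base \<Gamma>) p)), p)))"

definition delta :: "('o, 'a, 'o, 'a) galois \<Rightarrow> 'a \<Rightarrow> 'a" where
  "delta \<Gamma> = vcomp (NExt \<Gamma>) (Target \<Gamma>) (iota \<Gamma>) (kappa \<Gamma>)"

end

theory Submission
  imports Defs
begin

text \<open>
  Why the theorem is true. For a normal extension \<open>p : E \<rightarrow> B\<close> the Galois group embeds into \<open>E\<close> with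
  image \<open>Ker(p) \<inter> Ker(\<eta>\<^sub>E)\<close>; write \<open>i\<^sub>p\<close> for this monomorphism (\<open>iker\<close> below). Everything rests on
  three facts about it.

  \<^item> Two morphisms \<open>(f, b), (g, b) : p \<rightarrow> q\<close> over the same \<open>b\<close> satisfy \<open>f i\<^sub>p = g i\<^sub>p\<close>
    (\<open>iker_independent\<close>). The pair \<open>\<langle>f, g\<rangle>\<close> and the pair \<open>\<langle>f, f\<rangle>\<close> are arrows into \<open>Eq(q)\<close>; after
    \<open>i\<^sub>p\<close> they have the same first projection, and both are annihilated by \<open>\<eta>\<close>. The first projection
    is a trivial covering, so it and \<open>\<eta>\<close> are jointly monic on \<open>Eq(q)\<close>.

  \<^item> An arrow \<open>x\<close> into \<open>Ker(p)\<close> factors through the Galois group as soon as \<open>\<eta>\<^sub>E ker(p) x = 0\<close>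
    (\<open>iota_lift\<close>). Indeed \<open>\<eta> \<langle>0, ker p\<rangle>\<close> is a kernel of \<open>I(d)\<close>, again because \<open>d\<close> is a trivial
    covering, and composed with \<open>I(c)\<close> it becomes \<open>\<eta>\<^sub>E ker(p)\<close>.

  \<^item> For every transformation \<open>\<gamma> : S \<circ> Cod \<Rightarrow> Ker\<close> and every \<open>p\<close>, \<open>\<eta>\<^sub>E ker(p) \<gamma>\<^sub>p = 0\<close>
    (\<open>eta_gamma_zero\<close>). The arrow \<open>t : I(E) \<rightarrow> 0\<close> is a normal extension; its zero endomorphism and its
    identity lie over the same arrow, so naturality gives \<open>ker(t) \<gamma>\<^sub>t = 0\<close>, and naturality at
    \<open>(\<eta>\<^sub>E, 0) : p \<rightarrow> t\<close> transports this to \<open>p\<close>.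

  For the weakly universal \<open>u\<close> over \<open>B\<close> the component \<open>\<kappa>\<^sub>u\<close> is the identity by the first fact, so a
  solution \<open>\<alpha>\<close> must satisfy \<open>\<iota>\<^sub>u \<alpha>\<^sub>B = \<gamma>\<^sub>u\<close>. This determines \<open>\<alpha>\<^sub>B\<close>, as \<open>\<iota>\<^sub>u\<close> is monic, and such an
  arrow exists by the other two facts; its naturality and \<open>\<delta> \<alpha> = \<gamma>\<close> follow from the naturality of
  \<open>\<gamma>\<close> at lifts to weakly universal extensions.

  Two inputs take work. Lifting \<open>f : A \<rightarrow> B\<close> to weakly universal extensions requires that normal
  extensions are pullback-stable, hence that trivial coverings are; this is where admissibility
  enters, through \<open>trivial_covering_if_pullback\<close>. That \<open>I(E) \<rightarrow> 0\<close> is a monadic extension is an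
  instance of the monadicity of split fibrations (\<open>split_monadic\<close>), proved by descending an algebra
  along the section.

  The reflective subcategory need not be closed under isomorphism, so a limit formed in the base may
  lie outside of it; this is why limits in the two categories are compared explicitly.
\<close>

section \<open>Arrows, isomorphisms and pullback squares\<close>

locale category =
  fixes C :: "('o, 'a) cat" (structure)
  assumes category: "is_category C"
begin

lemma Dom_Obj [simp]: "f \<in> Arr C \<Longrightarrow> Dom C f \<in> Obj C"
  and Cod_Obj [simp]: "f \<in> Arr C \<Longrightarrow> Cod C f \<in> Obj C"
  using category by (auto simp only: is_category_def)

lemma Ide_Arr [simp]: "a \<in> Obj C \<Longrightarrow> Ide C a \<in> Arr C"
  and Dom_Ide [simp]: "a \<in> Obj C \<Longrightarrow> Dom C (Ide C a) = a"
  and Cod_Ide [simp]: "a \<in> Obj C \<Longrightarrow> Cod C (Ide C a) = a"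
  using category by (auto simp only: is_category_def hom_def)

lemma
  assumes "f \<in> Arr C" "g \<in> Arr C" "Cod C f = Dom C g"
  shows comp_Arr [simp]: "g \<cdot> f \<in> Arr C"
    and Dom_comp [simp]: "Dom C (g \<cdot> f) = Dom C f"
    and Cod_comp [simp]: "Cod C (g \<cdot> f) = Cod C g"
proof -
  have "\<forall>f\<in>Arr C. \<forall>g\<in>Arr C. Cod C f = Dom C g \<longrightarrow> g \<cdot> f \<in> hom C (Dom C f) (Cod C g)"
    using category unfolding is_category_def by (elim conjE)
  then have "g \<cdot> f \<in> hom C (Dom C f) (Cod C g)" using assms by blast
  then show "g \<cdot> f \<in> Arr C" "Dom C (g \<cdot> f) = Dom C f" "Cod C (g \<cdot> f) = Cod C g"
    unfolding hom_def by blast+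
qed

lemma comp_Ide [simp]: "f \<in> Arr C \<Longrightarrow> Dom C f = a \<Longrightarrow> f \<cdot> Ide C a = f"
  and Ide_comp [simp]: "f \<in> Arr C \<Longrightarrow> Cod C f = a \<Longrightarrow> Ide C a \<cdot> f = f"
  using category by (auto simp only: is_category_def)

lemma comp_assoc [simp]:
  assumes "f \<in> Arr C" "g \<in> Arr C" "h \<in> Arr C" "Cod C f = Dom C g" "Cod C g = Dom C h"
  shows "(h \<cdot> g) \<cdot> f = h \<cdot> (g \<cdot> f)"
proof -
  have "\<forall>f\<in>Arr C. \<forall>g\<in>Arr C. \<forall>h\<in>Arr C. Cod C f = Dom C g \<and> Cod C g = Dom C h \<longrightarrow>
      h \<cdot> (g \<cdot> f) = (h \<cdot> g) \<cdot> f"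
    using category unfolding is_category_def by (elim conjE)
  then show ?thesis using assms by simp
qed

text \<open>Composites are normalised by bracketing to the right, so that a known equation \<open>g \<cdot> f = k\<close> no
  longer matches inside a longer composite. The following two lemmas give its extended form.\<close>

lemma eq_extend: "g \<cdot> f = k \<Longrightarrow> f \<in> Arr C \<Longrightarrow> g \<in> Arr C \<Longrightarrow> Cod C f = Dom C g \<Longrightarrow>
    x \<in> Arr C \<Longrightarrow> Cod C x = Dom C f \<Longrightarrow> g \<cdot> (f \<cdot> x) = k \<cdot> x"
  using comp_assoc by metis

lemma square_extend: "g \<cdot> f = k \<cdot> l \<Longrightarrow> f \<in> Arr C \<Longrightarrow> g \<in> Arr C \<Longrightarrow> Cod C f = Dom C g \<Longrightarrow>
    l \<in> Arr C \<Longrightarrow> k \<in> Arr C \<Longrightarrow> Cod C l = Dom C k \<Longrightarrow> x \<in> Arr C \<Longrightarrow> Cod C x = Dom C f \<Longrightarrow>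
    Cod C x = Dom C l \<Longrightarrow> g \<cdot> (f \<cdot> x) = k \<cdot> (l \<cdot> x)"
  using comp_assoc by metis

lemma comp_in_hom: "f \<in> hom C a b \<Longrightarrow> g \<in> hom C b c \<Longrightarrow> g \<cdot> f \<in> hom C a c"
  by (simp add: hom_def)

lemma inverse_arrows_unique:
  assumes "inverse_arrows C f g" and "inverse_arrows C f g'"
  shows "g = g'"
proof -
  have *: "f \<in> Arr C" "g \<in> Arr C" "g' \<in> Arr C" "Dom C g = Cod C f" "Dom C g' = Cod C f"
      "Cod C g = Dom C f" "Cod C g' = Dom C f" "g \<cdot> f = Ide C (Dom C f)" "f \<cdot> g' = Ide C (Cod C f)"
    using assms by (auto simp: inverse_arrows_def hom_def)
  then have "g = (g \<cdot> f) \<cdot> g'" using comp_assoc[of g' f g] by simp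
  then show ?thesis using * by simp
qed

lemma inverse_inv_arr: "is_iso C f \<Longrightarrow> inverse_arrows C f (inv_arr C f)"
  unfolding inv_arr_def is_iso_def using inverse_arrows_unique by (metis (no_types, lifting) theI)

lemma inv_arr:
  assumes "is_iso C f"
  shows "f \<in> Arr C" "inv_arr C f \<in> Arr C" "Dom C (inv_arr C f) = Cod C f"
    "Cod C (inv_arr C f) = Dom C f" "inv_arr C f \<cdot> f = Ide C (Dom C f)"
    "f \<cdot> inv_arr C f = Ide C (Cod C f)"
  using inverse_inv_arr[OF assms] by (auto simp: inverse_arrows_def hom_def)

lemma inv_arr_comp [simp]:
    "is_iso C f \<Longrightarrow> x \<in> Arr C \<Longrightarrow> Cod C x = Dom C f \<Longrightarrow> inv_arr C f \<cdot> (f \<cdot> x) = x"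
  and comp_inv_arr [simp]:
    "is_iso C f \<Longrightarrow> x \<in> Arr C \<Longrightarrow> Cod C x = Cod C f \<Longrightarrow> f \<cdot> (inv_arr C f \<cdot> x) = x"
  using eq_extend[OF inv_arr(5)[of f]] eq_extend[OF inv_arr(6)[of f]] inv_arr(1-4)[of f] by simp_all

lemma iso_left_cancel:
  assumes "is_iso C f" "f \<cdot> x = f \<cdot> y" "x \<in> Arr C" "y \<in> Arr C" "Cod C x = Dom C f" "Cod C y = Dom C f"
  shows "x = y"
proof -
  have "x = inv_arr C f \<cdot> (f \<cdot> x)" using assms(1,3-) by simp
  also have "\<dots> = y" unfolding assms(2) using assms by simp
  finally show ?thesis .
qed

lemma iso_right_cancel:
  assumes "is_iso C f" "x \<cdot> f = y \<cdot> f" "x \<in> Arr C" "y \<in> Arr C" "Dom C x = Cod C f" "Dom C y = Cod C f"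
  shows "x = y"
proof -
  note f = inv_arr[OF assms(1)]
  have "x = (x \<cdot> f) \<cdot> inv_arr C f" using f assms(3-) by simp
  also have "\<dots> = y" unfolding assms(2) using f assms(3-) by simp
  finally show ?thesis .
qed

lemma is_isoI: "f \<in> Arr C \<Longrightarrow> g \<in> Arr C \<Longrightarrow> Dom C g = Cod C f \<Longrightarrow> Cod C g = Dom C f \<Longrightarrow>
    g \<cdot> f = Ide C (Dom C f) \<Longrightarrow> f \<cdot> g = Ide C (Cod C f) \<Longrightarrow> is_iso C f"
  by (auto simp: is_iso_def inverse_arrows_def hom_def)

lemma is_iso_Ide: "a \<in> Obj C \<Longrightarrow> is_iso C (Ide C a)"
  by (rule is_isoI[of _ "Ide C a"]) simp_all

lemma is_iso_inv_arr: "is_iso C f \<Longrightarrow> is_iso C (inv_arr C f)"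
  using inv_arr[of f] by (intro is_isoI[of _ f]) simp_all

lemma is_pullbackI:
  assumes "f \<in> Arr C" "g \<in> Arr C" "Cod C f = Cod C g" "p \<in> Arr C" "q \<in> Arr C"
    "Dom C p = Dom C q" "Cod C p = Dom C f" "Cod C q = Dom C g" "f \<cdot> p = g \<cdot> q"
    and "\<And>x y. x \<in> Arr C \<Longrightarrow> y \<in> Arr C \<Longrightarrow> Dom C x = Dom C y \<Longrightarrow> Cod C x = Dom C f \<Longrightarrow>
      Cod C y = Dom C g \<Longrightarrow> f \<cdot> x = g \<cdot> y \<Longrightarrow>
      \<exists>h\<in>Arr C. Dom C h = Dom C x \<and> Cod C h = Dom C p \<and> p \<cdot> h = x \<and> q \<cdot> h = y"
    and "\<And>h h'. h \<in> Arr C \<Longrightarrow> h' \<in> Arr C \<Longrightarrow> Dom C h = Dom C h' \<Longrightarrow> Cod C h = Dom C p \<Longrightarrow>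
      Cod C h' = Dom C p \<Longrightarrow> p \<cdot> h = p \<cdot> h' \<Longrightarrow> q \<cdot> h = q \<cdot> h' \<Longrightarrow> h = h'"
  shows "is_pullback C f g p q"
  unfolding is_pullback_def hom_def
proof (intro conjI ballI impI assms(1-9))
  fix x y assume "x \<in> Arr C" "y \<in> Arr C"
    "Dom C x = Dom C y \<and> Cod C x = Dom C f \<and> Cod C y = Dom C g \<and> f \<cdot> x = g \<cdot> y"
  then obtain h where "h \<in> Arr C" "Dom C h = Dom C x" "Cod C h = Dom C p" "p \<cdot> h = x" "q \<cdot> h = y"
    using assms(10) by blast
  then show "\<exists>!h. h \<in> {h \<in> Arr C. Dom C h = Dom C x \<and> Cod C h = Dom C p} \<and> p \<cdot> h = x \<and> q \<cdot> h = y"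
    using assms(11) by (intro ex1I[of _ h]) auto
qed

lemma pullbackD:
  assumes "is_pullback C f g p q"
  shows "f \<in> Arr C" "g \<in> Arr C" "Cod C f = Cod C g" "p \<in> Arr C" "q \<in> Arr C"
    "Dom C p = Dom C q" "Cod C p = Dom C f" "Cod C q = Dom C g" "f \<cdot> p = g \<cdot> q"
  using assms by (auto simp: is_pullback_def)

lemma pullback_lift:
  assumes "is_pullback C f g p q" "x \<in> Arr C" "y \<in> Arr C" "Dom C x = Dom C y"
    "Cod C x = Dom C f" "Cod C y = Dom C g" "f \<cdot> x = g \<cdot> y"
  obtains h where "h \<in> Arr C" "Dom C h = Dom C x" "Cod C h = Dom C p" "p \<cdot> h = x" "q \<cdot> h = y"
  using assms unfolding is_pullback_def hom_def by blast

lemma pullback_eq: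
  assumes "is_pullback C f g p q" "h \<in> Arr C" "h' \<in> Arr C" "Dom C h = Dom C h'"
    "Cod C h = Dom C p" "Cod C h' = Dom C p" "p \<cdot> h = p \<cdot> h'" "q \<cdot> h = q \<cdot> h'"
  shows "h = h'"
proof -
  note D = pullbackD[OF assms(1)]
  have "f \<cdot> (p \<cdot> h) = g \<cdot> (q \<cdot> h)"
    using D assms eq_extend[OF D(9)] by simp
  moreover have "\<forall>x\<in>Arr C. \<forall>y\<in>Arr C. Dom C x = Dom C y \<and> Cod C x = Dom C f \<and> Cod C y = Dom C g \<and>
      f \<cdot> x = g \<cdot> y \<longrightarrow> (\<exists>!h. h \<in> hom C (Dom C x) (Dom C p) \<and> p \<cdot> h = x \<and> q \<cdot> h = y)"
    using assms(1) unfolding is_pullback_def by (elim conjE)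
  ultimately have "\<exists>!k. k \<in> hom C (Dom C (p \<cdot> h)) (Dom C p) \<and> p \<cdot> k = p \<cdot> h \<and> q \<cdot> k = q \<cdot> h"
    using D(1-8) assms(2-6) by (elim ballE[of _ _ "p \<cdot> h"] ballE[of _ _ "q \<cdot> h"]) simp_all
  then show ?thesis
    using D assms by (auto simp: hom_def)
qed

lemma pullback_sym: "is_pullback C f g p q \<Longrightarrow> is_pullback C g f q p"
  unfolding is_pullback_def by (metis (no_types, lifting))

text \<open>Vertical variants of the pasting law and its converse are obtained with \<open>pullback_sym\<close>.\<close>

lemma pullback_paste:
  assumes R: "is_pullback C f g p q" and L: "is_pullback C f' p r s"
  shows "is_pullback C (f \<cdot> f') g r (q \<cdot> s)"
proof (rule is_pullbackI)
  note R' = pullbackD[OF R] and L' = pullbackD[OF L]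
  show "f \<cdot> f' \<in> Arr C" "g \<in> Arr C" "Cod C (f \<cdot> f') = Cod C g" "r \<in> Arr C" "q \<cdot> s \<in> Arr C"
    "Dom C r = Dom C (q \<cdot> s)" "Cod C r = Dom C (f \<cdot> f')" "Cod C (q \<cdot> s) = Dom C g"
    using R' L' by simp_all
  show "(f \<cdot> f') \<cdot> r = g \<cdot> (q \<cdot> s)"
    using R' L' eq_extend[OF R'(9)] by simp
next
  note R' = pullbackD[OF R] and L' = pullbackD[OF L]
  fix x y assume xy: "x \<in> Arr C" "y \<in> Arr C" "Dom C x = Dom C y" "Cod C x = Dom C (f \<cdot> f')"
    "Cod C y = Dom C g" "(f \<cdot> f') \<cdot> x = g \<cdot> y"
  obtain k where k: "k \<in> Arr C" "Dom C k = Dom C (f' \<cdot> x)" "Cod C k = Dom C p" "p \<cdot> k = f' \<cdot> x" "q \<cdot> k = y"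
    by (rule pullback_lift[OF R, of "f' \<cdot> x" y]) (use R' L' xy in simp_all)
  obtain h where h: "h \<in> Arr C" "Dom C h = Dom C x" "Cod C h = Dom C r" "r \<cdot> h = x" "s \<cdot> h = k"
    by (rule pullback_lift[OF L, of x k]) (use R' L' xy k in simp_all)
  then show "\<exists>h\<in>Arr C. Dom C h = Dom C x \<and> Cod C h = Dom C r \<and> r \<cdot> h = x \<and> (q \<cdot> s) \<cdot> h = y"
    using R' L' k by (intro bexI[of _ h]) auto
next
  note R' = pullbackD[OF R] and L' = pullbackD[OF L]
  fix h h' assume h: "h \<in> Arr C" "h' \<in> Arr C" "Dom C h = Dom C h'" "Cod C h = Dom C r"
    "Cod C h' = Dom C r" "r \<cdot> h = r \<cdot> h'" "(q \<cdot> s) \<cdot> h = (q \<cdot> s) \<cdot> h'"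
  have "p \<cdot> (s \<cdot> k) = f' \<cdot> (r \<cdot> k)" if "k \<in> Arr C" "Cod C k = Dom C r" for k
    using eq_extend[OF L'(9)[symmetric]] L'(1-8) R'(1-8) that by simp
  then have "p \<cdot> (s \<cdot> h) = p \<cdot> (s \<cdot> h')"
    using h by simp
  then have "s \<cdot> h = s \<cdot> h'"
    using L' R' h by - (rule pullback_eq[OF R], simp_all)
  then show "h = h'"
    using L' R' h by - (rule pullback_eq[OF L], simp_all)
qed

lemma pullback_cancel:
  assumes O: "is_pullback C (f \<cdot> f') g r q'" and R: "is_pullback C f g p q"
    and f': "f' \<in> Arr C" "Cod C f' = Dom C f"
    and s: "s \<in> Arr C" "Dom C s = Dom C r" "Cod C s = Dom C p" "f' \<cdot> r = p \<cdot> s" "q \<cdot> s = q'"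
  shows "is_pullback C f' p r s"
proof (rule is_pullbackI)
  note R' = pullbackD[OF R] and O' = pullbackD[OF O]
  show "f' \<in> Arr C" "p \<in> Arr C" "Cod C f' = Cod C p" "r \<in> Arr C" "s \<in> Arr C" "Dom C r = Dom C s"
    "Cod C r = Dom C f'" "Cod C s = Dom C p" "f' \<cdot> r = p \<cdot> s"
    using R' O' f' s by simp_all
next
  note R' = pullbackD[OF R] and O' = pullbackD[OF O]
  fix x y assume xy: "x \<in> Arr C" "y \<in> Arr C" "Dom C x = Dom C y" "Cod C x = Dom C f'"
    "Cod C y = Dom C p" "f' \<cdot> x = p \<cdot> y"
  have e: "f \<cdot> (f' \<cdot> x) = g \<cdot> (q \<cdot> y)"
    using xy R' f' eq_extend[OF R'(9)] by simp
  obtain h where h: "h \<in> Arr C" "Dom C h = Dom C x" "Cod C h = Dom C r" "r \<cdot> h = x" "q' \<cdot> h = q \<cdot> y"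
    by (rule pullback_lift[OF O, of x "q \<cdot> y"]) (use R' O' xy f' e in simp_all)
  have "p \<cdot> (s \<cdot> h) = p \<cdot> y"
    using square_extend[OF s(4), of h] R'(1-8) O'(1-8) f' s(1-3) h(1-4) xy by simp
  moreover have "q \<cdot> (s \<cdot> h) = q \<cdot> y"
    using eq_extend[OF s(5)] R' O' f' s h xy by simp
  ultimately have "s \<cdot> h = y"
    using R' O' f' s h xy by - (rule pullback_eq[OF R], simp_all)
  then show "\<exists>h\<in>Arr C. Dom C h = Dom C x \<and> Cod C h = Dom C r \<and> r \<cdot> h = x \<and> s \<cdot> h = y"
    using h by blast
next
  note R' = pullbackD[OF R] and O' = pullbackD[OF O]
  fix h h' assume h: "h \<in> Arr C" "h' \<in> Arr C" "Dom C h = Dom C h'" "Cod C h = Dom C r"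
    "Cod C h' = Dom C r" "r \<cdot> h = r \<cdot> h'" "s \<cdot> h = s \<cdot> h'"
  have "q' \<cdot> h = q' \<cdot> h'"
    using eq_extend[OF s(5)] R' O' f' s h by (metis (no_types))
  then show "h = h'"
    using h O' by - (rule pullback_eq[OF O], simp_all)
qed

lemma pullback_isos:
  assumes "is_iso C f" "is_iso C q" "p \<in> Arr C" "g \<in> Arr C" "Cod C f = Cod C g" "Dom C p = Dom C q"
    "Cod C p = Dom C f" "Cod C q = Dom C g" "f \<cdot> p = g \<cdot> q"
  shows "is_pullback C f g p q"
proof (rule is_pullbackI)
  note f = inv_arr[OF assms(1)] and q = inv_arr[OF assms(2)]
  show "f \<in> Arr C" "g \<in> Arr C" "Cod C f = Cod C g" "p \<in> Arr C" "q \<in> Arr C"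
    "Dom C p = Dom C q" "Cod C p = Dom C f" "Cod C q = Dom C g" "f \<cdot> p = g \<cdot> q"
    using f q assms by simp_all
next
  note f = inv_arr[OF assms(1)] and q = inv_arr[OF assms(2)]
  fix x y assume xy: "x \<in> Arr C" "y \<in> Arr C" "Dom C x = Dom C y" "Cod C x = Dom C f"
    "Cod C y = Dom C g" "f \<cdot> x = g \<cdot> y"
  let ?h = "inv_arr C q \<cdot> y"
  have qh: "q \<cdot> ?h = y" using eq_extend[OF q(6)] q xy assms by simp
  have "f \<cdot> (p \<cdot> ?h) = f \<cdot> x"
    using eq_extend[OF assms(9)] eq_extend[OF q(6)] q f xy assms by simp
  then have "p \<cdot> ?h = x"
    using q(1-4) xy assms by - (rule iso_left_cancel[of f], simp_all)
  then show "\<exists>h\<in>Arr C. Dom C h = Dom C x \<and> Cod C h = Dom C p \<and> p \<cdot> h = x \<and> q \<cdot> h = y"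
    using qh q xy assms by (intro bexI[of _ ?h]) simp_all
next
  note q = inv_arr[OF assms(2)]
  fix h h' assume h: "h \<in> Arr C" "h' \<in> Arr C" "Dom C h = Dom C h'" "Cod C h = Dom C p"
    "Cod C h' = Dom C p" "p \<cdot> h = p \<cdot> h'" "q \<cdot> h = q \<cdot> h'"
  then show "h = h'" using assms by - (rule iso_left_cancel[of q], simp_all)
qed

lemma pullback_iso:
  assumes "is_pullback C f g p q" and "is_iso C i" and "Cod C i = Dom C q"
  shows "is_pullback C f g (p \<cdot> i) (q \<cdot> i)"
proof -
  note D = pullbackD[OF assms(1)] and i = inv_arr[OF assms(2)]
  have "is_pullback C (Ide C (Dom C f)) p (p \<cdot> i) i"
    using D i assms by (intro pullback_isos is_iso_Ide) simp_all
  from pullback_paste[OF assms(1) this] show ?thesis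
    using D i by simp
qed

lemma pullbacks_isomorphic:
  assumes P: "is_pullback C f g p q" and P': "is_pullback C f g p' q'"
  obtains i where "is_iso C i" "Dom C i = Dom C q'" "Cod C i = Dom C q" "p \<cdot> i = p'" "q \<cdot> i = q'"
proof -
  note D = pullbackD[OF P] and D' = pullbackD[OF P']
  obtain i where i: "i \<in> Arr C" "Dom C i = Dom C p'" "Cod C i = Dom C p" "p \<cdot> i = p'" "q \<cdot> i = q'"
    by (rule pullback_lift[OF P, of p' q']) (use D D' in simp_all)
  obtain j where j: "j \<in> Arr C" "Dom C j = Dom C p" "Cod C j = Dom C p'" "p' \<cdot> j = p" "q' \<cdot> j = q"
    by (rule pullback_lift[OF P', of p q]) (use D D' in simp_all)
  have "i \<cdot> j = Ide C (Dom C p)"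
    using D D' i j eq_extend[OF i(4)] eq_extend[OF i(5)] by - (rule pullback_eq[OF P], simp_all)
  moreover have "j \<cdot> i = Ide C (Dom C p')"
    using D D' i j eq_extend[OF j(4)] eq_extend[OF j(5)] by - (rule pullback_eq[OF P'], simp_all)
  ultimately have "is_iso C i"
    using i j by (intro is_isoI[of _ j]) simp_all
  then show ?thesis using that i D D' by simp
qed

lemma pb_is_pullback:
  assumes "is_pullback C f g p q"
  shows "is_pullback C f g (pb_fst C f g) (pb_snd C f g)"
proof -
  have "case pb C f g of (p, q) \<Rightarrow> is_pullback C f g p q"
    unfolding pb_def by (rule someI[of _ "(p, q)"]) (simp add: assms)
  then show ?thesis by (simp add: pb_fst_def pb_snd_def split: prod.splits)
qed

lemma pb_tuple:
  assumes P: "is_pullback C f g p q"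
    and xy: "x \<in> Arr C" "y \<in> Arr C" "Dom C x = Dom C y" "Cod C x = Dom C f" "Cod C y = Dom C g" "f \<cdot> x = g \<cdot> y"
  shows "pb_tuple C f g x y \<in> Arr C" "Dom C (pb_tuple C f g x y) = Dom C x"
    "Cod C (pb_tuple C f g x y) = Dom C (pb_fst C f g)"
    "pb_fst C f g \<cdot> pb_tuple C f g x y = x" "pb_snd C f g \<cdot> pb_tuple C f g x y = y"
proof -
  have "\<exists>!h. h \<in> hom C (Dom C x) (Dom C (pb_fst C f g)) \<and> pb_fst C f g \<cdot> h = x \<and> pb_snd C f g \<cdot> h = y"
    using pb_is_pullback[OF P] xy unfolding is_pullback_def by blast
  from theI'[OF this, folded pb_tuple_def]
  show "pb_tuple C f g x y \<in> Arr C" "Dom C (pb_tuple C f g x y) = Dom C x"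
    "Cod C (pb_tuple C f g x y) = Dom C (pb_fst C f g)"
    "pb_fst C f g \<cdot> pb_tuple C f g x y = x" "pb_snd C f g \<cdot> pb_tuple C f g x y = y"
    by (auto simp: hom_def)
qed

section \<open>Zero arrows and kernels\<close>

lemma zero_arr_Arr: "is_zero_arr C f \<Longrightarrow> f \<in> Arr C"
  by (simp add: is_zero_arr_def)

lemma zero_comp:
  assumes "is_zero_arr C f" and g: "g \<in> Arr C" "Dom C g = Cod C f"
  shows "is_zero_arr C (g \<cdot> f)"
proof -
  obtain z a b where z: "is_zero_object C z" and a: "a \<in> hom C (Dom C f) z"
    and b: "b \<in> hom C z (Cod C f)" and f: "f = b \<cdot> a" "f \<in> Arr C"
    using assms unfolding is_zero_arr_def by blast
  have "g \<cdot> b \<in> hom C z (Cod C g)" "g \<cdot> (b \<cdot> a) = (g \<cdot> b) \<cdot> a"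
    using a b g by (auto simp: hom_def)
  moreover have "Dom C (g \<cdot> f) = Dom C f" "Cod C (g \<cdot> f) = Cod C g" "g \<cdot> f \<in> Arr C"
    using f g by simp_all
  ultimately show ?thesis
    using z a unfolding is_zero_arr_def f(1)[symmetric] by auto
qed

lemma comp_zero:
  assumes "is_zero_arr C f" and g: "g \<in> Arr C" "Cod C g = Dom C f"
  shows "is_zero_arr C (f \<cdot> g)"
proof -
  obtain z a b where z: "is_zero_object C z" and a: "a \<in> hom C (Dom C f) z"
    and b: "b \<in> hom C z (Cod C f)" and f: "f = b \<cdot> a" "f \<in> Arr C"
    using assms unfolding is_zero_arr_def by blast
  have "a \<cdot> g \<in> hom C (Dom C g) z" "(b \<cdot> a) \<cdot> g = b \<cdot> (a \<cdot> g)"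
    using a b g by (auto simp: hom_def)
  moreover have "Dom C (f \<cdot> g) = Dom C g" "Cod C (f \<cdot> g) = Cod C f" "f \<cdot> g \<in> Arr C"
    using f g by simp_all
  ultimately show ?thesis
    using z b unfolding is_zero_arr_def f(1)[symmetric] by auto
qed

lemma terminal_eq: "is_terminal C z \<Longrightarrow> f \<in> hom C a z \<Longrightarrow> g \<in> hom C a z \<Longrightarrow> f = g"
  unfolding is_terminal_def hom_def using Dom_Obj by blast

lemma initial_eq: "is_initial C z \<Longrightarrow> f \<in> hom C z a \<Longrightarrow> g \<in> hom C z a \<Longrightarrow> f = g"
  unfolding is_initial_def hom_def using Cod_Obj by blast

lemma zero_object_maps:
  assumes "is_zero_object C z" "a \<in> Obj C"
  obtains f g where "f \<in> Arr C" "Dom C f = a" "Cod C f = z" "g \<in> Arr C" "Dom C g = z" "Cod C g = a"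
proof -
  have "\<exists>!f. f \<in> hom C a z" "\<exists>!g. g \<in> hom C z a"
    using assms by (simp_all add: is_zero_object_def is_terminal_def is_initial_def)
  then obtain f g where "f \<in> hom C a z" "g \<in> hom C z a"
    by (meson ex1_implies_ex)
  then show ?thesis
    using that unfolding hom_def by blast
qed

lemma zero_object_Obj: "is_zero_object C z \<Longrightarrow> z \<in> Obj C"
  by (simp add: is_zero_object_def is_terminal_def)

lemma zero_arr_unique:
  assumes "is_zero_arr C f" "is_zero_arr C g" "Dom C f = Dom C g" "Cod C f = Cod C g"
  shows "f = g"
proof -
  obtain z a b where z: "is_zero_object C z" and a: "a \<in> hom C (Dom C f) z"
    and b: "b \<in> hom C z (Cod C f)" and f: "f = b \<cdot> a"
    using assms unfolding is_zero_arr_def by blast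
  obtain z' a' b' where z': "is_zero_object C z'" and a': "a' \<in> hom C (Dom C f) z'"
    and b': "b' \<in> hom C z' (Cod C f)" and g: "g = b' \<cdot> a'"
    using assms(2) unfolding is_zero_arr_def assms(3,4)[symmetric] by blast
  obtain i where i: "i \<in> hom C z z'"
    using zero_object_maps[OF z zero_object_Obj[OF z']] unfolding hom_def by blast
  have "i \<cdot> a = a'"
    using z' comp_in_hom[OF a i] a' terminal_eq unfolding is_zero_object_def by blast
  moreover have "b' \<cdot> i = b"
    using z comp_in_hom[OF i b'] b initial_eq unfolding is_zero_object_def by blast
  moreover have "(b' \<cdot> i) \<cdot> a = b' \<cdot> (i \<cdot> a)"
    using i a b' by (auto simp: hom_def)
  ultimately show ?thesis
    unfolding f g by simp
qed

lemma is_zero_arrI: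
  "is_zero_object C z \<Longrightarrow> f \<in> Arr C \<Longrightarrow> g \<in> Arr C \<Longrightarrow> Cod C f = z \<Longrightarrow> Dom C g = z \<Longrightarrow> is_zero_arr C (g \<cdot> f)"
  unfolding is_zero_arr_def hom_def by auto

lemma kernelI:
  assumes "f \<in> Arr C" "k \<in> Arr C" "Cod C k = Dom C f" "is_zero_arr C (f \<cdot> k)"
    and "\<And>x. x \<in> Arr C \<Longrightarrow> Cod C x = Dom C f \<Longrightarrow> is_zero_arr C (f \<cdot> x) \<Longrightarrow>
      \<exists>h\<in>Arr C. Dom C h = Dom C x \<and> Cod C h = Dom C k \<and> k \<cdot> h = x"
    and "\<And>h h'. h \<in> Arr C \<Longrightarrow> h' \<in> Arr C \<Longrightarrow> Dom C h = Dom C h' \<Longrightarrow> Cod C h = Dom C k \<Longrightarrow>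
      Cod C h' = Dom C k \<Longrightarrow> k \<cdot> h = k \<cdot> h' \<Longrightarrow> h = h'"
  shows "is_kernel C f k"
  unfolding is_kernel_def hom_def
proof (intro conjI ballI impI assms(1-4))
  fix x assume "x \<in> Arr C" "Cod C x = Dom C f \<and> is_zero_arr C (f \<cdot> x)"
  then obtain h where "h \<in> Arr C" "Dom C h = Dom C x" "Cod C h = Dom C k" "k \<cdot> h = x"
    using assms(5) by blast
  then show "\<exists>!h. h \<in> {h \<in> Arr C. Dom C h = Dom C x \<and> Cod C h = Dom C k} \<and> k \<cdot> h = x"
    using assms(6) by (intro ex1I[of _ h]) auto
qed

lemma kernelD:
  assumes "is_kernel C f k"
  shows "f \<in> Arr C" "k \<in> Arr C" "Cod C k = Dom C f" "is_zero_arr C (f \<cdot> k)"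
  using assms by (auto simp: is_kernel_def)

lemma kernel_lift:
  assumes "is_kernel C f k" "x \<in> Arr C" "Cod C x = Dom C f" "is_zero_arr C (f \<cdot> x)"
  obtains h where "h \<in> Arr C" "Dom C h = Dom C x" "Cod C h = Dom C k" "k \<cdot> h = x"
  using assms unfolding is_kernel_def hom_def by blast

lemma kernel_eq:
  assumes "is_kernel C f k" "h \<in> Arr C" "h' \<in> Arr C" "Dom C h = Dom C h'"
    "Cod C h = Dom C k" "Cod C h' = Dom C k" "k \<cdot> h = k \<cdot> h'"
  shows "h = h'"
proof -
  note D = kernelD[OF assms(1)]
  have "is_zero_arr C ((f \<cdot> k) \<cdot> h)"
    using D assms by - (rule comp_zero, simp_all)
  then have "is_zero_arr C (f \<cdot> (k \<cdot> h))"
    using D assms by simp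
  moreover have "\<forall>x\<in>Arr C. Cod C x = Dom C f \<and> is_zero_arr C (f \<cdot> x) \<longrightarrow>
      (\<exists>!h. h \<in> hom C (Dom C x) (Dom C k) \<and> k \<cdot> h = x)"
    using assms(1) unfolding is_kernel_def by (elim conjE)
  ultimately have "\<exists>!h'. h' \<in> hom C (Dom C (k \<cdot> h)) (Dom C k) \<and> k \<cdot> h' = k \<cdot> h"
    using assms(2-6) D by (elim ballE[of _ _ "k \<cdot> h"]) simp_all
  then show ?thesis
    using D assms by (auto simp: hom_def)
qed

lemma ker_arr_is_kernel: "is_kernel C f k \<Longrightarrow> is_kernel C f (ker_arr C f)"
  unfolding ker_arr_def by (rule someI)

text \<open>An arrow is zero exactly when it factors through a zero object, so a cone over \<open>f\<close> and an arrow
  out of a zero object is the same as an arrow annihilated by \<open>f\<close>.\<close>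

lemma kernel_if_pullback:
  assumes P: "is_pullback C f g k q" and z: "is_zero_object C (Dom C g)"
  shows "is_kernel C f k"
proof (rule kernelI)
  note D = pullbackD[OF P]
  show "f \<in> Arr C" "k \<in> Arr C" "Cod C k = Dom C f" using D by simp_all
  show "is_zero_arr C (f \<cdot> k)"
    unfolding D(9) using z D by (intro is_zero_arrI[OF z]) simp_all
next
  note D = pullbackD[OF P]
  fix x assume x: "x \<in> Arr C" "Cod C x = Dom C f" "is_zero_arr C (f \<cdot> x)"
  obtain y where y: "y \<in> Arr C" "Dom C y = Dom C x" "Cod C y = Dom C g"
    using zero_object_maps[OF z Dom_Obj[OF x(1)]] by metis
  have "f \<cdot> x = g \<cdot> y"
    using x y D by - (rule zero_arr_unique, auto intro: is_zero_arrI[OF z])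
  then show "\<exists>h\<in>Arr C. Dom C h = Dom C x \<and> Cod C h = Dom C k \<and> k \<cdot> h = x"
    using pullback_lift[OF P, of x y] x y by metis
next
  note D = pullbackD[OF P]
  fix h h' assume h: "h \<in> Arr C" "h' \<in> Arr C" "Dom C h = Dom C h'" "Cod C h = Dom C k"
    "Cod C h' = Dom C k" "k \<cdot> h = k \<cdot> h'"
  have "q \<cdot> h = q \<cdot> h'"
    using z h D terminal_eq[of "Dom C g" "q \<cdot> h" "Dom C h" "q \<cdot> h'"]
    by (simp add: is_zero_object_def hom_def)
  then show "h = h'" using h by - (rule pullback_eq[OF P], simp_all)
qed

text \<open>An arrow annihilated by \<open>f\<close> is completed by a zero arrow to a cone over the square, so kernels
  can be computed after pulling back. In this way kernels are carried along the defining square of a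
  trivial covering, in both directions.\<close>

lemma kernel_of_pullback:
  assumes P: "is_pullback C f g p q" and K: "is_kernel C q k"
  shows "is_kernel C f (p \<cdot> k)"
proof (rule kernelI)
  note D = pullbackD[OF P] and K' = kernelD[OF K]
  show "f \<in> Arr C" "p \<cdot> k \<in> Arr C" "Cod C (p \<cdot> k) = Dom C f" using D K' by simp_all
  show "is_zero_arr C (f \<cdot> (p \<cdot> k))"
    using zero_comp[OF K'(4), of g] D K' eq_extend[OF D(9)] by simp
next
  note D = pullbackD[OF P] and K' = kernelD[OF K]
  fix x assume x: "x \<in> Arr C" "Cod C x = Dom C f" "is_zero_arr C (f \<cdot> x)"
  obtain z a where z: "is_zero_object C z" and a: "a \<in> hom C (Dom C x) z"
    using x(3) x(1,2) D(1) unfolding is_zero_arr_def Dom_comp[OF x(1) D(1) x(2)] by blast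
  obtain b where b: "b \<in> hom C z (Dom C g)"
    using zero_object_maps[OF z Dom_Obj[OF D(2)]] unfolding hom_def by blast
  have ba: "is_zero_arr C (b \<cdot> a)" "b \<cdot> a \<in> Arr C" "Dom C (b \<cdot> a) = Dom C x" "Cod C (b \<cdot> a) = Dom C g"
    using a b by (auto intro: is_zero_arrI[OF z] simp: hom_def)
  have "f \<cdot> x = g \<cdot> (b \<cdot> a)"
    using x ba D by - (rule zero_arr_unique, auto intro: zero_comp)
  then obtain y where y: "y \<in> Arr C" "Dom C y = Dom C x" "Cod C y = Dom C p" "p \<cdot> y = x" "q \<cdot> y = b \<cdot> a"
    using pullback_lift[OF P, of x "b \<cdot> a"] x ba by auto
  obtain h where h: "h \<in> Arr C" "Dom C h = Dom C y" "Cod C h = Dom C k" "k \<cdot> h = y"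
    by (rule kernel_lift[OF K, of y]) (use y ba D in simp_all)
  show "\<exists>h\<in>Arr C. Dom C h = Dom C x \<and> Cod C h = Dom C (p \<cdot> k) \<and> (p \<cdot> k) \<cdot> h = x"
    using h y K' D by (intro bexI[of _ h]) simp_all
next
  note D = pullbackD[OF P] and K' = kernelD[OF K]
  fix h h' assume h: "h \<in> Arr C" "h' \<in> Arr C" "Dom C h = Dom C h'" "Cod C h = Dom C (p \<cdot> k)"
    "Cod C h' = Dom C (p \<cdot> k)" "(p \<cdot> k) \<cdot> h = (p \<cdot> k) \<cdot> h'"
  have "is_zero_arr C (q \<cdot> (k \<cdot> h))" "is_zero_arr C (q \<cdot> (k \<cdot> h'))"
    using comp_zero[OF K'(4), of h] comp_zero[OF K'(4), of h'] h D K' by simp_all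
  then have "q \<cdot> (k \<cdot> h) = q \<cdot> (k \<cdot> h')"
    using h D K' by - (rule zero_arr_unique, simp_all)
  then have "k \<cdot> h = k \<cdot> h'"
    using h D K' by - (rule pullback_eq[OF P], simp_all)
  then show "h = h'"
    using h D K' by - (rule kernel_eq[OF K], simp_all)
qed

lemma kernel_of_pullback_conv:
  assumes P: "is_pullback C f g p q" and K: "is_kernel C f (p \<cdot> k)"
    and k: "k \<in> Arr C" "Cod C k = Dom C p" "is_zero_arr C (q \<cdot> k)"
  shows "is_kernel C q k"
proof (rule kernelI)
  note D = pullbackD[OF P]
  show "q \<in> Arr C" "k \<in> Arr C" "Cod C k = Dom C q" "is_zero_arr C (q \<cdot> k)"
    using D k by simp_all
next
  note D = pullbackD[OF P]
  fix x assume x: "x \<in> Arr C" "Cod C x = Dom C q" "is_zero_arr C (q \<cdot> x)"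
  have "is_zero_arr C (g \<cdot> (q \<cdot> x))"
    using zero_comp[OF x(3), of g] D x by simp
  then have "is_zero_arr C (f \<cdot> (p \<cdot> x))"
    using square_extend[OF D(9), of x] D(1-8) x by simp
  then obtain h where h: "h \<in> Arr C" "Dom C h = Dom C (p \<cdot> x)" "Cod C h = Dom C (p \<cdot> k)" "(p \<cdot> k) \<cdot> h = p \<cdot> x"
    using kernel_lift[OF K, of "p \<cdot> x"] D x by auto
  have "is_zero_arr C ((q \<cdot> k) \<cdot> h)"
    using h D k x by - (rule comp_zero, simp_all)
  then have "q \<cdot> (k \<cdot> h) = q \<cdot> x"
    using h D k x by - (rule zero_arr_unique, simp_all)
  then have "k \<cdot> h = x"
    using h D k x by - (rule pullback_eq[OF P], simp_all)
  then show "\<exists>h\<in>Arr C. Dom C h = Dom C x \<and> Cod C h = Dom C k \<and> k \<cdot> h = x"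
    using h D k x by (intro bexI[of _ h]) simp_all
next
  note D = pullbackD[OF P]
  fix h h' assume h: "h \<in> Arr C" "h' \<in> Arr C" "Dom C h = Dom C h'" "Cod C h = Dom C k"
    "Cod C h' = Dom C k" "k \<cdot> h = k \<cdot> h'"
  then show "h = h'"
    using D k by - (rule kernel_eq[OF K], simp_all)
qed

end

section \<open>Pullbacks from finite limits\<close>

text \<open>The non-identity arrows are \<open>3 : 0 \<rightarrow> 2\<close> and \<open>4 : 1 \<rightarrow> 2\<close>; a composite with an identity is the
  other factor, and in the remaining composable pair the first factor ends in \<open>2\<close>, so the second is
  an identity.\<close>

definition cospan_shape :: "(nat, nat) cat" where
  "cospan_shape = \<lparr>Obj = {0, 1, 2}, Arr = {0, 1, 2, 3, 4},
     Dom = (\<lambda>n. if n = 3 then 0 else if n = 4 then 1 else n), Cod = (\<lambda>n. if n < 3 then n else 2),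
     Ide = (\<lambda>n. n), Comp = (\<lambda>g f. if f < 3 then g else f)\<rparr>"

lemma cospan_shape_category: "is_category cospan_shape"
  unfolding is_category_def cospan_shape_def hom_def by simp

lemma (in category) ex_pullback:
  assumes "finitely_complete C" "f \<in> Arr C" "g \<in> Arr C" "Cod C f = Cod C g"
  shows "\<exists>p q. is_pullback C f g p q"
proof -
  let ?J = cospan_shape
  define D where "D = \<lparr>FObj = (\<lambda>n::nat. if n = 0 then Dom C f else if n = 1 then Dom C g else Cod C f),
     FArr = (\<lambda>n::nat. if n = 0 then Ide C (Dom C f) else if n = 1 then Ide C (Dom C g)
       else if n = 2 then Ide C (Cod C f) else if n = 3 then f else g)\<rparr>"
  have "is_functor ?J C D"
    unfolding is_functor_def using assms category cospan_shape_category
    by (simp add: hom_def cospan_shape_def D_def)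
  moreover have "finite (Obj ?J)" "finite (Arr ?J)"
    by (simp_all add: cospan_shape_def)
  ultimately obtain c \<pi> where lim: "is_limit C ?J D c \<pi>"
    using assms(1) unfolding finitely_complete_def by blast
  have cone: "is_cone C ?J D x \<xi> \<longleftrightarrow> x \<in> Obj C \<and> \<xi> 0 \<in> hom C x (Dom C f) \<and> \<xi> 1 \<in> hom C x (Dom C g) \<and>
      \<xi> 2 \<in> hom C x (Cod C f) \<and> f \<cdot> \<xi> 0 = \<xi> 2 \<and> g \<cdot> \<xi> 1 = \<xi> 2" for x \<xi>
    unfolding is_cone_def using assms by (auto simp: D_def cospan_shape_def hom_def)
  have c: "is_cone C ?J D c \<pi>"
    and u: "\<And>x \<xi>. is_cone C ?J D x \<xi> \<Longrightarrow> \<exists>!h. h \<in> hom C x c \<and> (\<forall>j\<in>Obj ?J. \<pi> j \<cdot> h = \<xi> j)"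
    using lim unfolding is_limit_def by blast+
  have \<pi>: "c \<in> Obj C" "\<pi> 0 \<in> Arr C" "Dom C (\<pi> 0) = c" "Cod C (\<pi> 0) = Dom C f"
    "\<pi> 1 \<in> Arr C" "Dom C (\<pi> 1) = c" "Cod C (\<pi> 1) = Dom C g" "f \<cdot> \<pi> 0 = g \<cdot> \<pi> 1" "\<pi> 2 = f \<cdot> \<pi> 0"
    using c unfolding cone hom_def by auto
  have J: "(\<forall>j\<in>Obj ?J. P j) \<longleftrightarrow> P 0 \<and> P 1 \<and> P 2" for P
    by (auto simp: cospan_shape_def)
  have "is_pullback C f g (\<pi> 0) (\<pi> 1)"
    unfolding is_pullback_def
  proof (intro conjI ballI impI)
    fix x y assume x: "x \<in> Arr C" and y: "y \<in> Arr C"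
      and xy: "Dom C x = Dom C y \<and> Cod C x = Dom C f \<and> Cod C y = Dom C g \<and> f \<cdot> x = g \<cdot> y"
    define \<xi> where "\<xi> n = (if n = (0::nat) then x else if n = 1 then y else f \<cdot> x)" for n
    have "is_cone C ?J D (Dom C x) \<xi>"
      unfolding cone using x y xy assms by (simp add: \<xi>_def hom_def)
    from u[OF this] have "\<exists>!h. h \<in> hom C (Dom C x) c \<and> \<pi> 0 \<cdot> h = x \<and> \<pi> 1 \<cdot> h = y \<and> \<pi> 2 \<cdot> h = f \<cdot> x"
      unfolding J by (simp add: \<xi>_def)
    moreover have "\<pi> 2 \<cdot> h = f \<cdot> x" if "h \<in> hom C (Dom C x) c" "\<pi> 0 \<cdot> h = x" for h
      using that \<pi>(1-7) assms(2) unfolding \<pi>(9) by (simp add: hom_def)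
    ultimately show "\<exists>!h. h \<in> hom C (Dom C x) (Dom C (\<pi> 0)) \<and> \<pi> 0 \<cdot> h = x \<and> \<pi> 1 \<cdot> h = y"
      unfolding \<pi>(3) by (metis (no_types, lifting))
  qed (use \<pi> assms in simp_all)
  then show ?thesis by blast
qed


section \<open>Functors, natural transformations and equivalences\<close>

lemma is_functorI:
  assumes "is_category A" "is_category B"
    and "\<And>a. a \<in> Obj A \<Longrightarrow> FObj F a \<in> Obj B"
    and "\<And>f. f \<in> Arr A \<Longrightarrow> FArr F f \<in> Arr B \<and> Dom B (FArr F f) = FObj F (Dom A f) \<and>
      Cod B (FArr F f) = FObj F (Cod A f)"
    and "\<And>a. a \<in> Obj A \<Longrightarrow> FArr F (Ide A a) = Ide B (FObj F a)"
    and "\<And>f g. f \<in> Arr A \<Longrightarrow> g \<in> Arr A \<Longrightarrow> Cod A f = Dom A g \<Longrightarrow>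
        FArr F (g \<cdot>\<^bsub>A\<^esub> f) = FArr F g \<cdot>\<^bsub>B\<^esub> FArr F f"
  shows "is_functor A B F"
  using assms unfolding is_functor_def hom_def by blast

lemma functorD:
  assumes "is_functor A B F"
  shows "is_category A" "is_category B"
    and "a \<in> Obj A \<Longrightarrow> FObj F a \<in> Obj B"
    and "f \<in> Arr A \<Longrightarrow> FArr F f \<in> Arr B"
    and "f \<in> Arr A \<Longrightarrow> Dom B (FArr F f) = FObj F (Dom A f)"
    and "f \<in> Arr A \<Longrightarrow> Cod B (FArr F f) = FObj F (Cod A f)"
    and "a \<in> Obj A \<Longrightarrow> FArr F (Ide A a) = Ide B (FObj F a)"
    and "f \<in> Arr A \<Longrightarrow> g \<in> Arr A \<Longrightarrow> Cod A f = Dom A g \<Longrightarrow>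
        FArr F (g \<cdot>\<^bsub>A\<^esub> f) = FArr F g \<cdot>\<^bsub>B\<^esub> FArr F f"
  using assms unfolding is_functor_def hom_def by simp_all

lemma comp_functor_simps [simp]:
  "FObj (comp_functor G F) a = FObj G (FObj F a)"
  "FArr (comp_functor G F) f = FArr G (FArr F f)"
  by (simp_all add: comp_functor_def)

lemma id_functor_simps [simp]: "FObj id_functor a = a" "FArr id_functor f = f"
  by (simp_all add: id_functor_def)

lemma id_functor: "is_category A \<Longrightarrow> is_functor A A id_functor"
  using category.Dom_Obj[of A] category.Cod_Obj[of A]
  by (intro is_functorI) (auto simp: category_def)

lemma comp_functor:
  assumes "is_functor A B F" "is_functor B D G"
  shows "is_functor A D (comp_functor G F)"
  by (rule is_functorI) (simp_all add: functorD[OF assms(1)] functorD[OF assms(2)])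

lemma nat_transI:
  assumes "is_functor A B F" "is_functor A B G" "\<tau> \<in> extensional (Obj A)"
    and "\<And>a. a \<in> Obj A \<Longrightarrow> \<tau> a \<in> Arr B \<and> Dom B (\<tau> a) = FObj F a \<and> Cod B (\<tau> a) = FObj G a"
    and "\<And>f. f \<in> Arr A \<Longrightarrow> FArr G f \<cdot>\<^bsub>B\<^esub> \<tau> (Dom A f) = \<tau> (Cod A f) \<cdot>\<^bsub>B\<^esub> FArr F f"
  shows "is_nat_trans A B F G \<tau>"
  using assms unfolding is_nat_trans_def hom_def by blast

lemma nat_transD:
  assumes "is_nat_trans A B F G \<tau>"
  shows "is_functor A B F" "is_functor A B G" "\<tau> \<in> extensional (Obj A)"
    and "a \<in> Obj A \<Longrightarrow> \<tau> a \<in> Arr B"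
    and "a \<in> Obj A \<Longrightarrow> Dom B (\<tau> a) = FObj F a"
    and "a \<in> Obj A \<Longrightarrow> Cod B (\<tau> a) = FObj G a"
    and "f \<in> Arr A \<Longrightarrow> FArr G f \<cdot>\<^bsub>B\<^esub> \<tau> (Dom A f) = \<tau> (Cod A f) \<cdot>\<^bsub>B\<^esub> FArr F f"
  using assms unfolding is_nat_trans_def hom_def by simp_all

text \<open>Once every object of \<open>B\<close> has a chosen preimage up to isomorphism, the quasi-inverse is forced on
  arrows by full faithfulness, and each equation needed of it can be checked after applying \<open>F\<close>.\<close>

lemma equivalence_if_full_faithful_surjective:
  assumes F: "is_functor A B F" and full: "is_full A B F" and faithful: "is_faithful A B F"
    and surj: "\<And>b. b \<in> Obj B \<Longrightarrow> \<exists>a\<in>Obj A. \<exists>i. is_iso B i \<and> Dom B i = FObj F a \<and> Cod B i = b"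
  shows "is_equivalence A B F"
proof -
  interpret A: category A using functorD(1)[OF F] by (simp add: category_def)
  interpret B: category B using functorD(2)[OF F] by (simp add: category_def)
  note F' [simp] = functorD(3-)[OF F]
  have eqI: "f = g" if "f \<in> Arr A" "g \<in> Arr A" "Dom A f = Dom A g" "Cod A f = Cod A g"
      "FArr F f = FArr F g" for f g
    using faithful that unfolding is_faithful_def hom_def by (metis (mono_tags, lifting) A.Dom_Obj A.Cod_Obj mem_Collect_eq)
  have exF: "\<exists>f. f \<in> Arr A \<and> Dom A f = a \<and> Cod A f = b \<and> FArr F f = h"
    if "a \<in> Obj A" "b \<in> Obj A" "h \<in> Arr B" "Dom B h = FObj F a" "Cod B h = FObj F b" for a b h
    using full that unfolding is_full_def hom_def by blast
  have "\<forall>b\<in>Obj B. \<exists>ai. fst ai \<in> Obj A \<and> is_iso B (snd ai) \<and> Dom B (snd ai) = FObj F (fst ai) \<and>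
      Cod B (snd ai) = b"
    using surj by fastforce
  then obtain ai where ai: "\<forall>b\<in>Obj B. fst (ai b) \<in> Obj A \<and> is_iso B (snd (ai b)) \<and>
      Dom B (snd (ai b)) = FObj F (fst (ai b)) \<and> Cod B (snd (ai b)) = b"
    unfolding bchoice_iff by blast
  define G0 where "G0 b = fst (ai b)" for b
  define i where "i b = snd (ai b)" for b
  have G0 [simp]: "G0 b \<in> Obj A" "is_iso B (i b)" "Dom B (i b) = FObj F (G0 b)" "Cod B (i b) = b"
    if "b \<in> Obj B" for b
    using ai that by (simp_all add: G0_def i_def)
  have i [simp]: "i b \<in> Arr B" "inv_arr B (i b) \<in> Arr B" "Dom B (inv_arr B (i b)) = b"
    "Cod B (inv_arr B (i b)) = FObj F (G0 b)" "inv_arr B (i b) \<cdot>\<^bsub>B\<^esub> i b = Ide B (FObj F (G0 b))"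
    "i b \<cdot>\<^bsub>B\<^esub> inv_arr B (i b) = Ide B b" if "b \<in> Obj B" for b
    using B.inv_arr[OF G0(2)[OF that]] that by simp_all
  have "\<forall>h\<in>Arr B. \<exists>f. f \<in> Arr A \<and> Dom A f = G0 (Dom B h) \<and> Cod A f = G0 (Cod B h) \<and>
      FArr F f = inv_arr B (i (Cod B h)) \<cdot>\<^bsub>B\<^esub> (h \<cdot>\<^bsub>B\<^esub> i (Dom B h))"
    by (intro ballI exF) simp_all
  then obtain G1 where "\<forall>h\<in>Arr B. G1 h \<in> Arr A \<and> Dom A (G1 h) = G0 (Dom B h) \<and>
      Cod A (G1 h) = G0 (Cod B h) \<and> FArr F (G1 h) = inv_arr B (i (Cod B h)) \<cdot>\<^bsub>B\<^esub> (h \<cdot>\<^bsub>B\<^esub> i (Dom B h))"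
    unfolding bchoice_iff by blast
  then have G1 [simp]: "G1 h \<in> Arr A" "Dom A (G1 h) = G0 (Dom B h)" "Cod A (G1 h) = G0 (Cod B h)"
      "FArr F (G1 h) = inv_arr B (i (Cod B h)) \<cdot>\<^bsub>B\<^esub> (h \<cdot>\<^bsub>B\<^esub> i (Dom B h))" if "h \<in> Arr B" for h
    using that by blast+
  define G where "G = \<lparr>FObj = G0, FArr = G1\<rparr>"
  have [simp]: "FObj G = G0" "FArr G = G1" by (simp_all add: G_def)
  have G: "is_functor B A G"
  proof (rule is_functorI[OF B.category A.category])
    fix b assume "b \<in> Obj B"
    then show "FArr G (Ide B b) = Ide A (FObj G b)" by - (rule eqI, simp_all)
  next
    fix f g assume "f \<in> Arr B" "g \<in> Arr B" "Cod B f = Dom B g"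
    then show "FArr G (g \<cdot>\<^bsub>B\<^esub> f) = FArr G g \<cdot>\<^bsub>A\<^esub> FArr G f" by - (rule eqI, simp_all)
  qed simp_all
  have "\<forall>a\<in>Obj A. \<exists>f. f \<in> Arr A \<and> Dom A f = a \<and> Cod A f = G0 (FObj F a) \<and> FArr F f = inv_arr B (i (FObj F a))"
    by (intro ballI exF) simp_all
  then obtain \<sigma> where "\<forall>a\<in>Obj A. \<sigma> a \<in> Arr A \<and> Dom A (\<sigma> a) = a \<and> Cod A (\<sigma> a) = G0 (FObj F a) \<and>
      FArr F (\<sigma> a) = inv_arr B (i (FObj F a))"
    unfolding bchoice_iff by blast
  then have \<sigma> [simp]: "\<sigma> a \<in> Arr A" "Dom A (\<sigma> a) = a" "Cod A (\<sigma> a) = G0 (FObj F a)"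
      "FArr F (\<sigma> a) = inv_arr B (i (FObj F a))" if "a \<in> Obj A" for a
    using that by blast+
  have "is_nat_trans A A id_functor (comp_functor G F) (restrict \<sigma> (Obj A))"
  proof (rule nat_transI[OF id_functor[OF A.category] comp_functor[OF F G]])
    fix f assume "f \<in> Arr A"
    then show "FArr (comp_functor G F) f \<cdot>\<^bsub>A\<^esub> restrict \<sigma> (Obj A) (Dom A f) =
        restrict \<sigma> (Obj A) (Cod A f) \<cdot>\<^bsub>A\<^esub> FArr id_functor f"
      by - (rule eqI, simp_all)
  qed simp_all
  moreover have "is_iso A (restrict \<sigma> (Obj A) a)" if a: "a \<in> Obj A" for a
  proof -
    obtain r where "r \<in> Arr A" "Dom A r = G0 (FObj F a)" "Cod A r = a" "FArr F r = i (FObj F a)"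
      using exF[of "G0 (FObj F a)" a "i (FObj F a)"] a by auto
    moreover from this a have "r \<cdot>\<^bsub>A\<^esub> \<sigma> a = Ide A a" "\<sigma> a \<cdot>\<^bsub>A\<^esub> r = Ide A (G0 (FObj F a))"
      by - (rule eqI, simp_all)+
    ultimately show ?thesis using a by (intro A.is_isoI[of _ r]) simp_all
  qed
  moreover have "is_nat_trans B B (comp_functor F G) id_functor (restrict i (Obj B))"
    by (rule nat_transI[OF comp_functor[OF G F] id_functor[OF B.category]]) simp_all
  moreover have \<tau>_iso: "is_iso B (restrict i (Obj B) b)" if "b \<in> Obj B" for b
    using that by simp
  ultimately show ?thesis
    unfolding is_equivalence_def is_nat_iso_def using F G \<tau>_iso by blast
qed


section \<open>Full subcategories, slices and arrow categories\<close>

lemma full_subcat_simps [simp]: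
  "Obj (full_subcat C S) = Obj C \<inter> S"
  "Arr (full_subcat C S) = {f \<in> Arr C. Dom C f \<in> S \<and> Cod C f \<in> S}"
  "Dom (full_subcat C S) = Dom C" "Cod (full_subcat C S) = Cod C"
  "Ide (full_subcat C S) = Ide C" "Comp (full_subcat C S) = Comp C"
  by (simp_all add: full_subcat_def)

lemma is_categoryI:
  assumes "\<And>f. f \<in> Arr C \<Longrightarrow> Dom C f \<in> Obj C \<and> Cod C f \<in> Obj C"
    and "\<And>a. a \<in> Obj C \<Longrightarrow> Ide C a \<in> Arr C \<and> Dom C (Ide C a) = a \<and> Cod C (Ide C a) = a"
    and "\<And>f g. f \<in> Arr C \<Longrightarrow> g \<in> Arr C \<Longrightarrow> Cod C f = Dom C g \<Longrightarrow>
      g \<cdot>\<^bsub>C\<^esub> f \<in> Arr C \<and> Dom C (g \<cdot>\<^bsub>C\<^esub> f) = Dom C f \<and> Cod C (g \<cdot>\<^bsub>C\<^esub> f) = Cod C g"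
    and "\<And>f. f \<in> Arr C \<Longrightarrow> f \<cdot>\<^bsub>C\<^esub> Ide C (Dom C f) = f \<and> Ide C (Cod C f) \<cdot>\<^bsub>C\<^esub> f = f"
    and "\<And>f g h. f \<in> Arr C \<Longrightarrow> g \<in> Arr C \<Longrightarrow> h \<in> Arr C \<Longrightarrow> Cod C f = Dom C g \<Longrightarrow>
      Cod C g = Dom C h \<Longrightarrow> h \<cdot>\<^bsub>C\<^esub> (g \<cdot>\<^bsub>C\<^esub> f) = (h \<cdot>\<^bsub>C\<^esub> g) \<cdot>\<^bsub>C\<^esub> f"
  shows "is_category C"
  using assms unfolding is_category_def hom_def by blast

context category
begin

lemma full_subcat_category: "is_category (full_subcat C S)"
  by (rule is_categoryI) auto

lemma slice_category: "is_category (slice C B)"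
proof (rule is_categoryI)
  fix x y assume xy: "x \<in> Arr (slice C B)" "y \<in> Arr (slice C B)" "Cod (slice C B) x = Dom (slice C B) y"
  obtain f h g where x: "x = (f, h, g)" by (metis prod.exhaust)
  obtain k l where y: "y = (g, k, l)" using xy x by (cases y) (simp add: slice_def)
  have *: "f \<in> Arr C" "g \<in> Arr C" "l \<in> Arr C" "h \<in> Arr C" "k \<in> Arr C" "Dom C h = Dom C f"
    "Cod C h = Dom C g" "Dom C k = Dom C g" "Cod C k = Dom C l" "g \<cdot> h = f" "l \<cdot> k = g"
    "Cod C f = B" "Cod C g = B" "Cod C l = B"
    using xy by (simp_all add: x y slice_def hom_def)
  then show "y \<cdot>\<^bsub>slice C B\<^esub> x \<in> Arr (slice C B) \<and> Dom (slice C B) (y \<cdot>\<^bsub>slice C B\<^esub> x) = Dom (slice C B) x \<and>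
      Cod (slice C B) (y \<cdot>\<^bsub>slice C B\<^esub> x) = Cod (slice C B) y"
    using eq_extend[OF *(11), of h] by (simp add: x y slice_def hom_def)
next
  fix x assume "x \<in> Arr (slice C B)"
  then show "Dom (slice C B) x \<in> Obj (slice C B) \<and> Cod (slice C B) x \<in> Obj (slice C B)"
    by (cases x) (simp add: slice_def)
next
  fix x assume "x \<in> Arr (slice C B)"
  then show "x \<cdot>\<^bsub>slice C B\<^esub> Ide (slice C B) (Dom (slice C B) x) = x \<and>
      Ide (slice C B) (Cod (slice C B) x) \<cdot>\<^bsub>slice C B\<^esub> x = x"
    by (cases x) (simp add: slice_def hom_def)
next
  fix x assume "x \<in> Obj (slice C B)"
  then show "Ide (slice C B) x \<in> Arr (slice C B) \<and> Dom (slice C B) (Ide (slice C B) x) = x \<and>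
      Cod (slice C B) (Ide (slice C B) x) = x"
    by (simp add: slice_def hom_def)
next
  fix x y z assume "x \<in> Arr (slice C B)" "y \<in> Arr (slice C B)" "z \<in> Arr (slice C B)"
    "Cod (slice C B) x = Dom (slice C B) y" "Cod (slice C B) y = Dom (slice C B) z"
  then show "z \<cdot>\<^bsub>slice C B\<^esub> (y \<cdot>\<^bsub>slice C B\<^esub> x) = (z \<cdot>\<^bsub>slice C B\<^esub> y) \<cdot>\<^bsub>slice C B\<^esub> x"
    by (cases x; cases y; cases z) (simp add: slice_def hom_def)
qed

lemma arrow_cat_category: "is_category (arrow_cat C)"
proof (rule is_categoryI)
  fix f g assume fg: "f \<in> Arr (arrow_cat C)" "g \<in> Arr (arrow_cat C)" "Cod (arrow_cat C) f = Dom (arrow_cat C) g"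
  obtain p a b p' where f: "f = (p, (a, b), p')" by (metis prod.exhaust)
  obtain c d p'' where g: "g = (p', (c, d), p'')" using fg f by (auto simp: arrow_cat_def)
  have *: "p \<in> Arr C" "p' \<in> Arr C" "p'' \<in> Arr C" "a \<in> Arr C" "b \<in> Arr C" "c \<in> Arr C" "d \<in> Arr C"
    "Dom C a = Dom C p" "Cod C a = Dom C p'" "Dom C b = Cod C p" "Cod C b = Cod C p'"
    "Dom C c = Dom C p'" "Cod C c = Dom C p''" "Dom C d = Cod C p'" "Cod C d = Cod C p''"
    "p' \<cdot> a = b \<cdot> p" "p'' \<cdot> c = d \<cdot> p'"
    using fg by (simp_all add: f g arrow_cat_def hom_def)
  have "p'' \<cdot> (c \<cdot> a) = d \<cdot> (b \<cdot> p)"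
    using square_extend[OF *(17), of a] * by simp
  then show "g \<cdot>\<^bsub>arrow_cat C\<^esub> f \<in> Arr (arrow_cat C) \<and>
      Dom (arrow_cat C) (g \<cdot>\<^bsub>arrow_cat C\<^esub> f) = Dom (arrow_cat C) f \<and>
      Cod (arrow_cat C) (g \<cdot>\<^bsub>arrow_cat C\<^esub> f) = Cod (arrow_cat C) g"
    using *(1-15) by (simp add: f g arrow_cat_def hom_def)
qed (simp_all add: arrow_cat_def hom_def split_paired_all)

lemma Obj_slice_in: "f \<in> Obj (slice_in C M B) \<longleftrightarrow> f \<in> Arr C \<and> Cod C f = B \<and> f \<in> M"
  by (auto simp: slice_in_def slice_def)

lemma Arr_slice_in: "(f, h, g) \<in> Arr (slice_in C M B) \<longleftrightarrow> f \<in> Arr C \<and> Cod C f = B \<and> g \<in> Arr C \<and> Cod C g = B \<and>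
    f \<in> M \<and> g \<in> M \<and> h \<in> Arr C \<and> Dom C h = Dom C f \<and> Cod C h = Dom C g \<and> g \<cdot> h = f"
  by (auto simp: slice_in_def slice_def hom_def)

lemma slice_in_simps:
  "Dom (slice_in C M B) (f, h, g) = f" "Cod (slice_in C M B) (f, h, g) = g"
  "Ide (slice_in C M B) f = (f, Ide C (Dom C f), f)"
  "(g', k, l) \<cdot>\<^bsub>slice_in C M B\<^esub> (f, h, g) = (f, k \<cdot> h, l)"
  by (simp_all add: slice_in_def slice_def)

lemma slice_in_category: "is_category (slice_in C M B)"
  unfolding slice_in_def by (intro category.full_subcat_category) (simp add: category_def slice_category)

end


section \<open>Algebras and the comparison functor\<close>

lemma EM_category:
  assumes T: "is_functor B B T"
  shows "is_category (EM B T \<eta> \<mu>)"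
proof -
  interpret B: category B using functorD(1)[OF T] by (simp add: category_def)
  note T' = functorD(3-)[OF T]
  let ?E = "EM B T \<eta> \<mu>"
  show ?thesis
  proof (rule is_categoryI)
    fix f g assume fg: "f \<in> Arr ?E" "g \<in> Arr ?E" "Cod ?E f = Dom ?E g"
    obtain xa h yb where f: "f = (xa, h, yb)" by (metis prod.exhaust)
    obtain k zc where g: "g = (yb, k, zc)" using fg f by (cases g) (auto simp: EM_def)
    obtain x a where xa: "xa = (x, a)" by fastforce
    obtain y b where yb: "yb = (y, b)" by fastforce
    obtain z c where zc: "zc = (z, c)" by fastforce
    have *: "h \<in> Arr B" "Dom B h = x" "Cod B h = y" "k \<in> Arr B" "Dom B k = y" "Cod B k = z"
      "h \<cdot>\<^bsub>B\<^esub> a = b \<cdot>\<^bsub>B\<^esub> FArr T h" "k \<cdot>\<^bsub>B\<^esub> b = c \<cdot>\<^bsub>B\<^esub> FArr T k"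
      "is_algebra B T \<eta> \<mu> xa" "is_algebra B T \<eta> \<mu> yb" "is_algebra B T \<eta> \<mu> zc"
      using fg by (simp_all add: f g EM_def hom_def xa yb zc)
    have alg: "a \<in> Arr B" "Dom B a = FObj T x" "Cod B a = x" "b \<in> Arr B" "Dom B b = FObj T y" "Cod B b = y"
      "c \<in> Arr B" "Dom B c = FObj T z" "Cod B c = z"
      using *(9-11) by (simp_all add: xa yb zc is_algebra_def hom_def)
    have "(k \<cdot>\<^bsub>B\<^esub> h) \<cdot>\<^bsub>B\<^esub> a = k \<cdot>\<^bsub>B\<^esub> (b \<cdot>\<^bsub>B\<^esub> FArr T h)"
      using *(1-7) alg by simp
    also have "\<dots> = c \<cdot>\<^bsub>B\<^esub> (FArr T k \<cdot>\<^bsub>B\<^esub> FArr T h)"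
      using *(1-6) alg T' by (intro B.square_extend[OF *(8)]) simp_all
    finally show "g \<cdot>\<^bsub>?E\<^esub> f \<in> Arr ?E \<and> Dom ?E (g \<cdot>\<^bsub>?E\<^esub> f) = Dom ?E f \<and> Cod ?E (g \<cdot>\<^bsub>?E\<^esub> f) = Cod ?E g"
      using *(1-6,9-11) T' by (simp add: f g EM_def hom_def xa yb zc)
  next
    fix xa assume "xa \<in> Obj ?E"
    then show "Ide ?E xa \<in> Arr ?E \<and> Dom ?E (Ide ?E xa) = xa \<and> Cod ?E (Ide ?E xa) = xa"
      using T' by (auto simp: EM_def hom_def is_algebra_def)
  qed (auto simp: EM_def hom_def is_algebra_def)
qed

lemma adjunctionD:
  assumes "is_adjunction A B L R \<eta> \<epsilon>"
  shows "is_functor A B L" "is_functor B A R"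
    "is_nat_trans A A id_functor (comp_functor R L) \<eta>"
    "is_nat_trans B B (comp_functor L R) id_functor \<epsilon>"
    "a \<in> Obj A \<Longrightarrow> \<epsilon> (FObj L a) \<cdot>\<^bsub>B\<^esub> FArr L (\<eta> a) = Ide B (FObj L a)"
    "b \<in> Obj B \<Longrightarrow> FArr R (\<epsilon> b) \<cdot>\<^bsub>A\<^esub> \<eta> (FObj R b) = Ide A (FObj R b)"
  using assms unfolding is_adjunction_def by simp_all

text \<open>The associativity law of the algebra \<open>(U a, U \<epsilon>\<^sub>a)\<close> is \<open>U\<close> applied to the naturality of \<open>\<epsilon>\<close> at
  \<open>\<epsilon>\<^sub>a\<close>, its unit law is a triangle identity, and images of arrows are algebra morphisms by the
  naturality of \<open>\<epsilon>\<close>.\<close>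

lemma comparison_functor:
  assumes adj: "is_adjunction B A L U \<eta> \<epsilon>"
  shows "is_functor A (EM B (comp_functor U L) \<eta> (\<lambda>b\<in>Obj B. FArr U (\<epsilon> (FObj L b)))) (comparison A U \<epsilon>)"
proof -
  note L = functorD[OF adjunctionD(1)[OF adj]] and U = functorD[OF adjunctionD(2)[OF adj]]
  note \<epsilon> = nat_transD[OF adjunctionD(4)[OF adj], simplified]
  interpret B: category B using L(1) by (simp add: category_def)
  interpret A: category A using L(2) by (simp add: category_def)
  let ?T = "comp_functor U L" and ?m = "\<lambda>b\<in>Obj B. FArr U (\<epsilon> (FObj L b))"
  let ?E = "EM B ?T \<eta> ?m"
  have alg: "is_algebra B ?T \<eta> ?m (FObj U a, FArr U (\<epsilon> a))" if a: "a \<in> Obj A" for a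
  proof -
    have "\<epsilon> a \<cdot>\<^bsub>A\<^esub> FArr L (FArr U (\<epsilon> a)) = \<epsilon> a \<cdot>\<^bsub>A\<^esub> \<epsilon> (FObj L (FObj U a))"
      using \<epsilon>(7)[of "\<epsilon> a"] \<epsilon>(4-6)[OF a] a by simp
    then have "FArr U (\<epsilon> a \<cdot>\<^bsub>A\<^esub> FArr L (FArr U (\<epsilon> a))) = FArr U (\<epsilon> a \<cdot>\<^bsub>A\<^esub> \<epsilon> (FObj L (FObj U a)))"
      by simp
    then show ?thesis
      using a adjunctionD(6)[OF adj a] L U \<epsilon>(4-6) by (simp add: is_algebra_def hom_def)
  qed
  have nat: "FArr U f \<cdot>\<^bsub>B\<^esub> FArr U (\<epsilon> (Dom A f)) = FArr U (\<epsilon> (Cod A f)) \<cdot>\<^bsub>B\<^esub> FArr U (FArr L (FArr U f))"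
    if f: "f \<in> Arr A" for f
  proof -
    have "FArr U (f \<cdot>\<^bsub>A\<^esub> \<epsilon> (Dom A f)) = FArr U (\<epsilon> (Cod A f) \<cdot>\<^bsub>A\<^esub> FArr L (FArr U f))"
      using \<epsilon>(7)[OF f] by simp
    then show ?thesis
      using f L(3-6) U(3-) \<epsilon>(4-6) by simp
  qed
  show ?thesis
  proof (rule is_functorI[OF A.category EM_category[OF comp_functor[OF adjunctionD(1,2)[OF adj]]]])
    fix f assume f: "f \<in> Arr A"
    show "FArr (comparison A U \<epsilon>) f \<in> Arr ?E \<and>
         Dom ?E (FArr (comparison A U \<epsilon>) f) = FObj (comparison A U \<epsilon>) (Dom A f) \<and>
         Cod ?E (FArr (comparison A U \<epsilon>) f) = FObj (comparison A U \<epsilon>) (Cod A f)"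
      using f alg nat U by (simp add: comparison_def EM_def hom_def)
  qed (use alg U in \<open>simp_all add: comparison_def EM_def\<close>)
qed

text \<open>If \<open>h a = b T(h)\<close> with \<open>h\<close> invertible, then \<open>h\<^sup>-\<^sup>1 b = a T(h\<^sup>-\<^sup>1)\<close>, so invertibility of the
  underlying arrow suffices.\<close>

lemma EM_iso:
  assumes T: "is_functor B B T" and h: "(xa, h, yb) \<in> Arr (EM B T \<eta> \<mu>)" and iso: "is_iso B h"
  shows "is_iso (EM B T \<eta> \<mu>) (xa, h, yb)"
proof -
  interpret B: category B using functorD(1)[OF T] by (simp add: category_def)
  interpret E: category "EM B T \<eta> \<mu>" using EM_category[OF T] by (simp add: category_def)
  note T' = functorD(3-)[OF T]
  obtain x a where xa: "xa = (x, a)" by fastforce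
  obtain y b where yb: "yb = (y, b)" by fastforce
  have *: "h \<in> Arr B" "Dom B h = x" "Cod B h = y" "h \<cdot>\<^bsub>B\<^esub> a = b \<cdot>\<^bsub>B\<^esub> FArr T h"
      "is_algebra B T \<eta> \<mu> (x, a)" "is_algebra B T \<eta> \<mu> (y, b)"
    using h by (simp_all add: EM_def hom_def xa yb)
  have alg: "a \<in> Arr B" "Dom B a = FObj T x" "Cod B a = x" "b \<in> Arr B" "Dom B b = FObj T y" "Cod B b = y"
    using *(5-6) by (simp_all add: is_algebra_def hom_def)
  let ?k = "inv_arr B h"
  note k = B.inv_arr[OF iso]
  have "FArr T h \<cdot>\<^bsub>B\<^esub> FArr T ?k = FArr T (h \<cdot>\<^bsub>B\<^esub> ?k)"
    using k by (intro T'(6)[symmetric]) simp_all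
  also have "\<dots> = Ide B (FObj T y)"
    unfolding k(6) *(3) using T'(5) *(3) B.Cod_Obj[OF *(1)] by simp
  finally have Tk: "FArr T h \<cdot>\<^bsub>B\<^esub> FArr T ?k = Ide B (FObj T y)" .
  have "h \<cdot>\<^bsub>B\<^esub> (a \<cdot>\<^bsub>B\<^esub> FArr T ?k) = b \<cdot>\<^bsub>B\<^esub> (FArr T h \<cdot>\<^bsub>B\<^esub> FArr T ?k)"
    using *(1-3) alg k T' by (intro B.square_extend[OF *(4)]) simp_all
  also have "\<dots> = h \<cdot>\<^bsub>B\<^esub> (?k \<cdot>\<^bsub>B\<^esub> b)"
    unfolding Tk using *(1-3) alg iso by simp
  finally have "a \<cdot>\<^bsub>B\<^esub> FArr T ?k = ?k \<cdot>\<^bsub>B\<^esub> b"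
    using *(1-3) alg k T' by - (rule B.iso_left_cancel[OF iso], simp_all)
  then have "(yb, ?k, xa) \<in> Arr (EM B T \<eta> \<mu>)"
    using *(1-3,5,6) k by (simp add: EM_def hom_def xa yb)
  moreover have "Dom (EM B T \<eta> \<mu>) (yb, ?k, xa) = Cod (EM B T \<eta> \<mu>) (xa, h, yb)"
    "Cod (EM B T \<eta> \<mu>) (yb, ?k, xa) = Dom (EM B T \<eta> \<mu>) (xa, h, yb)"
    "(yb, ?k, xa) \<cdot>\<^bsub>EM B T \<eta> \<mu>\<^esub> (xa, h, yb) = Ide (EM B T \<eta> \<mu>) (Dom (EM B T \<eta> \<mu>) (xa, h, yb))"
    "(xa, h, yb) \<cdot>\<^bsub>EM B T \<eta> \<mu>\<^esub> (yb, ?k, xa) = Ide (EM B T \<eta> \<mu>) (Cod (EM B T \<eta> \<mu>) (xa, h, yb))"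
    using *(1-3) k by (simp_all add: EM_def xa yb)
  ultimately show ?thesis
    using h E.is_isoI by blast
qed

section \<open>Split fibrations are monadic\<close>

lemma (in category) fibration_classD:
  assumes "fibration_class C M"
  shows "f \<in> M \<Longrightarrow> f \<in> Arr C" "is_iso C f \<Longrightarrow> f \<in> M"
    "f \<in> M \<Longrightarrow> g \<in> Arr C \<Longrightarrow> Cod C f = Cod C g \<Longrightarrow> \<exists>p q. is_pullback C f g p q"
    "f \<in> M \<Longrightarrow> is_pullback C f g p q \<Longrightarrow> q \<in> M"
    "f \<in> M \<Longrightarrow> g \<in> M \<Longrightarrow> Cod C f = Dom C g \<Longrightarrow> g \<cdot> f \<in> M"
  using assms pullbackD(2,3)[of f g p q] unfolding fibration_class_def pullback_stable_def by blast+

text \<open>For a fibration \<open>p\<close>, pulling back along \<open>p\<close> (\<open>pull\<close>) is right adjoint to composing with \<open>p\<close>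
  (\<open>push\<close>). In terms of elements, \<open>pull f\<close> consists of the pairs \<open>(y, e)\<close> with \<open>f y = p e\<close>; its two
  projections are \<open>fs f\<close> and \<open>sn f\<close>, and \<open>pair f x y\<close> is the induced arrow into it. The unit at \<open>f\<close>
  is \<open>y \<mapsto> (y, f y)\<close> and the counit at \<open>g\<close> is \<open>(y, e) \<mapsto> y\<close>.\<close>

locale fibration = category C for C :: "('o, 'a) cat" (structure) +
  fixes M :: "'a set" and p :: 'a
  assumes M: "fibration_class C M" and p_M: "p \<in> M"
begin

abbreviation "\<A> \<equiv> slice_in C M (Cod C p)"
abbreviation "\<B> \<equiv> slice_in C M (Dom C p)"
abbreviation "pull \<equiv> pullback_functor C p"
abbreviation "fs f \<equiv> pb_fst C f p"
abbreviation "sn f \<equiv> pb_snd C f p"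
abbreviation "pair f x y \<equiv> pb_tuple C f p x y"

definition push :: "('a, 'a \<times> 'a \<times> 'a, 'a, 'a \<times> 'a \<times> 'a) func" where
  "push = \<lparr>FObj = (\<lambda>f. p \<cdot> f), FArr = (\<lambda>(f, h, g). (p \<cdot> f, h, p \<cdot> g))\<rparr>"

definition push_unit :: "'a \<Rightarrow> 'a \<times> 'a \<times> 'a" where
  "push_unit = (\<lambda>f\<in>Obj \<B>. (f, pair (p \<cdot> f) (Ide C (Dom C f)) f, sn (p \<cdot> f)))"

definition push_counit :: "'a \<Rightarrow> 'a \<times> 'a \<times> 'a" where
  "push_counit = (\<lambda>g\<in>Obj \<A>. (p \<cdot> sn g, fs g, g))"

lemma p [simp]: "p \<in> Arr C" using fibration_classD(1)[OF M p_M] .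

lemma pb: "f \<in> M \<Longrightarrow> Cod C f = Cod C p \<Longrightarrow> is_pullback C f p (fs f) (sn f)"
  using fibration_classD(1,3)[OF M] pb_is_pullback p by metis

lemma pb_simps [simp]:
  assumes "f \<in> M" "Cod C f = Cod C p"
  shows "fs f \<in> Arr C" "sn f \<in> Arr C" "Dom C (fs f) = Dom C (sn f)" "Cod C (fs f) = Dom C f"
    "Cod C (sn f) = Dom C p" "f \<cdot> fs f = p \<cdot> sn f" "sn f \<in> M"
  using pullbackD[OF pb[OF assms]] fibration_classD(4)[OF M assms(1) pb[OF assms]] by simp_all

lemma M_Arr [simp]: "f \<in> M \<Longrightarrow> f \<in> Arr C"
  and M_push [simp]: "f \<in> M \<Longrightarrow> Cod C f = Dom C p \<Longrightarrow> p \<cdot> f \<in> M"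
  using fibration_classD[OF M] p_M by auto

lemma pb_sq [simp]:
  assumes "f \<in> M" "Cod C f = Cod C p" "x \<in> Arr C" "Cod C x = Dom C (sn f)"
  shows "f \<cdot> (fs f \<cdot> x) = p \<cdot> (sn f \<cdot> x)"
  using assms by (intro square_extend) simp_all

lemma push_pb_sq [simp]:
  assumes "f \<in> M" "Cod C f = Dom C p"
  shows "p \<cdot> (f \<cdot> fs (p \<cdot> f)) = p \<cdot> sn (p \<cdot> f)"
proof -
  have "(p \<cdot> f) \<cdot> fs (p \<cdot> f) = p \<cdot> sn (p \<cdot> f)"
    using assms by (intro pb_simps) simp_all
  moreover have "(p \<cdot> f) \<cdot> fs (p \<cdot> f) = p \<cdot> (f \<cdot> fs (p \<cdot> f))"
    using assms by (intro comp_assoc) simp_all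
  ultimately show ?thesis by simp
qed

lemma push_pb_sq_comp [simp]:
  assumes "f \<in> M" "Cod C f = Dom C p" "x \<in> Arr C" "Cod C x = Dom C (sn (p \<cdot> f))"
  shows "p \<cdot> (f \<cdot> (fs (p \<cdot> f) \<cdot> x)) = p \<cdot> (sn (p \<cdot> f) \<cdot> x)"
proof -
  have "(p \<cdot> f) \<cdot> (fs (p \<cdot> f) \<cdot> x) = p \<cdot> (sn (p \<cdot> f) \<cdot> x)"
    using assms by (intro pb_sq) simp_all
  moreover have "(p \<cdot> f) \<cdot> (fs (p \<cdot> f) \<cdot> x) = p \<cdot> (f \<cdot> (fs (p \<cdot> f) \<cdot> x))"
    using assms by (intro comp_assoc) simp_all
  ultimately show ?thesis by simp
qed

lemma pair [simp]:
  assumes "f \<in> M" "Cod C f = Cod C p" "x \<in> Arr C" "y \<in> Arr C" "Dom C x = Dom C y" "Cod C x = Dom C f"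
    "Cod C y = Dom C p" "f \<cdot> x = p \<cdot> y"
  shows "pair f x y \<in> Arr C" "Dom C (pair f x y) = Dom C y" "Cod C (pair f x y) = Dom C (sn f)"
    "fs f \<cdot> pair f x y = x" "sn f \<cdot> pair f x y = y"
  using pb_tuple[OF pb[OF assms(1,2)] assms(3-8)] assms pb_simps by simp_all

lemma pair_comp [simp]:
  assumes "f \<in> M" "Cod C f = Cod C p" "x \<in> Arr C" "y \<in> Arr C" "Dom C x = Dom C y" "Cod C x = Dom C f"
    "Cod C y = Dom C p" "f \<cdot> x = p \<cdot> y" "z \<in> Arr C" "Cod C z = Dom C y"
  shows "fs f \<cdot> (pair f x y \<cdot> z) = x \<cdot> z" "sn f \<cdot> (pair f x y \<cdot> z) = y \<cdot> z"
  using assms pair[OF assms(1-8)] by (auto intro: eq_extend)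

lemma pair_eqI:
  assumes "f \<in> M" "Cod C f = Cod C p" "h \<in> Arr C" "h' \<in> Arr C" "Dom C h = Dom C h'"
    "Cod C h = Dom C (sn f)" "Cod C h' = Dom C (sn f)" "fs f \<cdot> h = fs f \<cdot> h'" "sn f \<cdot> h = sn f \<cdot> h'"
  shows "h = h'"
  using assms by - (rule pullback_eq[OF pb], simp_all)

lemma pull_simps:
  "FObj pull f = sn f" "FArr pull (f, h, g) = (sn f, pair g (h \<cdot> fs f) (sn f), sn g)"
  by (simp_all add: pullback_functor_def)

lemma push_simps: "FObj push f = p \<cdot> f" "FArr push (f, h, g) = (p \<cdot> f, h, p \<cdot> g)"
  by (simp_all add: push_def)

lemmas slice_pull_simps = Obj_slice_in Arr_slice_in slice_in_simps pull_simps push_simps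

lemma pull_functor: "is_functor \<A> \<B> pull"
proof (rule is_functorI[OF slice_in_category slice_in_category])
  fix x assume "x \<in> Arr \<A>"
  moreover obtain f h g where x: "x = (f, h, g)" by (metis prod.exhaust)
  ultimately have *: "f \<in> M" "g \<in> M" "Cod C f = Cod C p" "Cod C g = Cod C p" "h \<in> Arr C"
      "Dom C h = Dom C f" "Cod C h = Dom C g" "g \<cdot> h = f"
    by (simp_all add: slice_pull_simps)
  have e: "g \<cdot> (h \<cdot> fs f) = p \<cdot> sn f"
    using * eq_extend[OF *(8), of "fs f"] by simp
  show "FArr pull x \<in> Arr \<B> \<and> Dom \<B> (FArr pull x) = FObj pull (Dom \<A> x) \<and> Cod \<B> (FArr pull x) = FObj pull (Cod \<A> x)"
    using * e by (simp add: slice_pull_simps x)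
next
  fix f assume "f \<in> Obj \<A>"
  then have f: "f \<in> M" "Cod C f = Cod C p" by (simp_all add: slice_pull_simps)
  then have "pair f (Ide C (Dom C f) \<cdot> fs f) (sn f) = Ide C (Dom C (sn f))"
    by - (rule pair_eqI[of f], simp_all)
  then show "FArr pull (Ide \<A> f) = Ide \<B> (FObj pull f)"
    using f by (simp add: slice_pull_simps)
next
  fix x y assume xy: "x \<in> Arr \<A>" "y \<in> Arr \<A>" "Cod \<A> x = Dom \<A> y"
  obtain f h g where x: "x = (f, h, g)" by (metis prod.exhaust)
  obtain k l where y: "y = (g, k, l)" using xy by (cases y) (simp add: x slice_pull_simps)
  have *: "f \<in> M" "g \<in> M" "Cod C f = Cod C p" "Cod C g = Cod C p" "h \<in> Arr C"
      "Dom C h = Dom C f" "Cod C h = Dom C g" "g \<cdot> h = f" "l \<in> M" "Cod C l = Cod C p" "k \<in> Arr C"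
      "Dom C k = Dom C g" "Cod C k = Dom C l" "l \<cdot> k = g"
    using xy by (simp_all add: slice_pull_simps x y)
  have e: "g \<cdot> (h \<cdot> fs f) = p \<cdot> sn f" "l \<cdot> (k \<cdot> fs g) = p \<cdot> sn g"
    "l \<cdot> (k \<cdot> (h \<cdot> fs f)) = p \<cdot> sn f"
    using *(1-7,9-13) eq_extend[OF *(8), of "fs f"] eq_extend[OF *(14), of "fs g"]
      eq_extend[OF *(14), of "h \<cdot> fs f"] by simp_all
  have "pair l ((k \<cdot> h) \<cdot> fs f) (sn f) = pair l (k \<cdot> fs g) (sn g) \<cdot> pair g (h \<cdot> fs f) (sn f)"
    using *(1-7,9-13) e by - (rule pair_eqI[of l], simp_all)
  then show "FArr pull (y \<cdot>\<^bsub>\<A>\<^esub> x) = FArr pull y \<cdot>\<^bsub>\<B>\<^esub> FArr pull x"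
    by (simp add: slice_pull_simps x y)
qed (simp_all add: slice_pull_simps)

lemma push_functor: "is_functor \<B> \<A> push"
proof (rule is_functorI[OF slice_in_category slice_in_category])
  fix x assume "x \<in> Arr \<B>"
  then show "FArr push x \<in> Arr \<A> \<and> Dom \<A> (FArr push x) = FObj push (Dom \<B> x) \<and> Cod \<A> (FArr push x) = FObj push (Cod \<B> x)"
    by (cases x) (simp add: slice_pull_simps)
next
  fix x y assume "x \<in> Arr \<B>" "y \<in> Arr \<B>" "Cod \<B> x = Dom \<B> y"
  then show "FArr push (y \<cdot>\<^bsub>\<B>\<^esub> x) = FArr push y \<cdot>\<^bsub>\<A>\<^esub> FArr push x"
    by (cases x; cases y) (simp add: slice_pull_simps)
qed (simp_all add: slice_pull_simps)

lemma push_unit_simps: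
  assumes "f \<in> M" "Cod C f = Dom C p"
  shows "push_unit f = (f, pair (p \<cdot> f) (Ide C (Dom C f)) f, sn (p \<cdot> f))"
  using assms by (simp add: push_unit_def slice_pull_simps)

lemma push_counit_simps:
  assumes "g \<in> M" "Cod C g = Cod C p"
  shows "push_counit g = (p \<cdot> sn g, fs g, g)"
  using assms by (simp add: push_counit_def slice_pull_simps)

lemma push_pull_adjunction: "is_adjunction \<B> \<A> push pull push_unit push_counit"
  unfolding is_adjunction_def
proof (intro conjI ballI push_functor pull_functor)
  show "is_nat_trans \<B> \<B> id_functor (comp_functor pull push) push_unit"
  proof (rule nat_transI[OF id_functor[OF slice_in_category] comp_functor[OF push_functor pull_functor]])
    fix x assume "x \<in> Arr \<B>"
    moreover obtain f h g where x: "x = (f, h, g)" by (metis prod.exhaust)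
    ultimately have *: "f \<in> M" "g \<in> M" "Cod C f = Dom C p" "Cod C g = Dom C p" "h \<in> Arr C"
        "Dom C h = Dom C f" "Cod C h = Dom C g" "g \<cdot> h = f"
      by (simp_all add: slice_pull_simps)
    have e: "p \<cdot> (g \<cdot> (h \<cdot> fs (p \<cdot> f))) = p \<cdot> sn (p \<cdot> f)"
      using * eq_extend[OF *(8), of "fs (p \<cdot> f)"] by simp
    have "pair (p \<cdot> g) (h \<cdot> fs (p \<cdot> f)) (sn (p \<cdot> f)) \<cdot> pair (p \<cdot> f) (Ide C (Dom C f)) f =
        pair (p \<cdot> g) (Ide C (Dom C g)) g \<cdot> h"
      using * e by - (rule pair_eqI[of "p \<cdot> g"], simp_all)
    then show "FArr (comp_functor pull push) x \<cdot>\<^bsub>\<B>\<^esub> push_unit (Dom \<B> x) = push_unit (Cod \<B> x) \<cdot>\<^bsub>\<B>\<^esub> FArr id_functor x"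
      using * by (simp add: x slice_pull_simps push_unit_simps)
  qed (simp_all add: slice_pull_simps push_unit_def)
  show "is_nat_trans \<A> \<A> (comp_functor push pull) id_functor push_counit"
  proof (rule nat_transI[OF comp_functor[OF pull_functor push_functor] id_functor[OF slice_in_category]])
    fix x assume "x \<in> Arr \<A>"
    moreover obtain f h g where x: "x = (f, h, g)" by (metis prod.exhaust)
    ultimately have *: "f \<in> M" "g \<in> M" "Cod C f = Cod C p" "Cod C g = Cod C p" "h \<in> Arr C"
        "Dom C h = Dom C f" "Cod C h = Dom C g" "g \<cdot> h = f"
      by (simp_all add: slice_pull_simps)
    have "g \<cdot> (h \<cdot> fs f) = p \<cdot> sn f"
      using * eq_extend[OF *(8), of "fs f"] by simp
    then show "FArr id_functor x \<cdot>\<^bsub>\<A>\<^esub> push_counit (Dom \<A> x) = push_counit (Cod \<A> x) \<cdot>\<^bsub>\<A>\<^esub> FArr (comp_functor push pull) x"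
      using * by (simp add: x slice_pull_simps push_counit_simps)
  qed (simp_all add: slice_pull_simps push_counit_def)
next
  fix f assume "f \<in> Obj \<B>"
  then show "push_counit (FObj push f) \<cdot>\<^bsub>\<A>\<^esub> FArr push (push_unit f) = Ide \<A> (FObj push f)"
    by (simp add: slice_pull_simps push_counit_simps push_unit_simps)
next
  fix g assume "g \<in> Obj \<A>"
  then have g: "g \<in> M" "Cod C g = Cod C p" by (simp_all add: slice_pull_simps)
  have "pair g (fs g \<cdot> fs (p \<cdot> sn g)) (sn (p \<cdot> sn g)) \<cdot> pair (p \<cdot> sn g) (Ide C (Dom C (sn g))) (sn g) =
     Ide C (Dom C (sn g))"
    using g by - (rule pair_eqI[of g], simp_all)
  then show "FArr pull (push_counit g) \<cdot>\<^bsub>\<B>\<^esub> push_unit (FObj pull g) = Ide \<B> (FObj pull g)"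
    using g by (simp add: slice_pull_simps push_counit_simps push_unit_simps)
qed

lemma pairs_eqI:
  assumes "f \<in> M" "Cod C f = Cod C p" "x \<in> Arr C" "y \<in> Arr C" "Dom C x = Dom C y" "Cod C x = Dom C f"
    "Cod C y = Dom C p" "f \<cdot> x = p \<cdot> y" "h \<in> Arr C" "Dom C h = Dom C y" "Cod C h = Dom C (sn f)"
    "fs f \<cdot> h = x" "sn f \<cdot> h = y"
  shows "h = pair f x y"
  using assms by - (rule pair_eqI[of f], simp_all)

abbreviation "pull_algebras \<equiv> EM \<B> (comp_functor pull push) push_unit
  (\<lambda>b\<in>Obj \<B>. FArr pull (push_counit (FObj push b)))"

abbreviation "pull_comparison \<equiv> comparison \<A> pull push_counit"

lemma pull_counit:
  assumes "f \<in> M" "Cod C f = Cod C p"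
  shows "FArr pull (push_counit f) =
    (sn (p \<cdot> sn f), pair f (fs f \<cdot> fs (p \<cdot> sn f)) (sn (p \<cdot> sn f)), sn f)"
  using assms by (simp add: push_counit_simps pull_simps)

context
  fixes s
  assumes s: "s \<in> Arr C" "Dom C s = Cod C p" "Cod C s = Dom C p" "p \<cdot> s = Ide C (Cod C p)"
begin

lemma ps [simp]: "x \<in> Arr C \<Longrightarrow> Cod C x = Cod C p \<Longrightarrow> p \<cdot> (s \<cdot> x) = x"
  using eq_extend[OF s(4), of x] s by simp

text \<open>From here on \<open>p\<close> is split by \<open>s\<close>. Then every counit \<open>fs f\<close> is split by \<open>y \<mapsto> (y, s (f y))\<close>.\<close>

definition sect :: "'a \<Rightarrow> 'a" where
  "sect f = pair f (Ide C (Dom C f)) (s \<cdot> f)"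

lemma sect [simp]:
  assumes "f \<in> M" "Cod C f = Cod C p"
  shows "sect f \<in> Arr C" "Dom C (sect f) = Dom C f" "Cod C (sect f) = Dom C (sn f)"
    "fs f \<cdot> sect f = Ide C (Dom C f)" "sn f \<cdot> sect f = s \<cdot> f"
    "x \<in> Arr C \<Longrightarrow> Cod C x = Dom C f \<Longrightarrow> fs f \<cdot> (sect f \<cdot> x) = x"
    "x \<in> Arr C \<Longrightarrow> Cod C x = Dom C f \<Longrightarrow> sn f \<cdot> (sect f \<cdot> x) = s \<cdot> (f \<cdot> x)"
  using assms s unfolding sect_def by simp_all

text \<open>The pulled-back arrow determines \<open>h \<cdot> fs f\<close>, and \<open>fs f\<close> is a split epimorphism.\<close>

lemma comparison_faithful: "is_faithful \<A> pull_algebras pull_comparison"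
  unfolding is_faithful_def
proof (intro ballI impI)
  fix f g x y assume f: "f \<in> Obj \<A>" and g: "g \<in> Obj \<A>" and x: "x \<in> hom \<A> f g" and y: "y \<in> hom \<A> f g"
    and e: "FArr pull_comparison x = FArr pull_comparison y"
  obtain h where h: "x = (f, h, g)" using x by (cases x) (simp add: hom_def slice_pull_simps)
  obtain k where k: "y = (f, k, g)" using y by (cases y) (simp add: hom_def slice_pull_simps)
  have *: "f \<in> M" "g \<in> M" "Cod C f = Cod C p" "Cod C g = Cod C p" "h \<in> Arr C"
      "Dom C h = Dom C f" "Cod C h = Dom C g" "g \<cdot> h = f" "k \<in> Arr C"
      "Dom C k = Dom C f" "Cod C k = Dom C g" "g \<cdot> k = f"
    using x y by (simp_all add: slice_pull_simps hom_def h k)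
  have "g \<cdot> (h \<cdot> fs f) = p \<cdot> sn f" "g \<cdot> (k \<cdot> fs f) = p \<cdot> sn f"
    using * eq_extend[OF *(8), of "fs f"] eq_extend[OF *(12), of "fs f"] by simp_all
  then have "fs g \<cdot> pair g (h \<cdot> fs f) (sn f) = h \<cdot> fs f" "fs g \<cdot> pair g (k \<cdot> fs f) (sn f) = k \<cdot> fs f"
    using *(1-7,9-11) by simp_all
  moreover have "pair g (h \<cdot> fs f) (sn f) = pair g (k \<cdot> fs f) (sn f)"
    using e by (simp add: comparison_def h k slice_pull_simps)
  ultimately have "h \<cdot> fs f = k \<cdot> fs f"
    by metis
  then have "(h \<cdot> fs f) \<cdot> sect f = (k \<cdot> fs f) \<cdot> sect f" by (rule arg_cong)
  then show "x = y"
    using *(1-7,9-11) by (simp add: h k)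
qed

text \<open>The canonical algebra on \<open>pull f\<close> is the action \<open>((y, e), e') \<mapsto> (y, e')\<close>. An algebra morphism has
  the form \<open>(y, e) \<mapsto> (k\<^sub>1(y, e), e)\<close>, and compatibility with the actions says that \<open>k\<^sub>1(y, e)\<close> does not
  depend on \<open>e\<close>. It is therefore the pullback of \<open>y \<mapsto> k\<^sub>1(y, s (f y))\<close>.\<close>

lemma comparison_full: "is_full \<A> pull_algebras pull_comparison"
  unfolding is_full_def
proof (intro ballI)
  fix f g H assume f: "f \<in> Obj \<A>" and g: "g \<in> Obj \<A>"
    and H: "H \<in> hom pull_algebras (FObj pull_comparison f) (FObj pull_comparison g)"
  have *: "f \<in> M" "g \<in> M" "Cod C f = Cod C p" "Cod C g = Cod C p"
    using f g by (simp_all add: slice_pull_simps)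
  obtain k' where H1: "H = (FObj pull_comparison f, k', FObj pull_comparison g)"
    using H by (cases H) (simp add: hom_def EM_def)
  have k': "k' \<in> Arr \<B>" "Dom \<B> k' = sn f" "Cod \<B> k' = sn g"
    "k' \<cdot>\<^bsub>\<B>\<^esub> FArr pull (push_counit f) = FArr pull (push_counit g) \<cdot>\<^bsub>\<B>\<^esub> FArr pull (FArr push k')"
    using H by (simp_all add: H1 EM_def hom_def comparison_def slice_pull_simps)
  then obtain k where k'_def: "k' = (sn f, k, sn g)" by (cases k') (simp add: slice_pull_simps)
  have k: "k \<in> Arr C" "Dom C k = Dom C (sn f)" "Cod C k = Dom C (sn g)" "sn g \<cdot> k = sn f"
    using k'(1) by (simp_all add: slice_pull_simps k'_def)
  let ?fs = "fs (p \<cdot> sn f)" and ?sn = "sn (p \<cdot> sn f)"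
  have snk: "sn g \<cdot> (k \<cdot> x) = sn f \<cdot> x" if "x \<in> Arr C" "Cod C x = Dom C (sn f)" for x
    using k * that eq_extend[OF k(4), of x] by simp
  have e: "k \<cdot> pair f (fs f \<cdot> ?fs) ?sn = pair g (fs g \<cdot> fs (p \<cdot> sn g)) (sn (p \<cdot> sn g)) \<cdot> pair (p \<cdot> sn g) (k \<cdot> ?fs) ?sn"
    using k'(4) * by (simp add: k'_def pull_counit slice_pull_simps)
  have "fs g \<cdot> (k \<cdot> pair f (fs f \<cdot> ?fs) ?sn) = fs g \<cdot> (k \<cdot> ?fs)"
    unfolding e using *  k(1-3) snk by simp
  \<comment> \<open>The arrow \<open>(y, e) \<mapsto> ((y, s (f y)), e)\<close>, which the action on \<open>pull f\<close> sends back to \<open>(y, e)\<close>.\<close>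
  moreover let ?z = "pair (p \<cdot> sn f) (sect f \<cdot> fs f) (sn f)"
  have "pair f (fs f \<cdot> ?fs) ?sn \<cdot> ?z = Ide C (Dom C (sn f))"
    using * s by - (rule pair_eqI[of f], simp_all)
  moreover have "(fs g \<cdot> (k \<cdot> pair f (fs f \<cdot> ?fs) ?sn)) \<cdot> ?z = fs g \<cdot> (k \<cdot> (pair f (fs f \<cdot> ?fs) ?sn \<cdot> ?z))"
    using * k(1-3) s by simp
  moreover have "(fs g \<cdot> (k \<cdot> ?fs)) \<cdot> ?z = fs g \<cdot> (k \<cdot> (sect f \<cdot> fs f))"
    using * k(1-3) s by simp
  ultimately have gk: "fs g \<cdot> (k \<cdot> (sect f \<cdot> fs f)) = fs g \<cdot> k"
    using k * by simp
  let ?h = "fs g \<cdot> (k \<cdot> sect f)"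
  have h: "(f, ?h, g) \<in> Arr \<A>"
    using * k snk s by (simp add: slice_pull_simps)
  have "k = pair g (?h \<cdot> fs f) (sn f)"
    using * k snk s gk by (intro pairs_eqI) simp_all
  then have "FArr pull (f, ?h, g) = k'"
    by (simp add: slice_pull_simps k'_def)
  then show "\<exists>x\<in>hom \<A> f g. FArr pull_comparison x = H"
    using h by (intro bexI[of _ "(f, ?h, g)"]) (simp_all add: H1 comparison_def hom_def slice_pull_simps)
qed

text \<open>An algebra structure \<open>a\<close> on \<open>x : A \<rightarrow> E\<close> moves \<open>y\<close> to an element \<open>a(y, e)\<close> of the fibre over \<open>e\<close>,
  whenever \<open>p (x y) = p e\<close>. It descends to the pullback \<open>f\<close> of \<open>x\<close> along \<open>s\<close>, whose elements are
  those \<open>y\<close> lying over a point of the section; write \<open>j\<close> for the inclusion. The isomorphism is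
  \<open>\<phi>(y, e) = a(j y, e)\<close> with inverse \<open>\<psi>(y) = (d y, x y)\<close>, where \<open>j (d y) = a(y, s (p (x y)))\<close>.\<close>

lemma comparison_surjective:
  assumes xa: "xa \<in> Obj pull_algebras"
  shows "\<exists>f\<in>Obj \<A>. \<exists>i. is_iso pull_algebras i \<and> Dom pull_algebras i = FObj pull_comparison f \<and> Cod pull_algebras i = xa"
proof -
  obtain x a' where xa_def: "xa = (x, a')" by (cases xa)
  have a': "x \<in> Obj \<B>" "a' \<in> Arr \<B>" "Dom \<B> a' = sn (p \<cdot> x)" "Cod \<B> a' = x"
    "a' \<cdot>\<^bsub>\<B>\<^esub> push_unit x = Ide \<B> x"
    "a' \<cdot>\<^bsub>\<B>\<^esub> FArr pull (FArr push a') = a' \<cdot>\<^bsub>\<B>\<^esub> FArr pull (push_counit (p \<cdot> x))"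
    using xa by (simp_all add: xa_def EM_def is_algebra_def hom_def slice_pull_simps)
  have x: "x \<in> M" "Cod C x = Dom C p" using a'(1) by (simp_all add: slice_pull_simps)
  obtain a where a'_def: "a' = (sn (p \<cdot> x), a, x)"
    using a' by (cases a') (simp add: slice_pull_simps)
  let ?f1 = "fs (p \<cdot> x)" and ?s1 = "sn (p \<cdot> x)"
  let ?f2 = "fs (p \<cdot> ?s1)" and ?s2 = "sn (p \<cdot> ?s1)"
  have a: "a \<in> Arr C" "Dom C a = Dom C ?s1" "Cod C a = Dom C x" "x \<cdot> a = ?s1"
    using a'(2) by (simp_all add: a'_def slice_pull_simps)
  have xa: "x \<cdot> (a \<cdot> y) = ?s1 \<cdot> y" if "y \<in> Arr C" "Cod C y = Dom C ?s1" for y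
    using a x that eq_extend[OF a(4), of y] by simp
  have unit: "a \<cdot> pair (p \<cdot> x) (Ide C (Dom C x)) x = Ide C (Dom C x)"
    using a'(5) x by (simp add: a'_def slice_pull_simps push_unit_simps)
  have mult: "a \<cdot> pair (p \<cdot> x) (a \<cdot> ?f2) ?s2 = a \<cdot> pair (p \<cdot> x) (?f1 \<cdot> ?f2) ?s2"
    using a'(6) x by (simp add: a'_def slice_pull_simps pull_counit)
  \<comment> \<open>The multiplication law in elements: \<open>a(a(y), v) = a(y\<^sub>1, v)\<close> for a pair \<open>y = (y\<^sub>1, y\<^sub>2)\<close>.\<close>
  have act: "a \<cdot> pair (p \<cdot> x) (a \<cdot> y) v = a \<cdot> pair (p \<cdot> x) (?f1 \<cdot> y) v"
    if "y \<in> Arr C" "Cod C y = Dom C ?s1" "v \<in> Arr C" "Cod C v = Dom C p" "Dom C v = Dom C y"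
      "p \<cdot> v = p \<cdot> (?s1 \<cdot> y)" for y v
  proof -
    let ?w = "pair (p \<cdot> ?s1) y v"
    have "pair (p \<cdot> x) (a \<cdot> ?f2) ?s2 \<cdot> ?w = pair (p \<cdot> x) (a \<cdot> y) v"
      using x a(1-3) xa that by (intro pairs_eqI) simp_all
    moreover have "pair (p \<cdot> x) (?f1 \<cdot> ?f2) ?s2 \<cdot> ?w = pair (p \<cdot> x) (?f1 \<cdot> y) v"
      using x that by (intro pairs_eqI) simp_all
    moreover have "(a \<cdot> pair (p \<cdot> x) (a \<cdot> ?f2) ?s2) \<cdot> ?w = a \<cdot> (pair (p \<cdot> x) (a \<cdot> ?f2) ?s2 \<cdot> ?w)"
      using x a(1-3) xa that by simp
    moreover have "(a \<cdot> pair (p \<cdot> x) (?f1 \<cdot> ?f2) ?s2) \<cdot> ?w = a \<cdot> (pair (p \<cdot> x) (?f1 \<cdot> ?f2) ?s2 \<cdot> ?w)"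
      using x a(1-3) that by simp
    ultimately show ?thesis using mult by simp
  qed
  let ?f = "pb_snd C x s" and ?j = "pb_fst C x s"
  have P: "is_pullback C x s ?j ?f"
    using fibration_classD(3)[OF M x(1) s(1)] s x pb_is_pullback by auto
  note PD = pullbackD[OF P]
  have f: "?f \<in> M" "Cod C ?f = Cod C p" "?f \<in> Arr C"
    using fibration_classD(4)[OF M x(1) P] PD s by simp_all
  have j: "?j \<in> Arr C" "Dom C ?j = Dom C ?f" "Cod C ?j = Dom C x" "x \<cdot> ?j = s \<cdot> ?f"
    "y \<in> Arr C \<Longrightarrow> Cod C y = Dom C ?f \<Longrightarrow> x \<cdot> (?j \<cdot> y) = s \<cdot> (?f \<cdot> y)" for y
    using PD s square_extend[OF PD(9)] by simp_all
  let ?q = "pair (p \<cdot> x) (?j \<cdot> fs ?f) (sn ?f)"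
  have q [simp]: "?q \<in> Arr C" "Dom C ?q = Dom C (sn ?f)" "Cod C ?q = Dom C ?s1" "?f1 \<cdot> ?q = ?j \<cdot> fs ?f"
    "?s1 \<cdot> ?q = sn ?f" "y \<in> Arr C \<Longrightarrow> Cod C y = Dom C (sn ?f) \<Longrightarrow> ?f1 \<cdot> (?q \<cdot> y) = ?j \<cdot> (fs ?f \<cdot> y)"
    "y \<in> Arr C \<Longrightarrow> Cod C y = Dom C (sn ?f) \<Longrightarrow> ?s1 \<cdot> (?q \<cdot> y) = sn ?f \<cdot> y" for y
    using f j s x by simp_all
  let ?\<phi> = "a \<cdot> ?q"
  have \<phi>: "(sn ?f, ?\<phi>, x) \<in> Arr \<B>"
    using x f a xa by (simp add: slice_pull_simps)
  let ?f3 = "fs (p \<cdot> sn ?f)" and ?s3 = "sn (p \<cdot> sn ?f)"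
  have e1: "?q \<cdot> pair ?f (fs ?f \<cdot> ?f3) ?s3 = pair (p \<cdot> x) (?f1 \<cdot> (?q \<cdot> ?f3)) ?s3"
    using x f s j by (intro pairs_eqI) simp_all
  have "a \<cdot> (?q \<cdot> pair ?f (fs ?f \<cdot> ?f3) ?s3) = a \<cdot> pair (p \<cdot> x) (a \<cdot> (?q \<cdot> ?f3)) ?s3"
    unfolding e1 using x f by (intro act[symmetric]) simp_all
  then have alg: "(sn ?f, ?\<phi>, x) \<cdot>\<^bsub>\<B>\<^esub> FArr pull (push_counit ?f) = a' \<cdot>\<^bsub>\<B>\<^esub> FArr pull (FArr push (sn ?f, ?\<phi>, x))"
    using x f a(1-3) by (simp add: pull_counit slice_pull_simps a'_def)
  have obj: "(sn ?f, FArr pull (push_counit ?f)) \<in> Obj pull_algebras"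
    using functorD(3)[OF comparison_functor[OF push_pull_adjunction], of ?f] f by (simp add: comparison_def slice_pull_simps)
  have arr: "((sn ?f, FArr pull (push_counit ?f)), (sn ?f, ?\<phi>, x), xa) \<in> Arr pull_algebras"
    using assms obj \<phi> alg by (simp add: EM_def xa_def hom_def slice_pull_simps)
  \<comment> \<open>The arrow \<open>y \<mapsto> (y, s (p (x y)))\<close>.\<close>
  let ?e = "pair (p \<cdot> x) (Ide C (Dom C x)) (s \<cdot> (p \<cdot> x))"
  have e [simp]: "?e \<in> Arr C" "Dom C ?e = Dom C x" "Cod C ?e = Dom C ?s1" "?f1 \<cdot> ?e = Ide C (Dom C x)"
    "?s1 \<cdot> ?e = s \<cdot> (p \<cdot> x)"
    using x s by simp_all
  obtain d where d: "d \<in> Arr C" "Dom C d = Dom C x" "Cod C d = Dom C ?f" "?j \<cdot> d = a \<cdot> ?e" "?f \<cdot> d = p \<cdot> x"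
    by (rule pullback_lift[OF P, of "a \<cdot> ?e" "p \<cdot> x"]) (use a(1-3) xa x s j in simp_all)
  let ?\<psi> = "pair ?f d x"
  have \<psi>: "(x, ?\<psi>, sn ?f) \<in> Arr \<B>"
    using x f d by (simp add: slice_pull_simps)
  have e2: "?q \<cdot> ?\<psi> = pair (p \<cdot> x) (a \<cdot> ?e) x"
    using x f d a(1-3) xa s j(1-4) by (intro pairs_eqI) simp_all
  have "a \<cdot> (?q \<cdot> ?\<psi>) = a \<cdot> pair (p \<cdot> x) (?f1 \<cdot> ?e) x"
    unfolding e2 using x s by (intro act) simp_all
  then have \<phi>\<psi>: "?\<phi> \<cdot> ?\<psi> = Ide C (Dom C x)"
    using unit x a(1-3) f d by simp
  have e3: "?e \<cdot> ?\<phi> = pair (p \<cdot> x) (a \<cdot> ?q) (s \<cdot> (p \<cdot> sn ?f))"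
    using x a(1-3) xa s f by (intro pairs_eqI) simp_all
  \<comment> \<open>The second components agree because \<open>x j = s f\<close> and \<open>f fs\<^sub>f = p sn\<^sub>f\<close>.\<close>
  have e4: "pair (p \<cdot> x) (?f1 \<cdot> ?q) (s \<cdot> (p \<cdot> sn ?f)) = pair (p \<cdot> x) (Ide C (Dom C x)) x \<cdot> (?j \<cdot> fs ?f)"
    using x f s j by (intro pairs_eqI[symmetric]) simp_all
  have "a \<cdot> (?e \<cdot> ?\<phi>) = a \<cdot> pair (p \<cdot> x) (?f1 \<cdot> ?q) (s \<cdot> (p \<cdot> sn ?f))"
    unfolding e3 using x s f by (intro act) simp_all
  also have "\<dots> = (a \<cdot> pair (p \<cdot> x) (Ide C (Dom C x)) x) \<cdot> (?j \<cdot> fs ?f)"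
    unfolding e4 using x f a(1-3) j(1-3) by simp
  also have "\<dots> = ?j \<cdot> fs ?f"
    unfolding unit using j(1-3) f by simp
  finally have "a \<cdot> (?e \<cdot> ?\<phi>) = ?j \<cdot> fs ?f" .
  moreover have "?j \<cdot> (d \<cdot> ?\<phi>) = a \<cdot> (?e \<cdot> ?\<phi>)"
    using x a(1-3) d(1-3) j(1-3) f by (intro square_extend[OF d(4)]) simp_all
  moreover have "?f \<cdot> (d \<cdot> ?\<phi>) = ?f \<cdot> fs ?f"
    using eq_extend[OF d(5), of ?\<phi>] x a(1-3) xa d(1-3) f by simp
  ultimately have d\<phi>: "d \<cdot> ?\<phi> = fs ?f"
    using x a(1-3) d(1-3) f j(1-3) by - (rule pullback_eq[OF P], simp_all)
  have "?\<psi> \<cdot> ?\<phi> = Ide C (Dom C (sn ?f))"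
    using d\<phi> x a(1-3) xa f d by - (rule pair_eqI[of ?f], simp_all)
  then have "is_iso \<B> (sn ?f, ?\<phi>, x)"
    using \<phi> \<psi> \<phi>\<psi> slice_in_category[of M "Dom C p"]
    by (intro category.is_isoI[of _ _ "(x, ?\<psi>, sn ?f)"]) (simp_all add: slice_pull_simps category_def)
  from EM_iso[OF comp_functor[OF push_functor pull_functor] arr this]
  moreover have "Dom pull_algebras (X, m, Y) = X" "Cod pull_algebras (X, m, Y) = Y" for X m Y
    by (simp_all add: EM_def)
  moreover have "FObj pull_comparison ?f = (sn ?f, FArr pull (push_counit ?f))"
    by (simp add: comparison_def slice_pull_simps)
  moreover have "?f \<in> Obj \<A>" using f by (simp add: slice_pull_simps)
  ultimately show ?thesis
    by metis
qed

lemma split_monadic: "is_monadic \<A> \<B> pull"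
  unfolding is_monadic_def
  using push_pull_adjunction equivalence_if_full_faithful_surjective[OF
      comparison_functor[OF push_pull_adjunction] comparison_full comparison_faithful comparison_surjective] by blast

end

end

section \<open>Galois structures given by a full reflective subcategory\<close>

text \<open>The base category is named \<open>C\<close> by an equation, so that it can serve as the implicit structure
  in composites.\<close>

locale reflective_galois = category C for C :: "('o, 'a) cat" (structure) +
  fixes \<Gamma> :: "('o, 'a, 'o, 'a) galois"
  assumes Base [simp]: "Base \<Gamma> = C"
    and galois: "is_galois_structure \<Gamma>"
    and admissible: "admissible \<Gamma>"
    and complete: "finitely_complete C"
    and pointed: "pointed C"
    and subcategory: "is_full_subcategory (Target \<Gamma>) C"
    and inclusion: "is_inclusion (Target \<Gamma>) (RightAdj \<Gamma>)"
    and monadic_stable: "pullback_stable C {p. monadic_extension \<Gamma> p}"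
    and ex_weakly_universal: "\<forall>B\<in>Obj C. \<exists>u. weakly_universal \<Gamma> u \<and> Cod C u = B"
    and fibrant: "\<forall>E\<in>Obj C. \<forall>z t. is_zero_object (Target \<Gamma>) z \<and>
           t \<in> hom (Target \<Gamma>) (FObj (LeftAdj \<Gamma>) E) z \<longrightarrow> t \<in> FibF \<Gamma>"
begin

abbreviation "X \<equiv> Target \<Gamma>"
abbreviation "I \<equiv> FArr (LeftAdj \<Gamma>)"
abbreviation "IO \<equiv> FObj (LeftAdj \<Gamma>)"
abbreviation "\<eta> \<equiv> EtaG \<Gamma>"

lemma X_category: "is_category X"
  using subcategory by (simp add: is_full_subcategory_def)

interpretation X: category X using X_category by (simp add: category_def)

lemma X_Obj [simp]: "a \<in> Obj X \<Longrightarrow> a \<in> Obj C"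
  using subcategory by (auto simp: is_full_subcategory_def)

lemma Arr_X: "f \<in> Arr X \<longleftrightarrow> f \<in> Arr C \<and> Dom C f \<in> Obj X \<and> Cod C f \<in> Obj X"
  using subcategory by (auto simp: is_full_subcategory_def)

lemma X_simps:
  "f \<in> Arr X \<Longrightarrow> Dom X f = Dom C f" "f \<in> Arr X \<Longrightarrow> Cod X f = Cod C f"
  "a \<in> Obj X \<Longrightarrow> Ide X a = Ide C a"
  "f \<in> Arr X \<Longrightarrow> g \<in> Arr X \<Longrightarrow> Cod C f = Dom C g \<Longrightarrow> g \<cdot>\<^bsub>X\<^esub> f = g \<cdot> f"
  using subcategory by (auto simp: is_full_subcategory_def)

lemma X_hom: "a \<in> Obj X \<Longrightarrow> b \<in> Obj X \<Longrightarrow> hom X a b = hom C a b"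
  unfolding hom_def using Arr_X X_simps(1,2) by auto

lemma adjunction: "is_adjunction C X (LeftAdj \<Gamma>) (RightAdj \<Gamma>) \<eta> (EpsG \<Gamma>)"
  and FibE: "fibration_class C (FibE \<Gamma>)"
  and FibF: "fibration_class X (FibF \<Gamma>)"
  and RightAdj_FibF: "FArr (RightAdj \<Gamma>) ` FibF \<Gamma> \<subseteq> FibE \<Gamma>"
  and I_FibE: "f \<in> FibE \<Gamma> \<Longrightarrow> I f \<in> FibF \<Gamma>"
  using galois by (auto simp: is_galois_structure_def)

lemma RightAdj [simp]: "a \<in> Obj X \<Longrightarrow> FObj (RightAdj \<Gamma>) a = a" "f \<in> Arr X \<Longrightarrow> FArr (RightAdj \<Gamma>) f = f"
  using inclusion by (auto simp: is_inclusion_def)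

lemma FibF_Arr: "f \<in> FibF \<Gamma> \<Longrightarrow> f \<in> Arr X"
  using X.fibration_classD(1)[OF FibF] .

lemma FibF_FibE: "f \<in> FibF \<Gamma> \<Longrightarrow> f \<in> FibE \<Gamma>"
  using RightAdj_FibF FibF_Arr by fastforce

lemma FibE_Arr: "f \<in> FibE \<Gamma> \<Longrightarrow> f \<in> Arr C"
  using fibration_classD(1)[OF FibE] .

lemma IO [simp]: "a \<in> Obj C \<Longrightarrow> IO a \<in> Obj X"
  using functorD(3)[OF adjunctionD(1)[OF adjunction]] .

lemma I_X: "f \<in> Arr C \<Longrightarrow> I f \<in> Arr X"
  using functorD(4)[OF adjunctionD(1)[OF adjunction]] .

lemma I [simp]:
  "f \<in> Arr C \<Longrightarrow> I f \<in> Arr C" "f \<in> Arr C \<Longrightarrow> Dom C (I f) = IO (Dom C f)"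
  "f \<in> Arr C \<Longrightarrow> Cod C (I f) = IO (Cod C f)" "a \<in> Obj C \<Longrightarrow> I (Ide C a) = Ide C (IO a)"
  "f \<in> Arr C \<Longrightarrow> g \<in> Arr C \<Longrightarrow> Cod C f = Dom C g \<Longrightarrow> I (g \<cdot> f) = I g \<cdot> I f"
proof -
  note F = functorD[OF adjunctionD(1)[OF adjunction]]
  show *: "I f \<in> Arr C" "Dom C (I f) = IO (Dom C f)" "Cod C (I f) = IO (Cod C f)" if "f \<in> Arr C" for f
    using F(4-6)[OF that] Arr_X X_simps(1,2) by auto
  show "I (Ide C a) = Ide C (IO a)" if "a \<in> Obj C"
    using F(7)[OF that] X_simps(3) that by simp
  show "I (g \<cdot> f) = I g \<cdot> I f" if "f \<in> Arr C" "g \<in> Arr C" "Cod C f = Dom C g"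
    using F(8)[OF that] X_simps(4)[OF I_X[of f] I_X[of g]] that * by simp
qed

lemma \<eta> [simp]:
  assumes "a \<in> Obj C"
  shows "\<eta> a \<in> Arr C" "Dom C (\<eta> a) = a" "Cod C (\<eta> a) = IO a"
  using nat_transD(4-6)[OF adjunctionD(3)[OF adjunction] assms] assms by simp_all

lemma \<eta>_natural: "f \<in> Arr C \<Longrightarrow> I f \<cdot> \<eta> (Dom C f) = \<eta> (Cod C f) \<cdot> f"
  using nat_transD(7)[OF adjunctionD(3)[OF adjunction], of f] I_X by simp

lemma \<eta>_natural_comp:
  "f \<in> Arr C \<Longrightarrow> x \<in> Arr C \<Longrightarrow> Cod C x = Dom C f \<Longrightarrow> I f \<cdot> (\<eta> (Dom C f) \<cdot> x) = \<eta> (Cod C f) \<cdot> (f \<cdot> x)"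
  by (intro square_extend[OF \<eta>_natural]) simp_all

text \<open>The universal property of the unit, in elementary form: the extension of \<open>x\<close> along \<open>\<eta>\<close> is
  \<open>\<epsilon> I(x)\<close>.\<close>

lemma reflect:
  assumes "x \<in> Arr C" "Cod C x \<in> Obj X"
  obtains y where "y \<in> Arr C" "Dom C y = IO (Dom C x)" "Cod C y = Cod C x" "y \<cdot> \<eta> (Dom C x) = x"
proof -
  let ?b = "Cod C x" and ?e = "EpsG \<Gamma> (Cod C x)"
  note E = nat_transD[OF adjunctionD(4)[OF adjunction], simplified]
  have e: "?e \<in> Arr X" "Dom X ?e = IO ?b" "Cod X ?e = ?b"
    using E(4-6)[OF assms(2)] assms by simp_all
  then have e': "?e \<in> Arr C" "Dom C ?e = IO ?b" "Cod C ?e = ?b"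
    using Arr_X X_simps by auto
  have "?e \<cdot> \<eta> ?b = Ide C ?b"
    using adjunctionD(6)[OF adjunction assms(2)] assms e by simp
  then have "?e \<cdot> (\<eta> ?b \<cdot> x) = x"
    using eq_extend[of ?e "\<eta> ?b" _ x] e' assms by simp
  then show ?thesis
    using that[of "?e \<cdot> I x"] e' assms \<eta>_natural[of x] by simp
qed

lemma reflect_eq:
  assumes "y \<in> Arr C" "y' \<in> Arr C" "a \<in> Obj C" "Dom C y = IO a" "Dom C y' = IO a"
    "Cod C y = Cod C y'" "Cod C y \<in> Obj X" "y \<cdot> \<eta> a = y' \<cdot> \<eta> a"
  shows "y = y'"
proof -
  note E = nat_transD[OF adjunctionD(4)[OF adjunction], simplified]
  have "z = EpsG \<Gamma> (Cod C z) \<cdot>\<^bsub>X\<^esub> I (z \<cdot> \<eta> a)" if z: "z \<in> Arr C" "Dom C z = IO a" "Cod C z \<in> Obj X" for z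
  proof -
    have zX: "z \<in> Arr X" "I z \<in> Arr X" "I (\<eta> a) \<in> Arr X" using z assms(3) Arr_X I_X by simp_all
    have e: "EpsG \<Gamma> b \<in> Arr X" "Dom X (EpsG \<Gamma> b) = IO b" "Cod X (EpsG \<Gamma> b) = b" if "b \<in> Obj X" for b
      using E(4-6)[OF that] that by simp_all
    have n: "z \<cdot>\<^bsub>X\<^esub> EpsG \<Gamma> (IO a) = EpsG \<Gamma> (Cod C z) \<cdot>\<^bsub>X\<^esub> I z"
      using E(7)[OF zX(1)] zX z X_simps(1,2)[of z] by simp
    have "I (z \<cdot> \<eta> a) = I z \<cdot>\<^bsub>X\<^esub> I (\<eta> a)"
      using z zX assms(3) X_simps(4)[of "I (\<eta> a)" "I z"] by simp
    also have "EpsG \<Gamma> (Cod C z) \<cdot>\<^bsub>X\<^esub> (I z \<cdot>\<^bsub>X\<^esub> I (\<eta> a)) = z \<cdot>\<^bsub>X\<^esub> (EpsG \<Gamma> (IO a) \<cdot>\<^bsub>X\<^esub> I (\<eta> a))"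
      using zX z assms(3) e by (intro X.square_extend[OF n[symmetric]]) (simp_all add: X_simps)
    also have "\<dots> = z"
      using adjunctionD(5)[OF adjunction assms(3)] zX z X.comp_Ide[of z] X_simps(1)[of z] assms(3) by simp
    finally show ?thesis by simp
  qed
  then show ?thesis
    using assms by metis
qed

lemma is_iso_I: "is_iso C f \<Longrightarrow> is_iso C (I f)"
proof -
  assume f: "is_iso C f"
  note f' = inv_arr[OF f]
  have "I f \<cdot> I (inv_arr C f) = I (f \<cdot> inv_arr C f)" "I (inv_arr C f) \<cdot> I f = I (inv_arr C f \<cdot> f)"
    using f'(1-4) by (intro I(5)[symmetric]; simp)+
  then show ?thesis
    using f' by (intro is_isoI[of _ "I (inv_arr C f)"]) simp_all
qed

text \<open>A retraction of \<open>\<eta>\<^sub>a\<close> is an inverse, because \<open>\<eta>\<^sub>a r \<eta>\<^sub>a = \<eta>\<^sub>a\<close> and arrows out of \<open>I(a)\<close> are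
  determined by their restriction along \<open>\<eta>\<^sub>a\<close>.\<close>

lemma is_iso_\<eta>:
  assumes a: "a \<in> Obj C" and r: "r \<in> Arr C" "Dom C r = IO a" "Cod C r = a" "r \<cdot> \<eta> a = Ide C a"
  shows "is_iso C (\<eta> a)"
proof -
  have "\<eta> a \<cdot> r = Ide C (IO a)"
    using a r by - (rule reflect_eq[of _ _ a], simp_all)
  then show ?thesis using a r by (intro is_isoI[of _ r]) simp_all
qed

lemma is_iso_\<eta>_X: "a \<in> Obj X \<Longrightarrow> is_iso C (\<eta> a)"
proof -
  assume a: "a \<in> Obj X"
  obtain r where "r \<in> Arr C" "Dom C r = IO a" "Cod C r = a" "r \<cdot> \<eta> a = Ide C a"
    by (rule reflect[of "Ide C a"]) (use a in simp_all)
  then show ?thesis using a by (intro is_iso_\<eta>[of _ r]) simp_all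
qed


section \<open>Limits in a full reflective subcategory\<close>

lemma pullback_X_if_C:
  assumes P: "is_pullback C f g p q" and fg: "f \<in> Arr X" "g \<in> Arr X" and p: "Dom C p \<in> Obj X"
  shows "is_pullback X f g p q"
proof -
  note D = pullbackD[OF P]
  have pq: "p \<in> Arr X" "q \<in> Arr X" using D p fg by (simp_all add: Arr_X)
  show ?thesis
  proof (rule X.is_pullbackI)
    fix x y assume xy: "x \<in> Arr X" "y \<in> Arr X" "Dom X x = Dom X y" "Cod X x = Dom X f"
      "Cod X y = Dom X g" "f \<cdot>\<^bsub>X\<^esub> x = g \<cdot>\<^bsub>X\<^esub> y"
    obtain h where "h \<in> Arr C" "Dom C h = Dom C x" "Cod C h = Dom C p" "p \<cdot> h = x" "q \<cdot> h = y"
      by (rule pullback_lift[OF P, of x y]) (use xy fg in \<open>simp_all add: X_simps Arr_X\<close>)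
    moreover from this have "h \<in> Arr X" using xy p by (simp add: Arr_X)
    ultimately show "\<exists>h\<in>Arr X. Dom X h = Dom X x \<and> Cod X h = Dom X p \<and> p \<cdot>\<^bsub>X\<^esub> h = x \<and> q \<cdot>\<^bsub>X\<^esub> h = y"
      using pq xy D by (intro bexI[of _ h]) (simp_all add: X_simps)
  next
    fix h h' assume "h \<in> Arr X" "h' \<in> Arr X" "Dom X h = Dom X h'" "Cod X h = Dom X p"
      "Cod X h' = Dom X p" "p \<cdot>\<^bsub>X\<^esub> h = p \<cdot>\<^bsub>X\<^esub> h'" "q \<cdot>\<^bsub>X\<^esub> h = q \<cdot>\<^bsub>X\<^esub> h'"
    then show "h = h'"
      using pq D by - (rule pullback_eq[OF P], simp_all add: X_simps Arr_X)
  qed (use D pq fg in \<open>simp_all add: X_simps\<close>)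
qed

text \<open>The inclusion preserves limits: a cone from an arbitrary object of \<open>C\<close> extends along \<open>\<eta>\<close> to a
  cone from its reflection.\<close>

lemma pullback_C_if_X:
  assumes P: "is_pullback X f g p q"
  shows "is_pullback C f g p q"
proof -
  note DX = X.pullbackD[OF P]
  have D: "f \<in> Arr C" "g \<in> Arr C" "p \<in> Arr C" "q \<in> Arr C" "Cod C f = Cod C g" "Dom C p = Dom C q"
    "Cod C p = Dom C f" "Cod C q = Dom C g" "f \<cdot> p = g \<cdot> q" "Dom C q \<in> Obj X" "Dom C f \<in> Obj X"
    "Dom C g \<in> Obj X" "Cod C g \<in> Obj X"
    using DX X_simps Arr_X by (auto simp: X_simps)
  show ?thesis
  proof (rule is_pullbackI)
    fix x y assume xy: "x \<in> Arr C" "y \<in> Arr C" "Dom C x = Dom C y" "Cod C x = Dom C f"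
      "Cod C y = Dom C g" "f \<cdot> x = g \<cdot> y"
    let ?\<eta> = "\<eta> (Dom C x)"
    obtain x' where x': "x' \<in> Arr C" "Dom C x' = IO (Dom C x)" "Cod C x' = Dom C f" "x' \<cdot> ?\<eta> = x"
      by (rule reflect[of x]) (use xy D in simp_all)
    obtain y' where y': "y' \<in> Arr C" "Dom C y' = IO (Dom C x)" "Cod C y' = Dom C g" "y' \<cdot> ?\<eta> = y"
      by (rule reflect[of y]) (use xy D in simp_all)
    have "f \<cdot> x' = g \<cdot> y'"
      using D xy x' y' by - (rule reflect_eq[of _ _ "Dom C x"], simp_all)
    then obtain h where h: "h \<in> Arr X" "Dom X h = Dom X x'" "Cod X h = Dom X p" "p \<cdot>\<^bsub>X\<^esub> h = x'" "q \<cdot>\<^bsub>X\<^esub> h = y'"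
      using X.pullback_lift[OF P, of x' y'] x' y' xy D DX by (auto simp: X_simps Arr_X)
    then have h': "h \<in> Arr C" "Dom C h = IO (Dom C x)" "Cod C h = Dom C p" "p \<cdot> h = x'" "q \<cdot> h = y'"
      using x' y' xy D DX by (auto simp: X_simps Arr_X)
    show "\<exists>h\<in>Arr C. Dom C h = Dom C x \<and> Cod C h = Dom C p \<and> p \<cdot> h = x \<and> q \<cdot> h = y"
      using h' x' y' xy D eq_extend[OF h'(4)] eq_extend[OF h'(5)]
      by (intro bexI[of _ "h \<cdot> ?\<eta>"]) simp_all
  next
    fix h h' assume hh: "h \<in> Arr C" "h' \<in> Arr C" "Dom C h = Dom C h'" "Cod C h = Dom C p"
      "Cod C h' = Dom C p" "p \<cdot> h = p \<cdot> h'" "q \<cdot> h = q \<cdot> h'"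
    let ?\<eta> = "\<eta> (Dom C h')"
    obtain k where k: "k \<in> Arr C" "Dom C k = IO (Dom C h')" "Cod C k = Dom C p" "k \<cdot> ?\<eta> = h"
      by (rule reflect[of h]) (use hh D in simp_all)
    obtain k' where k': "k' \<in> Arr C" "Dom C k' = IO (Dom C h')" "Cod C k' = Dom C p" "k' \<cdot> ?\<eta> = h'"
      by (rule reflect[of h']) (use hh D in simp_all)
    have "p \<cdot> k = p \<cdot> k'" "q \<cdot> k = q \<cdot> k'"
      using D hh k k' by - (rule reflect_eq[of _ _ "Dom C h'"], simp_all)+
    then have "k = k'"
      using DX D hh k k' by - (rule X.pullback_eq[OF P], simp_all add: X_simps Arr_X)
    then show "h = h'" using k k' by simp
  qed (use D in simp_all)
qed

text \<open>A pullback formed in \<open>C\<close> may lie outside the subcategory, but its cone extends to its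
  reflection, which makes \<open>\<eta>\<close> invertible there; so the reflection is also a pullback.\<close>

lemma ex_pullback_X:
  assumes f: "f \<in> Arr X" and g: "g \<in> Arr X" and fg: "Cod C f = Cod C g"
  shows "\<exists>p q. is_pullback X f g p q"
proof -
  have fg': "f \<in> Arr C" "g \<in> Arr C" "Dom C f \<in> Obj X" "Dom C g \<in> Obj X" "Cod C g \<in> Obj X"
    using f g by (simp_all add: Arr_X)
  obtain p q where P: "is_pullback C f g p q"
    using ex_pullback[OF complete fg'(1,2) fg] by blast
  note D = pullbackD[OF P]
  let ?a = "Dom C q"
  obtain p' where p': "p' \<in> Arr C" "Dom C p' = IO ?a" "Cod C p' = Dom C f" "p' \<cdot> \<eta> ?a = p"
    by (rule reflect[of p]) (use D fg' in simp_all)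
  obtain q' where q': "q' \<in> Arr C" "Dom C q' = IO ?a" "Cod C q' = Dom C g" "q' \<cdot> \<eta> ?a = q"
    by (rule reflect[of q]) (use D fg' in simp_all)
  have "f \<cdot> p' = g \<cdot> q'"
    using D fg' p' q' by - (rule reflect_eq[of _ _ ?a], simp_all)
  then obtain r where r: "r \<in> Arr C" "Dom C r = IO ?a" "Cod C r = ?a" "p \<cdot> r = p'" "q \<cdot> r = q'"
    using pullback_lift[OF P, of p' q'] p' q' D by auto
  have "r \<cdot> \<eta> ?a = Ide C ?a"
    using D r p' q' eq_extend[OF r(4)] eq_extend[OF r(5)] by - (rule pullback_eq[OF P], simp_all)
  then have iso: "is_iso C (\<eta> ?a)" using is_iso_\<eta>[of ?a r] r D by simp
  note i = inv_arr[OF iso]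
  have "is_pullback C f g (p \<cdot> inv_arr C (\<eta> ?a)) (q \<cdot> inv_arr C (\<eta> ?a))"
    using pullback_iso[OF P is_iso_inv_arr[OF iso]] i D by simp
  moreover have "Dom C (p \<cdot> inv_arr C (\<eta> ?a)) \<in> Obj X"
    using i D by simp
  ultimately show ?thesis
    using pullback_X_if_C[OF _ f g] by blast
qed

text \<open>The reflection of a zero object is again one, and it lies in the subcategory. A single object
  therefore serves as zero object of both categories, and the two notions of zero arrow agree.\<close>

definition zero :: 'o where "zero = IO (SOME z. is_zero_object C z)"

lemma zero_C: "is_zero_object C zero"
  and zero_X: "is_zero_object X zero"
proof -
  let ?z = "SOME z. is_zero_object C z"
  have z: "is_zero_object C ?z"
    using pointed unfolding pointed_def by (rule someI_ex)
  note zo = zero_object_Obj[OF z]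
  obtain r where r: "r \<in> Arr C" "Dom C r = IO ?z" "Cod C r = ?z"
    using zero_object_maps[OF z, of "IO ?z"] zo by (metis IO X_Obj)
  have "r \<cdot> \<eta> ?z = Ide C ?z"
    using z r zo terminal_eq[of ?z "r \<cdot> \<eta> ?z" ?z] by (simp add: is_zero_object_def hom_def)
  then have iso: "is_iso C (\<eta> ?z)" using is_iso_\<eta> r zo by blast
  note i = inv_arr[OF iso]
  have w: "zero \<in> Obj X" unfolding zero_def using zo by simp
  have "\<exists>f. f \<in> hom C a zero" "\<exists>f. f \<in> hom C zero a" if a: "a \<in> Obj C" for a
  proof -
    obtain f g where "f \<in> Arr C" "Dom C f = a" "Cod C f = ?z" "g \<in> Arr C" "Dom C g = ?z" "Cod C g = a"
      by (rule zero_object_maps[OF z a])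
    then have "\<eta> ?z \<cdot> f \<in> hom C a zero" "g \<cdot> r \<in> hom C zero a"
      using r zo by (simp_all add: zero_def hom_def)
    then show "\<exists>f. f \<in> hom C a zero" "\<exists>f. f \<in> hom C zero a" by blast+
  qed
  moreover have "f = g" if "f \<in> hom C a zero" "g \<in> hom C a zero" for f g a
  proof -
    have "r \<cdot> f = r \<cdot> g"
      using that z r zo terminal_eq[of ?z "r \<cdot> f" a "r \<cdot> g"] by (simp add: is_zero_object_def hom_def zero_def)
    then have "\<eta> ?z \<cdot> (r \<cdot> f) = \<eta> ?z \<cdot> (r \<cdot> g)" by simp
    moreover have "\<eta> ?z \<cdot> r = Ide C (IO ?z)"
      using r zo \<open>r \<cdot> \<eta> ?z = Ide C ?z\<close> by - (rule reflect_eq[of _ _ ?z], simp_all)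
    ultimately show ?thesis
      using that r zo eq_extend[of "\<eta> ?z" r "Ide C (IO ?z)"] by (simp add: hom_def zero_def)
  qed
  moreover have "f = g" if "f \<in> hom C zero a" "g \<in> hom C zero a" for f g a
  proof -
    have "f \<cdot> \<eta> ?z = g \<cdot> \<eta> ?z"
      using that z zo initial_eq[of ?z "f \<cdot> \<eta> ?z" a "g \<cdot> \<eta> ?z"] by (simp add: is_zero_object_def hom_def zero_def)
    then show ?thesis
      using that zo iso by - (rule iso_right_cancel[OF iso], simp_all add: hom_def zero_def)
  qed
  ultimately have **: "\<exists>!f. f \<in> hom C a zero" "\<exists>!f. f \<in> hom C zero a" if "a \<in> Obj C" for a
    using that by (blast, blast)
  show "is_zero_object C zero" "is_zero_object X zero"
    using w ** X_hom unfolding is_zero_object_def is_initial_def is_terminal_def by auto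
qed

lemma zero_Obj [simp]: "zero \<in> Obj X"
  using X.zero_object_Obj[OF zero_X] .

lemma zero_arr_ex:
  assumes "a \<in> Obj C" "b \<in> Obj C"
  obtains f where "is_zero_arr C f" "f \<in> Arr C" "Dom C f = a" "Cod C f = b"
proof -
  obtain u v where "u \<in> Arr C" "Dom C u = a" "Cod C u = zero" "v \<in> Arr C" "Dom C v = zero" "Cod C v = b"
    using zero_object_maps[OF zero_C assms(1)] zero_object_maps[OF zero_C assms(2)] by metis
  then show ?thesis
    using that[of "v \<cdot> u"] is_zero_arrI[OF zero_C, of u v] by simp
qed

lemma zero_arr_eqI:
  assumes "is_zero_arr C f" "Dom C f = a" "Cod C f = b"
  shows "zero_arr C a b = f"
  unfolding zero_arr_def
  by (rule the_equality) (use assms zero_arr_unique in \<open>auto simp: hom_def zero_arr_Arr\<close>)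

lemma zero_arr:
  assumes "a \<in> Obj C" "b \<in> Obj C"
  shows "is_zero_arr C (zero_arr C a b)" "zero_arr C a b \<in> Arr C" "Dom C (zero_arr C a b) = a"
    "Cod C (zero_arr C a b) = b"
  using zero_arr_ex[OF assms] zero_arr_eqI by metis+

lemma is_zero_arr_X:
  assumes f: "f \<in> Arr X"
  shows "is_zero_arr X f \<longleftrightarrow> is_zero_arr C f"
proof -
  have f': "f \<in> Arr C" "Dom C f \<in> Obj X" "Cod C f \<in> Obj X" using f by (simp_all add: Arr_X)
  obtain u v where uv: "u \<in> Arr C" "Dom C u = Dom C f" "Cod C u = zero" "v \<in> Arr C" "Dom C v = zero" "Cod C v = Cod C f"
    using zero_object_maps[OF zero_C Dom_Obj[OF f'(1)]] zero_object_maps[OF zero_C Cod_Obj[OF f'(1)]] by metis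
  have uvX: "u \<in> Arr X" "v \<in> Arr X" using uv f' by (simp_all add: Arr_X)
  have "is_zero_arr C (v \<cdot> u)" using is_zero_arrI[OF zero_C] uv by simp
  moreover have "is_zero_arr X (v \<cdot> u)"
    using X.is_zero_arrI[OF zero_X uvX] uv uvX by (simp add: X_simps)
  moreover have "Dom X (v \<cdot> u) = Dom X f" "Cod X (v \<cdot> u) = Cod X f" "Dom C (v \<cdot> u) = Dom C f" "Cod C (v \<cdot> u) = Cod C f"
    using uv f f' by (simp_all add: X_simps Arr_X)
  ultimately show ?thesis
    using zero_arr_unique[of f "v \<cdot> u"] X.zero_arr_unique[of f "v \<cdot> u"] by metis
qed

lemma kernel_C_if_X:
  assumes K: "is_kernel X f k"
  shows "is_kernel C f k"
proof -
  note DX = X.kernelD[OF K]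
  have D: "f \<in> Arr C" "k \<in> Arr C" "Cod C k = Dom C f" "Dom C f \<in> Obj X" "Cod C f \<in> Obj X" "Dom C k \<in> Obj X"
    using DX by (auto simp: X_simps Arr_X)
  show ?thesis
  proof (rule kernelI)
    show "is_zero_arr C (f \<cdot> k)"
      using DX D is_zero_arr_X[of "f \<cdot> k"] by (simp add: X_simps Arr_X)
  next
    fix x assume x: "x \<in> Arr C" "Cod C x = Dom C f" "is_zero_arr C (f \<cdot> x)"
    let ?\<eta> = "\<eta> (Dom C x)"
    obtain y where y: "y \<in> Arr C" "Dom C y = IO (Dom C x)" "Cod C y = Dom C f" "y \<cdot> ?\<eta> = x"
      by (rule reflect[of x]) (use x D in simp_all)
    obtain o' where o': "is_zero_arr C o'" "o' \<in> Arr C" "Dom C o' = IO (Dom C x)" "Cod C o' = Cod C f"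
      by (rule zero_arr_ex[of "IO (Dom C x)" "Cod C f"]) (use x D in simp_all)
    have "is_zero_arr C (o' \<cdot> ?\<eta>)"
      using o' x by - (rule comp_zero, simp_all)
    then have "o' \<cdot> ?\<eta> = f \<cdot> x"
      using x o' D by - (rule zero_arr_unique, simp_all)
    then have "f \<cdot> y = o'"
      using D x y o' by - (rule reflect_eq[of _ _ "Dom C x"], simp_all)
    then have "is_zero_arr X (f \<cdot>\<^bsub>X\<^esub> y)"
      using o' is_zero_arr_X[of "f \<cdot> y"] D x y DX by (simp add: X_simps Arr_X)
    then obtain h where h: "h \<in> Arr X" "Dom X h = Dom X y" "Cod X h = Dom X k" "k \<cdot>\<^bsub>X\<^esub> h = y"
      using X.kernel_lift[OF K, of y] D x y DX by (auto simp: X_simps Arr_X)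
    then have h': "h \<in> Arr C" "Dom C h = IO (Dom C x)" "Cod C h = Dom C k" "k \<cdot> h = y"
      using D x y DX by (auto simp: X_simps Arr_X)
    then show "\<exists>h\<in>Arr C. Dom C h = Dom C x \<and> Cod C h = Dom C k \<and> k \<cdot> h = x"
      using y x D eq_extend[OF h'(4)] by (intro bexI[of _ "h \<cdot> ?\<eta>"]) simp_all
  next
    fix h h' assume hh: "h \<in> Arr C" "h' \<in> Arr C" "Dom C h = Dom C h'" "Cod C h = Dom C k"
      "Cod C h' = Dom C k" "k \<cdot> h = k \<cdot> h'"
    let ?\<eta> = "\<eta> (Dom C h')"
    obtain l where l: "l \<in> Arr C" "Dom C l = IO (Dom C h')" "Cod C l = Dom C k" "l \<cdot> ?\<eta> = h"
      by (rule reflect[of h]) (use hh D in simp_all)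
    obtain l' where l': "l' \<in> Arr C" "Dom C l' = IO (Dom C h')" "Cod C l' = Dom C k" "l' \<cdot> ?\<eta> = h'"
      by (rule reflect[of h']) (use hh D in simp_all)
    have "k \<cdot> l = k \<cdot> l'"
      using D hh l l' by - (rule reflect_eq[of _ _ "Dom C h'"], simp_all)
    then have "l = l'"
      using DX D hh l l' by - (rule X.kernel_eq[OF K], simp_all add: X_simps Arr_X)
    then show "h = h'" using l l' by simp
  qed (use D in simp_all)
qed

lemma ex_kernel_X:
  assumes "f \<in> Arr X"
  shows "\<exists>k. is_kernel X f k"
proof -
  obtain v where v: "v \<in> Arr X" "Dom X v = zero" "Cod X v = Cod X f"
    using X.zero_object_maps[OF zero_X X.Cod_Obj[OF assms]] by metis
  then obtain p q where "is_pullback X f v p q"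
    using ex_pullback_X[OF assms v(1)] assms by (auto simp: X_simps)
  then show ?thesis
    using X.kernel_if_pullback v zero_X by metis
qed

lemma ex_kernel:
  assumes "f \<in> Arr C"
  shows "\<exists>k. is_kernel C f k"
proof -
  obtain v where v: "v \<in> Arr C" "Dom C v = zero" "Cod C v = Cod C f"
    using zero_object_maps[OF zero_C Cod_Obj[OF assms]] by metis
  then obtain p q where "is_pullback C f v p q"
    using ex_pullback[OF complete assms v(1)] by auto
  then show ?thesis
    using kernel_if_pullback v zero_C by metis
qed

section \<open>Trivial coverings and normal extensions\<close>

lemma trivial_covering: "trivial_covering \<Gamma> f \<longleftrightarrow>
    f \<in> FibE \<Gamma> \<and> is_pullback C (I f) (\<eta> (Cod C f)) (\<eta> (Dom C f)) f"
  using FibE_Arr[of f] I_X[of f] by (auto simp: trivial_covering_def HI_def)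

text \<open>The naturality square of \<open>\<eta>\<close> at an isomorphism is a pullback, and squares can be pasted.\<close>

lemma trivial_covering_iso:
  assumes f: "trivial_covering \<Gamma> f" and i: "is_iso C i" "Cod C i = Dom C f"
  shows "trivial_covering \<Gamma> (f \<cdot> i)"
proof -
  note i' = inv_arr[OF i(1)]
  have fE: "f \<in> FibE \<Gamma>" "f \<in> Arr C" using f FibE_Arr by (simp_all add: trivial_covering)
  have P: "is_pullback C (I f) (\<eta> (Cod C f)) (\<eta> (Dom C f)) f" using f by (simp add: trivial_covering)
  have "is_pullback C (I i) (\<eta> (Dom C f)) (\<eta> (Dom C i)) i"
    using i i' fE \<eta>_natural[of i] by (intro pullback_isos is_iso_I) simp_all
  from pullback_paste[OF P this] show ?thesis
    using i i' fE fibration_classD(2,5)[OF FibE] by (simp add: trivial_covering)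
qed

text \<open>The functor \<open>H\<^sup>A\<close> has the left adjoint \<open>q \<mapsto> I(q)\<close>, and a right adjoint is full and faithful
  exactly when its counit \<open>c : I(H\<^sup>A(\<psi>)) \<rightarrow> \<psi>\<close> is invertible. Fullness, applied to the unit at
  \<open>H\<^sup>A(\<psi>)\<close>, provides an arrow \<open>\<sigma>\<close> with \<open>\<sigma> c = 1\<close>, and faithfulness yields \<open>c \<sigma> = 1\<close>. Along the
  isomorphism \<open>c\<close>, the square defining \<open>q = H\<^sup>A(\<psi>)\<close> becomes the naturality square of \<open>\<eta>\<close> at \<open>q\<close>.\<close>

lemma trivial_covering_if_pullback:
  assumes \<psi>: "\<psi> \<in> FibF \<Gamma>" and A: "A \<in> Obj C" and P: "is_pullback C \<psi> (\<eta> A) r q"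
  shows "trivial_covering \<Gamma> q"
proof -
  let ?r = "pb_fst C \<psi> (\<eta> A)" and ?q = "pb_snd C \<psi> (\<eta> A)"
  let ?Q = "Dom C ?q" and ?Y = "Dom C \<psi>"
  note P0 = pb_is_pullback[OF P]
  note D = pullbackD[OF P0]
  have \<psi>': "\<psi> \<in> Arr C" "Cod C \<psi> = IO A" "?Y \<in> Obj X" "\<psi> \<in> Arr X" "\<psi> \<in> FibE \<Gamma>"
    using FibF_Arr[OF \<psi>] D A FibF_FibE[OF \<psi>] by (auto simp: Arr_X)
  have qE: "?q \<in> FibE \<Gamma>"
    using fibration_classD(4)[OF FibE \<psi>'(5) P0] .
  have IqF: "I ?q \<in> FibF \<Gamma>" using I_FibE[OF qE] .
  have q: "?q \<in> Arr C" "Cod C ?q = A" "?r \<in> Arr C" "Dom C ?r = ?Q" "Cod C ?r = ?Y" "\<psi> \<cdot> ?r = \<eta> A \<cdot> ?q"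
    using D A by simp_all
  obtain c where c: "c \<in> Arr C" "Dom C c = IO ?Q" "Cod C c = ?Y" "c \<cdot> \<eta> ?Q = ?r"
    by (rule reflect[of ?r]) (use q \<psi>' in simp_all)
  have \<psi>c: "\<psi> \<cdot> c = I ?q"
    using \<eta>_natural[of ?q] A c q \<psi>' by - (rule reflect_eq[of _ _ ?Q], simp_all)
  let ?S = "slice_in X (FibF \<Gamma>) (IO A)" and ?T = "slice_in C (FibE \<Gamma>) A"
  have full: "is_full ?S ?T (HB \<Gamma> A)" and faithful: "is_faithful ?S ?T (HB \<Gamma> A)"
    using admissible A by (simp_all add: admissible_def Let_def)
  have HB_obj: "FObj (HB \<Gamma> A) \<chi> = pb_snd C \<chi> (\<eta> A)" if "\<chi> \<in> FibF \<Gamma>" for \<chi>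
    using FibF_Arr[OF that] by (simp add: HB_def pullback_functor_def slice_functor_def)
  have HB_arr: "FArr (HB \<Gamma> A) (\<chi>, h, \<xi>) = (pb_snd C \<chi> (\<eta> A),
      pb_tuple C \<xi> (\<eta> A) (h \<cdot> pb_fst C \<chi> (\<eta> A)) (pb_snd C \<chi> (\<eta> A)), pb_snd C \<xi> (\<eta> A))"
    if "\<chi> \<in> FibF \<Gamma>" "\<xi> \<in> FibF \<Gamma>" "h \<in> Arr X" for \<chi> h \<xi>
    using FibF_Arr[OF that(1)] FibF_Arr[OF that(2)] that(3)
    by (simp add: HB_def pullback_functor_def slice_functor_def)
  have obj: "\<psi> \<in> Obj ?S" "I ?q \<in> Obj ?S"
    using \<psi> \<psi>' IqF q I_X[of ?q] by (simp_all add: X.Obj_slice_in X_simps)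
  obtain p1 q1 where P1': "is_pullback C (I ?q) (\<eta> A) p1 q1"
    using ex_pullback[OF complete, of "I ?q" "\<eta> A"] q A by auto
  note P1 = pb_is_pullback[OF P1']
  let ?s = "pb_tuple C (I ?q) (\<eta> A) (\<eta> ?Q) ?q"
  have s: "?s \<in> Arr C" "Dom C ?s = ?Q" "Cod C ?s = Dom C (pb_fst C (I ?q) (\<eta> A))"
    "pb_fst C (I ?q) (\<eta> A) \<cdot> ?s = \<eta> ?Q" "pb_snd C (I ?q) (\<eta> A) \<cdot> ?s = ?q"
    using pb_tuple[OF P1', of "\<eta> ?Q" ?q] q A \<eta>_natural[of ?q] by simp_all
  have "pb_snd C (I ?q) (\<eta> A) \<in> FibE \<Gamma>"
    using fibration_classD(4)[OF FibE FibF_FibE[OF IqF] P1] .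
  then have "(?q, ?s, pb_snd C (I ?q) (\<eta> A)) \<in> hom ?T (FObj (HB \<Gamma> A) \<psi>) (FObj (HB \<Gamma> A) (I ?q))"
    using s q qE IqF A pullbackD[OF P1] unfolding HB_obj[OF \<psi>] HB_obj[OF IqF] hom_def
    by (simp add: Arr_slice_in slice_in_simps)
  then obtain x where x: "x \<in> hom ?S \<psi> (I ?q)" "FArr (HB \<Gamma> A) x = (?q, ?s, pb_snd C (I ?q) (\<eta> A))"
    using full obj unfolding is_full_def by blast
  obtain \<sigma> where \<sigma>x: "x = (\<psi>, \<sigma>, I ?q)"
    using x(1) by (cases x) (simp add: hom_def X.slice_in_simps)
  have \<sigma>X: "\<sigma> \<in> Arr X" "Dom X \<sigma> = Dom X \<psi>" "Cod X \<sigma> = Dom X (I ?q)" "I ?q \<cdot>\<^bsub>X\<^esub> \<sigma> = \<psi>"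
    using x(1) by (simp_all add: hom_def \<sigma>x X.Arr_slice_in)
  then have \<sigma>: "\<sigma> \<in> Arr C" "Dom C \<sigma> = ?Y" "Cod C \<sigma> = IO ?Q" "I ?q \<cdot> \<sigma> = \<psi>"
    using \<psi>' q I_X[of ?q] by (simp_all add: X_simps Arr_X)
  have "I ?q \<cdot> (\<sigma> \<cdot> ?r) = \<eta> A \<cdot> ?q"
    using eq_extend[OF \<sigma>(4), of ?r] \<sigma> q by simp
  then have "pb_fst C (I ?q) (\<eta> A) \<cdot> pb_tuple C (I ?q) (\<eta> A) (\<sigma> \<cdot> ?r) ?q = \<sigma> \<cdot> ?r"
    using \<sigma> q A by (intro pb_tuple(4)[OF P1']) simp_all
  moreover have "pb_tuple C (I ?q) (\<eta> A) (\<sigma> \<cdot> ?r) ?q = ?s"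
    using x(2) HB_arr[OF \<psi> IqF \<sigma>X(1)] by (simp add: \<sigma>x)
  ultimately have \<sigma>r: "\<sigma> \<cdot> ?r = \<eta> ?Q" using s(4) by simp
  have \<sigma>c: "\<sigma> \<cdot> c = Ide C (IO ?Q)"
    using \<sigma>(1-3) c q \<sigma>r by - (rule reflect_eq[of _ _ ?Q], simp_all)
  have c\<sigma>r: "(c \<cdot> \<sigma>) \<cdot> ?r = Ide C ?Y \<cdot> ?r"
    using \<sigma>(1-3) c q \<sigma>r \<psi>' by simp
  have c\<sigma>X: "c \<cdot> \<sigma> \<in> Arr X" "Ide C ?Y \<in> Arr X" using c \<sigma> \<psi>' by (simp_all add: Arr_X)
  have "\<psi> \<cdot> (c \<cdot> \<sigma>) = \<psi>"
    using eq_extend[OF \<psi>c, of \<sigma>] c \<sigma> \<psi>' by simp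
  then have "(\<psi>, c \<cdot> \<sigma>, \<psi>) \<in> hom ?S \<psi> \<psi>" "(\<psi>, Ide C ?Y, \<psi>) \<in> hom ?S \<psi> \<psi>"
    using c\<sigma>X c \<sigma>(1-3) \<psi> \<psi>' by (simp_all add: hom_def X.Arr_slice_in X.slice_in_simps X_simps)
  moreover have "FArr (HB \<Gamma> A) (\<psi>, c \<cdot> \<sigma>, \<psi>) = FArr (HB \<Gamma> A) (\<psi>, Ide C ?Y, \<psi>)"
    unfolding HB_arr[OF \<psi> \<psi> c\<sigma>X(1)] HB_arr[OF \<psi> \<psi> c\<sigma>X(2)] c\<sigma>r ..
  ultimately have "(\<psi>, c \<cdot> \<sigma>, \<psi>) = (\<psi>, Ide C ?Y, \<psi>)"
    using faithful obj(1) unfolding is_faithful_def by blast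
  then have "c \<cdot> \<sigma> = Ide C ?Y" by simp
  then have iso: "is_iso C c"
    using \<sigma>c c \<sigma> by (intro is_isoI[of _ \<sigma>]) simp_all
  have "is_pullback C c ?r (\<eta> ?Q) (Ide C ?Q)"
    using iso q c by (intro pullback_isos is_iso_Ide) simp_all
  from pullback_paste[OF P0 this] have triv: "trivial_covering \<Gamma> ?q"
    using qE q by (simp add: trivial_covering \<psi>c)
  obtain i where "is_iso C i" "Cod C i = Dom C ?q" "?q \<cdot> i = q"
    using pullbacks_isomorphic[OF P0 P] by metis
  then show ?thesis using trivial_covering_iso[OF triv] by metis
qed

text \<open>By naturality of \<open>\<eta>\<close>, \<open>q'\<close> is a pullback of \<open>I(q)\<close> along \<open>I(f) \<eta>\<close>. Factoring through the
  pullback \<open>\<psi>\<close> of \<open>I(q)\<close> along \<open>I(f)\<close>, which is taken in the subcategory, exhibits \<open>q'\<close> as a pullback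
  of \<open>\<psi>\<close> along \<open>\<eta>\<close>.\<close>

lemma trivial_covering_stable:
  assumes q: "trivial_covering \<Gamma> q" and P: "is_pullback C q f f' q'"
  shows "trivial_covering \<Gamma> q'"
proof -
  note D = pullbackD[OF P]
  have P1: "is_pullback C (\<eta> (Cod C q)) (I q) q (\<eta> (Dom C q))"
    by (rule pullback_sym) (use q in \<open>simp add: trivial_covering\<close>)
  have qF: "I q \<in> FibF \<Gamma>" using q I_FibE by (simp add: trivial_covering)
  have "is_pullback C (\<eta> (Cod C q) \<cdot> f) (I q) q' (\<eta> (Dom C q) \<cdot> f')"
    using pullback_paste[OF P1 pullback_sym[OF P]] .
  then have O: "is_pullback C (I f \<cdot> \<eta> (Dom C f)) (I q) q' (\<eta> (Dom C q) \<cdot> f')"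
    using \<eta>_natural[of f] D by simp
  have "Cod X (I q) = Cod X (I f)"
    using D I_X[of q] I_X[of f] by (simp add: X_simps)
  then obtain p0 \<psi> where P0: "is_pullback X (I q) (I f) p0 \<psi>"
    using X.fibration_classD(3)[OF FibF qF I_X[of f]] D by auto
  have \<psi>: "\<psi> \<in> FibF \<Gamma>" using X.fibration_classD(4)[OF FibF qF P0] .
  have P2: "is_pullback C (I f) (I q) \<psi> p0"
    using pullback_sym[OF pullback_C_if_X[OF P0]] .
  note D2 = pullbackD[OF P2]
  have sq: "I f \<cdot> (\<eta> (Dom C f) \<cdot> q') = I q \<cdot> (\<eta> (Dom C q) \<cdot> f')"
    using pullbackD(9)[OF O] D by simp
  obtain s where s: "s \<in> Arr C" "Dom C s = Dom C q'" "Cod C s = Dom C \<psi>"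
    "\<psi> \<cdot> s = \<eta> (Dom C f) \<cdot> q'" "p0 \<cdot> s = \<eta> (Dom C q) \<cdot> f'"
    by (rule pullback_lift[OF P2, of "\<eta> (Dom C f) \<cdot> q'" "\<eta> (Dom C q) \<cdot> f'"]) (use D D2 sq in simp_all)
  have "is_pullback C (\<eta> (Dom C f)) \<psi> q' s"
    using s D by (intro pullback_cancel[OF O P2]) simp_all
  from trivial_covering_if_pullback[OF \<psi> Dom_Obj[OF D(2)] pullback_sym[OF this]]
  show ?thesis .
qed

lemma normal_extension: "normal_extension \<Gamma> p \<longleftrightarrow>
    monadic_extension \<Gamma> p \<and> trivial_covering \<Gamma> (pb_snd C p p)"
  by (simp add: normal_extension_def pullback_functor_def)

lemma normal_FibE: "normal_extension \<Gamma> p \<Longrightarrow> p \<in> FibE \<Gamma>"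
  by (simp add: normal_extension monadic_extension_def)

lemma normal_Arr: "normal_extension \<Gamma> p \<Longrightarrow> p \<in> Arr C"
  using normal_FibE FibE_Arr by blast

lemma kernel_pair:
  assumes "p \<in> Arr C"
  shows "is_pullback C p p (eq_d C p) (eq_c C p)"
  using ex_pullback[OF complete assms assms] pb_is_pullback unfolding eq_d_def eq_c_def by blast

lemma trivial_eq_c: "normal_extension \<Gamma> p \<Longrightarrow> trivial_covering \<Gamma> (eq_c C p)"
  by (simp add: normal_extension eq_c_def)

text \<open>The two projections differ by the automorphism of \<open>Eq(p)\<close> that swaps components.\<close>

lemma trivial_eq_d:
  assumes "normal_extension \<Gamma> p"
  shows "trivial_covering \<Gamma> (eq_d C p)"
proof -
  note P = kernel_pair[OF normal_Arr[OF assms]]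
  obtain i where "is_iso C i" "Cod C i = Dom C (eq_c C p)" "eq_c C p \<cdot> i = eq_d C p"
    using pullbacks_isomorphic[OF P pullback_sym[OF P]] by metis
  then show ?thesis using trivial_covering_iso[OF trivial_eq_c[OF assms]] by metis
qed

text \<open>A kernel pair projection of the pulled-back arrow \<open>p'\<close> is a pullback of the corresponding
  projection of \<open>p\<close>, so stability of trivial coverings suffices.\<close>

lemma normal_extension_stable:
  assumes p: "normal_extension \<Gamma> p" and P: "is_pullback C p f g p'"
  shows "normal_extension \<Gamma> p'"
proof -
  note D = pullbackD[OF P]
  have "monadic_extension \<Gamma> p'"
    using monadic_stable p P D(2,3) by (auto simp: pullback_stable_def normal_extension)
  moreover have "trivial_covering \<Gamma> (eq_c C p')"
  proof -
    note K = kernel_pair[OF D(1)] and K' = kernel_pair[OF D(5)]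
    note KD = pullbackD[OF K] and KD' = pullbackD[OF K']
    have "is_pullback C (f \<cdot> p') p (eq_c C p') (g \<cdot> eq_d C p')"
      by (rule pullback_paste[OF pullback_sym[OF P] pullback_sym[OF K']])
    then have O: "is_pullback C (p \<cdot> g) p (eq_c C p') (g \<cdot> eq_d C p')"
      by (simp add: D(9))
    have sq: "p \<cdot> (g \<cdot> eq_d C p') = p \<cdot> (g \<cdot> eq_c C p')"
      using square_extend[OF D(9), of "eq_d C p'"] square_extend[OF D(9), of "eq_c C p'"] D(1-8) KD' by simp
    obtain h where h: "h \<in> Arr C" "Dom C h = Dom C (eq_c C p')" "Cod C h = Dom C (eq_d C p)"
      "eq_d C p \<cdot> h = g \<cdot> eq_d C p'" "eq_c C p \<cdot> h = g \<cdot> eq_c C p'"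
      by (rule pullback_lift[OF K, of "g \<cdot> eq_d C p'" "g \<cdot> eq_c C p'"]) (use D(1-8) KD' sq in simp_all)
    have "is_pullback C g (eq_c C p) (eq_c C p') h"
      using h D(1-8) KD KD' by (intro pullback_cancel[OF O pullback_sym[OF K]]) simp_all
    then show ?thesis
      using trivial_covering_stable[OF trivial_eq_c[OF p] pullback_sym] by blast
  qed
  ultimately show ?thesis by (simp add: normal_extension eq_c_def)
qed

text \<open>These normal extensions are the targets of the morphisms \<open>(\<eta>\<^sub>E, 0) : p \<rightarrow> t\<close>. The arrow \<open>t\<close> is
  monadic because a zero arrow splits it, and a trivial covering because \<open>\<eta>\<close> is invertible on objects of
  the subcategory.\<close>

lemma normal_extension_to_zero:
  assumes E: "E \<in> Obj C" and t: "t \<in> Arr C" "Dom C t = IO E" "Cod C t = zero"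
  shows "normal_extension \<Gamma> t"
proof -
  have "t \<in> hom X (IO E) zero" using t E by (simp add: hom_def X_simps Arr_X)
  then have "t \<in> FibF \<Gamma>" using fibrant E zero_X by blast
  then have tE: "t \<in> FibE \<Gamma>" by (rule FibF_FibE)
  interpret fibration C "FibE \<Gamma>" t
    using FibE tE by unfold_locales
  obtain s where s: "s \<in> Arr C" "Dom C s = zero" "Cod C s = IO E"
    using zero_object_maps[OF zero_C Cod_Obj[OF t(1)]] zero_object_maps[OF zero_C Dom_Obj[OF t(1)]] t by metis
  have "t \<cdot> s = Ide C zero"
    using s t zero_C terminal_eq[of zero "t \<cdot> s" zero "Ide C zero"]
    by (simp add: is_zero_object_def hom_def)
  then have "monadic_extension \<Gamma> t"
    using split_monadic[of s] s t tE by (simp add: monadic_extension_def)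
  moreover have "is_pullback C (I t) (\<eta> zero) (\<eta> (IO E)) t"
    using E t \<eta>_natural[of t] is_iso_\<eta>_X by (intro pullback_sym[OF pullback_isos]) simp_all
  then have "trivial_covering \<Gamma> t" using tE t by (simp add: trivial_covering)
  ultimately show ?thesis
    using trivial_covering_stable[OF _ kernel_pair[OF t(1)]] by (simp add: normal_extension eq_c_def)
qed

section \<open>The Galois group as a subobject of the kernel\<close>

text \<open>The kernel of \<open>p\<close> agrees with the kernel of the trivial covering \<open>c\<close>, a pullback of \<open>p\<close>, and further with the kernel of \<open>I(c)\<close>, which can be chosen in the
  subcategory.\<close>

lemma nker:
  assumes p: "normal_extension \<Gamma> p"
  shows "is_kernel C p (nker \<Gamma> p)" "Dom C (nker \<Gamma> p) \<in> Obj X"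
proof -
  note pA = normal_Arr[OF p]
  note P = kernel_pair[OF pA]
  note D = pullbackD[OF P]
  let ?c = "eq_c C p"
  have T: "is_pullback C (I ?c) (\<eta> (Cod C ?c)) (\<eta> (Dom C ?c)) ?c"
    using trivial_eq_c[OF p] by (simp add: trivial_covering)
  obtain k0 where k0: "is_kernel X (I ?c) k0"
    using ex_kernel_X[OF I_X] D by blast
  note K = kernel_C_if_X[OF k0] and KX = X.kernelD[OF k0]
  note KD = kernelD[OF K]
  have k0X: "Dom C k0 \<in> Obj X" using KX by (simp add: Arr_X)
  obtain z where z: "is_zero_arr C z" "z \<in> Arr C" "Dom C z = Dom C k0" "Cod C z = Cod C ?c"
    by (rule zero_arr_ex[of "Dom C k0" "Cod C ?c"]) (use k0X D in simp_all)
  have "is_zero_arr C (\<eta> (Cod C ?c) \<cdot> z)"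
    using zero_comp[OF z(1)] z D by simp
  then have "I ?c \<cdot> k0 = \<eta> (Cod C ?c) \<cdot> z"
    using z D KD by - (rule zero_arr_unique, simp_all)
  then obtain k where k: "k \<in> Arr C" "Dom C k = Dom C k0" "Cod C k = Dom C ?c" "\<eta> (Dom C ?c) \<cdot> k = k0" "?c \<cdot> k = z"
    using pullback_lift[OF T, of k0 z] z D KD by auto
  have "is_kernel C ?c k"
    using k z K D by (intro kernel_of_pullback_conv[OF T]) simp_all
  then have "is_kernel C p (eq_d C p \<cdot> k)"
    by (rule kernel_of_pullback[OF P])
  moreover have "Dom C (eq_d C p \<cdot> k) \<in> Obj X"
    using k D k0X by simp
  ultimately have "\<exists>k. is_kernel C p k \<and> Dom C k \<in> Obj X" by blast
  from someI_ex[OF this] show "is_kernel C p (nker \<Gamma> p)" "Dom C (nker \<Gamma> p) \<in> Obj X"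
    by (simp_all add: nker_def)
qed

lemma nker_simps [simp]:
  assumes "normal_extension \<Gamma> p"
  shows "nker \<Gamma> p \<in> Arr C" "Cod C (nker \<Gamma> p) = Dom C p"
  using kernelD[OF nker(1)[OF assms]] by simp_all

text \<open>The arrow \<open>\<langle>0, ker p\<rangle> : Ker(p) \<rightarrow> Eq(p)\<close>, a kernel of the first projection.\<close>

definition kernel_section :: "'a \<Rightarrow> 'a" where
  "kernel_section p = pb_tuple C p p (zero_arr C (Dom C (nker \<Gamma> p)) (Dom C p)) (nker \<Gamma> p)"

lemma kernel_section:
  assumes p: "normal_extension \<Gamma> p"
  shows "kernel_section p \<in> Arr C" "Dom C (kernel_section p) = Dom C (nker \<Gamma> p)"
    "Cod C (kernel_section p) = eq_obj C p" "is_zero_arr C (eq_d C p \<cdot> kernel_section p)"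
    "eq_c C p \<cdot> kernel_section p = nker \<Gamma> p" "is_kernel C (eq_d C p) (kernel_section p)"
proof -
  note pA = normal_Arr[OF p]
  note P = kernel_pair[OF pA]
  note D = pullbackD[OF P]
  let ?k = "nker \<Gamma> p" and ?z = "zero_arr C (Dom C (nker \<Gamma> p)) (Dom C p)"
  note K = kernelD[OF nker(1)[OF p]]
  have z: "is_zero_arr C ?z" "?z \<in> Arr C" "Dom C ?z = Dom C ?k" "Cod C ?z = Dom C p"
    using zero_arr[of "Dom C ?k" "Dom C p"] K pA by simp_all
  have "is_zero_arr C (p \<cdot> ?z)" using zero_comp[OF z(1)] z pA by simp
  then have "p \<cdot> ?z = p \<cdot> ?k"
    using z K by - (rule zero_arr_unique, simp_all)
  note t = pb_tuple[OF P z(2) K(2) z(3,4) K(3) this, folded kernel_section_def eq_d_def eq_c_def]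
  then show t': "kernel_section p \<in> Arr C" "Dom C (kernel_section p) = Dom C (nker \<Gamma> p)"
    "Cod C (kernel_section p) = eq_obj C p" "is_zero_arr C (eq_d C p \<cdot> kernel_section p)"
    "eq_c C p \<cdot> kernel_section p = nker \<Gamma> p"
    using z by (simp_all add: eq_obj_def)
  show "is_kernel C (eq_d C p) (kernel_section p)"
    using t' nker(1)[OF p] D by (intro kernel_of_pullback_conv[OF pullback_sym[OF P]]) (simp_all add: eq_obj_def)
qed

lemma eq_simps [simp]:
  assumes "normal_extension \<Gamma> p"
  shows "eq_d C p \<in> Arr C" "eq_c C p \<in> Arr C" "Dom C (eq_d C p) = eq_obj C p" "Dom C (eq_c C p) = eq_obj C p"
    "Cod C (eq_d C p) = Dom C p" "Cod C (eq_c C p) = Dom C p" "eq_obj C p \<in> Obj C" "p \<cdot> eq_d C p = p \<cdot> eq_c C p"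
  using pullbackD[OF kernel_pair[OF normal_Arr[OF assms]]] by (auto simp: eq_obj_def)

text \<open>The arrow \<open>\<eta> \<langle>0, ker p\<rangle> : Ker(p) \<rightarrow> I(Eq(p))\<close>. As \<open>d\<close> is a trivial covering, \<open>\<eta>\<close> carries a kernel
  of \<open>d\<close> to a kernel of \<open>I(d)\<close>.\<close>

definition kernel_to_gal :: "'a \<Rightarrow> 'a" where
  "kernel_to_gal p = \<eta> (eq_obj C p) \<cdot> kernel_section p"

lemma kernel_to_gal:
  assumes p: "normal_extension \<Gamma> p"
  shows "kernel_to_gal p \<in> Arr C" "Dom C (kernel_to_gal p) = Dom C (nker \<Gamma> p)"
    "Cod C (kernel_to_gal p) = IO (eq_obj C p)" "is_kernel C (I (eq_d C p)) (kernel_to_gal p)"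
    "I (eq_c C p) \<cdot> kernel_to_gal p = \<eta> (Dom C p) \<cdot> nker \<Gamma> p"
proof -
  note t = kernel_section[OF p]
  show "kernel_to_gal p \<in> Arr C" "Dom C (kernel_to_gal p) = Dom C (nker \<Gamma> p)"
    "Cod C (kernel_to_gal p) = IO (eq_obj C p)"
    using t p by (simp_all add: kernel_to_gal_def)
  have "is_pullback C (I (eq_d C p)) (\<eta> (Dom C p)) (\<eta> (eq_obj C p)) (eq_d C p)"
    using trivial_eq_d[OF p] p by (simp add: trivial_covering)
  then show "is_kernel C (I (eq_d C p)) (kernel_to_gal p)"
    unfolding kernel_to_gal_def using t(6) by (rule kernel_of_pullback)
  show "I (eq_c C p) \<cdot> kernel_to_gal p = \<eta> (Dom C p) \<cdot> nker \<Gamma> p"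
    using \<eta>_natural_comp[of "eq_c C p" "kernel_section p"] t p by (simp add: kernel_to_gal_def)
qed

text \<open>The chosen inclusion of the Galois group is built in the subcategory, but since its kernels and
  pullbacks are also such in \<open>C\<close>, it is universal among all arrows of \<open>C\<close> that are annihilated by
  \<open>I(d)\<close> and \<open>I(c)\<close>.\<close>

lemma gal_incl:
  assumes p: "normal_extension \<Gamma> p"
  shows "gal_incl \<Gamma> p \<in> Arr C" "Dom C (gal_incl \<Gamma> p) = gal_obj \<Gamma> p" "gal_obj \<Gamma> p \<in> Obj X"
    "Cod C (gal_incl \<Gamma> p) = IO (eq_obj C p)"
    "is_zero_arr C (I (eq_d C p) \<cdot> gal_incl \<Gamma> p)" "is_zero_arr C (I (eq_c C p) \<cdot> gal_incl \<Gamma> p)"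
    "x \<in> Arr C \<Longrightarrow> Cod C x = IO (eq_obj C p) \<Longrightarrow> is_zero_arr C (I (eq_d C p) \<cdot> x) \<Longrightarrow>
      is_zero_arr C (I (eq_c C p) \<cdot> x) \<Longrightarrow>
      \<exists>h\<in>Arr C. Dom C h = Dom C x \<and> Cod C h = gal_obj \<Gamma> p \<and> gal_incl \<Gamma> p \<cdot> h = x"
    "h \<in> Arr C \<Longrightarrow> h' \<in> Arr C \<Longrightarrow> Dom C h = Dom C h' \<Longrightarrow> Cod C h = gal_obj \<Gamma> p \<Longrightarrow>
      Cod C h' = gal_obj \<Gamma> p \<Longrightarrow> gal_incl \<Gamma> p \<cdot> h = gal_incl \<Gamma> p \<cdot> h' \<Longrightarrow> h = h'"
proof -
  let ?kd = "ker_arr X (I (eq_d C p))" and ?kc = "ker_arr X (I (eq_c C p))"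
  have Kd: "is_kernel X (I (eq_d C p)) ?kd" and Kc: "is_kernel X (I (eq_c C p)) ?kc"
    using ex_kernel_X[OF I_X] p X.ker_arr_is_kernel by (metis eq_simps(1), metis eq_simps(2))
  note Kd' = kernel_C_if_X[OF Kd] and Kc' = kernel_C_if_X[OF Kc]
  note d = kernelD[OF Kd'] and c = kernelD[OF Kc']
  have kX: "?kd \<in> Arr X" "?kc \<in> Arr X" using X.kernelD[OF Kd] X.kernelD[OF Kc] by simp_all
  have "Cod C ?kd = Cod C ?kc" using c d p by simp
  then obtain a b where "is_pullback X ?kd ?kc a b" using ex_pullback_X kX by blast
  then have PX: "is_pullback X ?kd ?kc (pb_fst X ?kd ?kc) (pb_snd X ?kd ?kc)"
    by (rule X.pb_is_pullback)
  let ?a = "pb_fst X ?kd ?kc" and ?b = "pb_snd X ?kd ?kc"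
  note P = pullback_C_if_X[OF PX]
  note D = pullbackD[OF P] and DX = X.pullbackD[OF PX]
  have j: "gal_incl \<Gamma> p = ?kd \<cdot> ?a"
    using kX DX D by (simp add: gal_incl_def Let_def X_simps)
  have j': "gal_incl \<Gamma> p = ?kc \<cdot> ?b" using j D by simp
  show jA: "gal_incl \<Gamma> p \<in> Arr C" using j D by simp
  have "gal_incl \<Gamma> p \<in> Arr X" using j D DX kX by (simp add: Arr_X)
  then show obj: "Dom C (gal_incl \<Gamma> p) = gal_obj \<Gamma> p" "gal_obj \<Gamma> p \<in> Obj X"
    by (simp_all add: gal_obj_def X_simps Arr_X)
  show cod: "Cod C (gal_incl \<Gamma> p) = IO (eq_obj C p)" using j D d p by simp
  have Dab: "Dom C ?a = gal_obj \<Gamma> p" "Dom C ?b = gal_obj \<Gamma> p"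
    using obj D unfolding j by simp_all
  show "is_zero_arr C (I (eq_d C p) \<cdot> gal_incl \<Gamma> p)"
    unfolding j using comp_zero[OF d(4), of ?a] d D by simp
  show "is_zero_arr C (I (eq_c C p) \<cdot> gal_incl \<Gamma> p)"
    unfolding j' using comp_zero[OF c(4), of ?b] c D by simp
  show "\<exists>h\<in>Arr C. Dom C h = Dom C x \<and> Cod C h = gal_obj \<Gamma> p \<and> gal_incl \<Gamma> p \<cdot> h = x"
    if x: "x \<in> Arr C" "Cod C x = IO (eq_obj C p)" "is_zero_arr C (I (eq_d C p) \<cdot> x)"
      "is_zero_arr C (I (eq_c C p) \<cdot> x)"
  proof -
    obtain h where h: "h \<in> Arr C" "Dom C h = Dom C x" "Cod C h = Dom C ?kd" "?kd \<cdot> h = x"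
      by (rule kernel_lift[OF Kd', of x]) (use x p in simp_all)
    obtain l where l: "l \<in> Arr C" "Dom C l = Dom C x" "Cod C l = Dom C ?kc" "?kc \<cdot> l = x"
      by (rule kernel_lift[OF Kc', of x]) (use x p in simp_all)
    obtain m where "m \<in> Arr C" "Dom C m = Dom C h" "Cod C m = Dom C ?a" "?a \<cdot> m = h"
      by (rule pullback_lift[OF P, of h l]) (use h l in simp_all)
    then show ?thesis
      using h D(1-8) Dab unfolding j by (intro bexI[of _ m]) simp_all
  qed
  show "h = h'" if h: "h \<in> Arr C" "h' \<in> Arr C" "Dom C h = Dom C h'" "Cod C h = gal_obj \<Gamma> p"
      "Cod C h' = gal_obj \<Gamma> p" "gal_incl \<Gamma> p \<cdot> h = gal_incl \<Gamma> p \<cdot> h'"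
  proof -
    have "?a \<cdot> h = ?a \<cdot> h'"
      using h D(1-8) Dab unfolding j by - (rule kernel_eq[OF Kd'], simp_all)
    moreover have "?b \<cdot> h = ?b \<cdot> h'"
      using h D(1-8) Dab unfolding j' by - (rule kernel_eq[OF Kc'], simp_all)
    ultimately show ?thesis
      using h Dab D by - (rule pullback_eq[OF P], simp_all)
  qed
qed

lemma ker_eta_incl:
  assumes p: "normal_extension \<Gamma> p"
  shows "ker_eta_incl \<Gamma> p \<in> Arr C" "Cod C (ker_eta_incl \<Gamma> p) = Dom C (nker \<Gamma> p)"
    "is_zero_arr C (\<eta> (Dom C p) \<cdot> (nker \<Gamma> p \<cdot> ker_eta_incl \<Gamma> p))"
    "x \<in> Arr C \<Longrightarrow> Cod C x = Dom C (nker \<Gamma> p) \<Longrightarrow> is_zero_arr C (\<eta> (Dom C p) \<cdot> (nker \<Gamma> p \<cdot> x)) \<Longrightarrow>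
      \<exists>h\<in>Arr C. Dom C h = Dom C x \<and> Cod C h = Dom C (ker_eta_incl \<Gamma> p) \<and> ker_eta_incl \<Gamma> p \<cdot> h = x"
    "h \<in> Arr C \<Longrightarrow> h' \<in> Arr C \<Longrightarrow> Dom C h = Dom C h' \<Longrightarrow> Cod C h = Dom C (ker_eta_incl \<Gamma> p) \<Longrightarrow>
      Cod C h' = Dom C (ker_eta_incl \<Gamma> p) \<Longrightarrow> ker_eta_incl \<Gamma> p \<cdot> h = ker_eta_incl \<Gamma> p \<cdot> h' \<Longrightarrow> h = h'"
proof -
  let ?e = "\<eta> (Dom C p)"
  let ?k = "ker_arr C ?e" and ?n = "nker \<Gamma> p"
  have E: "Dom C p \<in> Obj C" using normal_Arr[OF p] by simp
  have K: "is_kernel C ?e ?k" using ex_kernel[of ?e] ker_arr_is_kernel E by auto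
  note KD = kernelD[OF K]
  have P: "is_pullback C ?n ?k (pb_fst C ?n ?k) (pb_snd C ?n ?k)"
    using ex_pullback[OF complete, of ?n ?k] p KD E pb_is_pullback[of ?n ?k] by auto
  note D = pullbackD[OF P]
  have e: "ker_eta_incl \<Gamma> p = pb_fst C ?n ?k" by (simp add: ker_eta_incl_def Let_def)
  show "ker_eta_incl \<Gamma> p \<in> Arr C" "Cod C (ker_eta_incl \<Gamma> p) = Dom C ?n"
    using D e by simp_all
  show "is_zero_arr C (?e \<cdot> (?n \<cdot> ker_eta_incl \<Gamma> p))"
    unfolding e D(9) using comp_zero[OF KD(4), of "pb_snd C ?n ?k"] KD D(4-8) by simp
  show "\<exists>h\<in>Arr C. Dom C h = Dom C x \<and> Cod C h = Dom C (ker_eta_incl \<Gamma> p) \<and> ker_eta_incl \<Gamma> p \<cdot> h = x"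
    if x: "x \<in> Arr C" "Cod C x = Dom C ?n" "is_zero_arr C (?e \<cdot> (?n \<cdot> x))"
  proof -
    obtain l where l: "l \<in> Arr C" "Dom C l = Dom C (?n \<cdot> x)" "Cod C l = Dom C ?k" "?k \<cdot> l = ?n \<cdot> x"
      by (rule kernel_lift[OF K, of "?n \<cdot> x"]) (use x p E in simp_all)
    obtain m where "m \<in> Arr C" "Dom C m = Dom C x" "Cod C m = Dom C (pb_fst C ?n ?k)" "pb_fst C ?n ?k \<cdot> m = x"
      by (rule pullback_lift[OF P, of x l]) (use x l p in simp_all)
    then show ?thesis unfolding e by blast
  qed
  show "h = h'" if h: "h \<in> Arr C" "h' \<in> Arr C" "Dom C h = Dom C h'" "Cod C h = Dom C (ker_eta_incl \<Gamma> p)"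
      "Cod C h' = Dom C (ker_eta_incl \<Gamma> p)" "ker_eta_incl \<Gamma> p \<cdot> h = ker_eta_incl \<Gamma> p \<cdot> h'"
  proof -
    have "?k \<cdot> (pb_snd C ?n ?k \<cdot> h) = ?k \<cdot> (pb_snd C ?n ?k \<cdot> h')"
      using square_extend[OF D(9), of h] square_extend[OF D(9), of h'] h D(1-8) unfolding e by simp
    then have "pb_snd C ?n ?k \<cdot> h = pb_snd C ?n ?k \<cdot> h'"
      using h D(1-8) unfolding e by - (rule kernel_eq[OF K], simp_all)
    then show ?thesis
      using h D(1-8) unfolding e by - (rule pullback_eq[OF P], simp_all)
  qed
qed

lemma in_NExt: "p \<in> Obj (NExt \<Gamma>) \<longleftrightarrow> normal_extension \<Gamma> p"
  using normal_Arr by (auto simp: NExt_def arrow_cat_def)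

text \<open>Arrows annihilated by \<open>I(d)\<close> factor through \<open>n = \<eta> \<langle>0, ker p\<rangle>\<close>, and \<open>I(c) n = \<eta>\<^sub>E ker(p)\<close>. Hence
  the Galois group and \<open>Ker(p) \<inter> Ker(\<eta>\<^sub>E)\<close> represent the same arrows, and \<open>\<iota>\<^sub>p\<close> is the unique arrow
  whose composite with \<open>n\<close> is the inclusion of the Galois group.\<close>

lemma iota:
  assumes p: "normal_extension \<Gamma> p"
  shows "iota \<Gamma> p \<in> Arr C" "Dom C (iota \<Gamma> p) = gal_obj \<Gamma> p" "Cod C (iota \<Gamma> p) = Dom C (nker \<Gamma> p)"
    "kernel_to_gal p \<cdot> iota \<Gamma> p = gal_incl \<Gamma> p"
proof -
  let ?j = "gal_incl \<Gamma> p" and ?n = "kernel_to_gal p" and ?e = "ker_eta_incl \<Gamma> p"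
  note j = gal_incl[OF p] and n = kernel_to_gal[OF p] and e = ker_eta_incl[OF p] and t = kernel_section[OF p]
  note nd = kernelD(4)[OF n(4)]
  have E: "Dom C p \<in> Obj C" using normal_Arr[OF p] by simp
  have "is_zero_arr C ((I (eq_d C p) \<cdot> ?n) \<cdot> ?e)"
    using n e(1-3) p by (intro comp_zero[OF nd]) simp_all
  then have z1: "is_zero_arr C (I (eq_d C p) \<cdot> (?n \<cdot> ?e))"
    using n e(1-3) p by simp
  have "I (eq_c C p) \<cdot> (?n \<cdot> ?e) = \<eta> (Dom C p) \<cdot> (nker \<Gamma> p \<cdot> ?e)"
    using n e(1-3) p E by (intro square_extend[OF n(5)]) simp_all
  then have z2: "is_zero_arr C (I (eq_c C p) \<cdot> (?n \<cdot> ?e))"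
    using e(3) by simp
  obtain \<phi> where \<phi>: "\<phi> \<in> Arr C" "Dom C \<phi> = Dom C ?e" "Cod C \<phi> = gal_obj \<Gamma> p" "?j \<cdot> \<phi> = ?n \<cdot> ?e"
    using j(7)[OF _ _ z1 z2] n e(1-3) by auto
  obtain j1 where j1: "j1 \<in> Arr C" "Dom C j1 = gal_obj \<Gamma> p" "Cod C j1 = Dom C ?n" "?n \<cdot> j1 = ?j"
    by (rule kernel_lift[OF n(4), of ?j]) (use j(1-6) p in simp_all)
  have "I (eq_c C p) \<cdot> ?j = \<eta> (Dom C p) \<cdot> (nker \<Gamma> p \<cdot> j1)"
    unfolding j1(4)[symmetric] using n j1 p E by (intro square_extend[OF n(5)]) simp_all
  then have "is_zero_arr C (\<eta> (Dom C p) \<cdot> (nker \<Gamma> p \<cdot> j1))"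
    using j(6) by simp
  then obtain \<psi> where \<psi>: "\<psi> \<in> Arr C" "Dom C \<psi> = gal_obj \<Gamma> p" "Cod C \<psi> = Dom C ?e" "?e \<cdot> \<psi> = j1"
    using e(4)[of j1] j1 n by auto
  have "?j \<cdot> (\<phi> \<cdot> \<psi>) = ?n \<cdot> (?e \<cdot> \<psi>)"
    using \<phi> \<psi> j(1-6) n e(1-3) by (intro square_extend[OF \<phi>(4)]) simp_all
  then have "?j \<cdot> (\<phi> \<cdot> \<psi>) = ?j \<cdot> Ide C (gal_obj \<Gamma> p)"
    using \<psi> j1 j(1-6) by simp
  then have \<phi>\<psi>: "\<phi> \<cdot> \<psi> = Ide C (gal_obj \<Gamma> p)"
    using \<phi> \<psi> j(1-6) by - (rule j(8), simp_all)
  have j1\<phi>: "j1 \<cdot> \<phi> = ?e"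
  proof (rule kernel_eq[OF n(4)])
    show "?n \<cdot> (j1 \<cdot> \<phi>) = ?n \<cdot> ?e"
      using eq_extend[OF j1(4), of \<phi>] j1 n \<phi> by simp
  qed (use j1 \<phi> e(1-3) n in simp_all)
  then have "?e \<cdot> (\<psi> \<cdot> \<phi>) = ?e \<cdot> Ide C (Dom C ?e)"
    using eq_extend[OF \<psi>(4), of \<phi>] j1\<phi> \<psi>(1-3) \<phi> e(1-3) by simp
  then have \<psi>\<phi>: "\<psi> \<cdot> \<phi> = Ide C (Dom C ?e)"
    using \<psi> \<phi> e(1-3) by - (rule e(5), simp_all)
  have inv: "inverse_arrows C \<phi> \<psi>"
    using \<phi> \<psi> \<phi>\<psi> \<psi>\<phi> by (simp add: inverse_arrows_def hom_def)
  have "gal_canon \<Gamma> p = \<phi>"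
    unfolding gal_canon_def Let_def Base kernel_section_def[symmetric] kernel_to_gal_def[symmetric]
    using \<phi> j(1-6) by (intro the_equality) (simp_all add: hom_def, rule j(8), simp_all)
  then have "inv_arr C (gal_canon \<Gamma> p) = \<psi>"
    using inverse_arrows_unique[OF inverse_inv_arr inv] inv by (auto simp: is_iso_def)
  then have iota: "iota \<Gamma> p = j1"
    using p \<psi> by (simp add: iota_def in_NExt)
  show "iota \<Gamma> p \<in> Arr C" "Dom C (iota \<Gamma> p) = gal_obj \<Gamma> p" "Cod C (iota \<Gamma> p) = Dom C (nker \<Gamma> p)"
    "?n \<cdot> iota \<Gamma> p = ?j"
    using j1 n by (simp_all add: iota)
qed

text \<open>The embedding of the Galois group into the domain \<open>E\<close> of \<open>p\<close>, with image \<open>Ker(p) \<inter> Ker(\<eta>\<^sub>E)\<close>.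
  Arrows between Galois groups are compared after composing with it.\<close>

definition iker :: "'a \<Rightarrow> 'a" where
  "iker p = nker \<Gamma> p \<cdot> iota \<Gamma> p"

lemma iker:
  assumes p: "normal_extension \<Gamma> p"
  shows "iker p \<in> Arr C" "Dom C (iker p) = gal_obj \<Gamma> p" "Cod C (iker p) = Dom C p"
    "is_zero_arr C (\<eta> (Dom C p) \<cdot> iker p)"
    "I (eq_c C p) \<cdot> gal_incl \<Gamma> p = \<eta> (Dom C p) \<cdot> iker p"
proof -
  note n = kernel_to_gal[OF p] and i = iota[OF p] and j = gal_incl[OF p]
  show 1: "iker p \<in> Arr C" "Dom C (iker p) = gal_obj \<Gamma> p" "Cod C (iker p) = Dom C p"
    using i p by (simp_all add: iker_def)
  show e: "I (eq_c C p) \<cdot> gal_incl \<Gamma> p = \<eta> (Dom C p) \<cdot> iker p"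
    unfolding i(4)[symmetric] iker_def using n i p normal_Arr[OF p] by (intro square_extend[OF n(5)]) simp_all
  then show "is_zero_arr C (\<eta> (Dom C p) \<cdot> iker p)" using j(6) by simp
qed

lemma iota_eq:
  assumes p: "normal_extension \<Gamma> p" and h: "h \<in> Arr C" "h' \<in> Arr C" "Dom C h = Dom C h'"
    "Cod C h = gal_obj \<Gamma> p" "Cod C h' = gal_obj \<Gamma> p" "iota \<Gamma> p \<cdot> h = iota \<Gamma> p \<cdot> h'"
  shows "h = h'"
proof -
  note n = kernel_to_gal[OF p] and i = iota[OF p]
  have "gal_incl \<Gamma> p \<cdot> h = gal_incl \<Gamma> p \<cdot> h'"
    using eq_extend[OF i(4), of h] eq_extend[OF i(4), of h'] n i h by simp
  then show ?thesis using h by - (rule gal_incl(8)[OF p], simp_all)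
qed

lemma iker_eq:
  assumes p: "normal_extension \<Gamma> p" and h: "h \<in> Arr C" "h' \<in> Arr C" "Dom C h = Dom C h'"
    "Cod C h = gal_obj \<Gamma> p" "Cod C h' = gal_obj \<Gamma> p" "iker p \<cdot> h = iker p \<cdot> h'"
  shows "h = h'"
proof -
  have "iota \<Gamma> p \<cdot> h = iota \<Gamma> p \<cdot> h'"
    using h iota[OF p] p unfolding iker_def by - (rule kernel_eq[OF nker(1)[OF p]], simp_all)
  then show ?thesis using h by - (rule iota_eq[OF p], simp_all)
qed

lemma iota_lift:
  assumes p: "normal_extension \<Gamma> p" and x: "x \<in> Arr C" "Cod C x = Dom C (nker \<Gamma> p)"
    "is_zero_arr C (\<eta> (Dom C p) \<cdot> (nker \<Gamma> p \<cdot> x))"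
  obtains h where "h \<in> Arr C" "Dom C h = Dom C x" "Cod C h = gal_obj \<Gamma> p" "iota \<Gamma> p \<cdot> h = x"
proof -
  let ?n = "kernel_to_gal p"
  note n = kernel_to_gal[OF p] and i = iota[OF p] and j = gal_incl[OF p]
  have "is_zero_arr C ((I (eq_d C p) \<cdot> ?n) \<cdot> x)"
    using n x p by (intro comp_zero[OF kernelD(4)[OF n(4)]]) simp_all
  then have "is_zero_arr C (I (eq_d C p) \<cdot> (?n \<cdot> x))"
    using n x p by simp
  moreover have "I (eq_c C p) \<cdot> (?n \<cdot> x) = \<eta> (Dom C p) \<cdot> (nker \<Gamma> p \<cdot> x)"
    using n x p normal_Arr[OF p] by (intro square_extend[OF n(5)]) simp_all
  ultimately obtain h where h: "h \<in> Arr C" "Dom C h = Dom C x" "Cod C h = gal_obj \<Gamma> p" "gal_incl \<Gamma> p \<cdot> h = ?n \<cdot> x"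
    using j(7)[of "?n \<cdot> x"] n x by auto
  have "?n \<cdot> (iota \<Gamma> p \<cdot> h) = ?n \<cdot> x"
    using eq_extend[OF i(4), of h] n i h by simp
  then have "iota \<Gamma> p \<cdot> h = x"
    using h i n x by - (rule kernel_eq[OF n(4)], simp_all)
  then show ?thesis using that h by blast
qed


section \<open>Functoriality of kernels and Galois groups\<close>

lemma Arr_NExt: "(p, (f, b), q) \<in> Arr (NExt \<Gamma>) \<longleftrightarrow> normal_extension \<Gamma> p \<and> normal_extension \<Gamma> q \<and>
    f \<in> Arr C \<and> Dom C f = Dom C p \<and> Cod C f = Dom C q \<and>
    b \<in> Arr C \<and> Dom C b = Cod C p \<and> Cod C b = Cod C q \<and> q \<cdot> f = b \<cdot> p"
proof -
  have "(p, (f, b), q) \<in> Arr (NExt \<Gamma>) \<longleftrightarrow> (p \<in> Arr C \<and> q \<in> Arr C \<and>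
    (f \<in> Arr C \<and> Dom C f = Dom C p \<and> Cod C f = Dom C q) \<and>
    (b \<in> Arr C \<and> Dom C b = Cod C p \<and> Cod C b = Cod C q) \<and> q \<cdot> f = b \<cdot> p) \<and>
    normal_extension \<Gamma> p \<and> normal_extension \<Gamma> q"
    by (simp add: NExt_def arrow_cat_def hom_def)
  then show ?thesis using normal_Arr by blast
qed

lemma NExt_simps:
  "Dom (NExt \<Gamma>) (p, fb, q) = p" "Cod (NExt \<Gamma>) (p, fb, q) = q"
  "Ide (NExt \<Gamma>) p = (p, (Ide C (Dom C p), Ide C (Cod C p)), p)"
  "(q, (g, c), r) \<cdot>\<^bsub>NExt \<Gamma>\<^esub> (p, (f, b), q') = (p, (g \<cdot> f, c \<cdot> b), r)"
  by (simp_all add: NExt_def arrow_cat_def)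

lemma NExt_category: "is_category (NExt \<Gamma>)"
  unfolding NExt_def by (intro category.full_subcat_category) (simp add: category_def arrow_cat_category)

definition ker_map :: "'a \<Rightarrow> 'a \<Rightarrow> 'a \<Rightarrow> 'a" where
  "ker_map p f q = (THE m. m \<in> hom C (Dom C (nker \<Gamma> p)) (Dom C (nker \<Gamma> q)) \<and>
     nker \<Gamma> q \<cdot> m = f \<cdot> nker \<Gamma> p)"

lemma KerF_simps: "FObj (KerF \<Gamma>) p = Dom C (nker \<Gamma> p)" "FArr (KerF \<Gamma>) (p, (f, b), q) = ker_map p f q"
  by (simp_all add: KerF_def Let_def ker_map_def)

lemma nker_eq:
  assumes "normal_extension \<Gamma> p" "h \<in> Arr C" "h' \<in> Arr C" "Dom C h = Dom C h'"
    "Cod C h = Dom C (nker \<Gamma> p)" "Cod C h' = Dom C (nker \<Gamma> p)" "nker \<Gamma> p \<cdot> h = nker \<Gamma> p \<cdot> h'"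
  shows "h = h'"
  using kernel_eq[OF nker(1)] assms by blast

lemma ker_map:
  assumes "(p, (f, b), q) \<in> Arr (NExt \<Gamma>)"
  shows "ker_map p f q \<in> Arr C" "Dom C (ker_map p f q) = Dom C (nker \<Gamma> p)"
    "Cod C (ker_map p f q) = Dom C (nker \<Gamma> q)" "nker \<Gamma> q \<cdot> ker_map p f q = f \<cdot> nker \<Gamma> p"
proof -
  have *: "normal_extension \<Gamma> p" "normal_extension \<Gamma> q" "p \<in> Arr C" "q \<in> Arr C"
    "f \<in> Arr C" "Dom C f = Dom C p" "Cod C f = Dom C q"
    "b \<in> Arr C" "Dom C b = Cod C p" "Cod C b = Cod C q" "q \<cdot> f = b \<cdot> p"
    using assms normal_Arr[of p] normal_Arr[of q] unfolding Arr_NExt by simp_all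
  have "q \<cdot> (f \<cdot> nker \<Gamma> p) = b \<cdot> (p \<cdot> nker \<Gamma> p)"
    using * by (intro square_extend[OF *(11)]) simp_all
  moreover have "is_zero_arr C (b \<cdot> (p \<cdot> nker \<Gamma> p))"
    using zero_comp[OF kernelD(4)[OF nker(1)[OF *(1)]], of b] * by simp
  ultimately obtain m where m: "m \<in> Arr C" "Dom C m = Dom C (nker \<Gamma> p)" "Cod C m = Dom C (nker \<Gamma> q)"
      "nker \<Gamma> q \<cdot> m = f \<cdot> nker \<Gamma> p"
    using kernel_lift[OF nker(1)[OF *(2)], of "f \<cdot> nker \<Gamma> p"] * by auto
  have "ker_map p f q = m"
    unfolding ker_map_def using m by (intro the_equality) (simp_all add: hom_def, rule nker_eq[OF *(2)], simp_all)
  then show "ker_map p f q \<in> Arr C" "Dom C (ker_map p f q) = Dom C (nker \<Gamma> p)"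
    "Cod C (ker_map p f q) = Dom C (nker \<Gamma> q)" "nker \<Gamma> q \<cdot> ker_map p f q = f \<cdot> nker \<Gamma> p"
    using m by simp_all
qed

text \<open>The last equation characterises \<open>Gal(f, b)\<close> without reference to \<open>I(Eq(f))\<close>. It expresses the
  naturality of \<open>\<iota>\<close> and results from the naturality of \<open>\<eta>\<close> and of \<open>\<langle>0, ker p\<rangle>\<close> in \<open>p\<close>.\<close>

lemma gal_map:
  assumes "(p, (f, b), q) \<in> Arr (NExt \<Gamma>)"
  shows "gal_map \<Gamma> p f q \<in> Arr C" "Dom C (gal_map \<Gamma> p f q) = gal_obj \<Gamma> p"
    "Cod C (gal_map \<Gamma> p f q) = gal_obj \<Gamma> q"
    "iker q \<cdot> gal_map \<Gamma> p f q = f \<cdot> iker p"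
proof -
  have *: "normal_extension \<Gamma> p" "normal_extension \<Gamma> q" "p \<in> Arr C" "q \<in> Arr C"
    "f \<in> Arr C" "Dom C f = Dom C p" "Cod C f = Dom C q"
    "b \<in> Arr C" "Dom C b = Cod C p" "Cod C b = Cod C q" "q \<cdot> f = b \<cdot> p"
    using assms normal_Arr[of p] normal_Arr[of q] unfolding Arr_NExt by simp_all
  let ?M = "eq_map C p f q" and ?d = "eq_d C p" and ?c = "eq_c C p" and ?d' = "eq_d C q" and ?c' = "eq_c C q"
  let ?j = "gal_incl \<Gamma> p" and ?j' = "gal_incl \<Gamma> q"
  note j = gal_incl[OF *(1)] and j' = gal_incl[OF *(2)]
  have "q \<cdot> (f \<cdot> ?d) = b \<cdot> (p \<cdot> ?d)" "q \<cdot> (f \<cdot> ?c) = b \<cdot> (p \<cdot> ?c)"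
    using *(1-10) by (intro square_extend[OF *(11)]; simp)+
  then have fdc: "q \<cdot> (f \<cdot> ?d) = q \<cdot> (f \<cdot> ?c)" using eq_simps(8)[OF *(1)] by simp
  have "f \<cdot> ?d \<in> Arr C" "f \<cdot> ?c \<in> Arr C" "Dom C (f \<cdot> ?d) = Dom C (f \<cdot> ?c)" "Cod C (f \<cdot> ?d) = Dom C q"
    "Cod C (f \<cdot> ?c) = Dom C q" using *(1-7) by simp_all
  note M0 = pb_tuple[OF kernel_pair[OF *(4)] this fdc, folded eq_map_def eq_d_def eq_c_def]
  have M: "?M \<in> Arr C" "Dom C ?M = eq_obj C p" "Cod C ?M = eq_obj C q" "?d' \<cdot> ?M = f \<cdot> ?d" "?c' \<cdot> ?M = f \<cdot> ?c"
    using M0(1-3) *(1-7) M0(4,5) by simp_all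
  have IM: "I ?d' \<cdot> I ?M = I f \<cdot> I ?d" "I ?c' \<cdot> I ?M = I f \<cdot> I ?c"
    using arg_cong[OF M(4), of I] arg_cong[OF M(5), of I] M(1-3) * by simp_all
  have "I ?d' \<cdot> (I ?M \<cdot> ?j) = I f \<cdot> (I ?d \<cdot> ?j)" "I ?c' \<cdot> (I ?M \<cdot> ?j) = I f \<cdot> (I ?c \<cdot> ?j)"
    using M(1-3) * j(1-6) square_extend[OF IM(1), of ?j] square_extend[OF IM(2), of ?j] by simp_all
  moreover have "is_zero_arr C (I f \<cdot> (I ?d \<cdot> ?j))" "is_zero_arr C (I f \<cdot> (I ?c \<cdot> ?j))"
    using zero_comp[OF j(5), of "I f"] zero_comp[OF j(6), of "I f"] * j(1-6) by simp_all
  ultimately obtain m where m: "m \<in> Arr C" "Dom C m = gal_obj \<Gamma> p" "Cod C m = gal_obj \<Gamma> q" "?j' \<cdot> m = I ?M \<cdot> ?j"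
    using j'(7)[of "I ?M \<cdot> ?j"] M * j(1-6) by auto
  have hom_eq: "hom X (gal_obj \<Gamma> p) (gal_obj \<Gamma> q) = hom C (gal_obj \<Gamma> p) (gal_obj \<Gamma> q)"
    using j(3) j'(3) by (rule X_hom)
  have X_comp: "?j' \<cdot>\<^bsub>X\<^esub> m = ?j' \<cdot> m" if "m \<in> hom C (gal_obj \<Gamma> p) (gal_obj \<Gamma> q)" for m
    using that j(1-6) j'(1-6) * by (intro X_simps(4)) (simp_all add: hom_def Arr_X)
  have "I ?M \<cdot>\<^bsub>X\<^esub> ?j = I ?M \<cdot> ?j"
    using M j(1-6) * by (intro X_simps(4)) (simp_all add: Arr_X)
  then have gm: "gal_map \<Gamma> p f q = m"
    unfolding gal_map_def Let_def Base hom_eq using m X_comp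
    by (intro the_equality) (simp_all add: hom_def, rule j'(8), simp_all, metis)
  show m': "gal_map \<Gamma> p f q \<in> Arr C" "Dom C (gal_map \<Gamma> p f q) = gal_obj \<Gamma> p"
    "Cod C (gal_map \<Gamma> p f q) = gal_obj \<Gamma> q" using m gm by simp_all
  let ?n = "kernel_to_gal p" and ?n' = "kernel_to_gal q" and ?t = "kernel_section p" and ?t' = "kernel_section q"
  let ?K = "ker_map p f q"
  note n = kernel_to_gal[OF *(1)] and n' = kernel_to_gal[OF *(2)] and t = kernel_section[OF *(1)]
    and t' = kernel_section[OF *(2)] and i = iota[OF *(1)] and i' = iota[OF *(2)] and K = ker_map[OF assms]
  have "?M \<cdot> ?t = ?t' \<cdot> ?K"
  proof (rule pullback_eq[OF kernel_pair[OF *(4)]])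
    have "?d' \<cdot> (?M \<cdot> ?t) = f \<cdot> (?d \<cdot> ?t)"
      using M(1-3) t * by (intro square_extend[OF M(4)]) simp_all
    moreover have "is_zero_arr C (f \<cdot> (?d \<cdot> ?t))"
      using zero_comp[OF t(4), of f] t * by simp
    moreover have "is_zero_arr C ((?d' \<cdot> ?t') \<cdot> ?K)"
      using t' K * by (intro comp_zero[OF t'(4)]) simp_all
    ultimately show "?d' \<cdot> (?M \<cdot> ?t) = ?d' \<cdot> (?t' \<cdot> ?K)"
      using M(1-3) t(1-3) t'(1-3) K(1-3) * by - (rule zero_arr_unique, simp_all)
    have "?c' \<cdot> (?M \<cdot> ?t) = f \<cdot> (?c \<cdot> ?t)"
      using M(1-3) t * by (intro square_extend[OF M(5)]) simp_all
    also have "\<dots> = ?c' \<cdot> (?t' \<cdot> ?K)"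
      using eq_extend[OF t'(5), of ?K] t t' K * by simp
    finally show "?c' \<cdot> (?M \<cdot> ?t) = ?c' \<cdot> (?t' \<cdot> ?K)" .
  qed (use M(1-3) t t' K * in simp_all)
  then have nK: "I ?M \<cdot> ?n = ?n' \<cdot> ?K"
    using \<eta>_natural_comp[of ?M ?t] M(1-3) t t' K * by (simp add: kernel_to_gal_def)
  have "?n' \<cdot> (iota \<Gamma> q \<cdot> m) = I ?M \<cdot> ?j"
    using eq_extend[OF i'(4), of m] m i' n' by simp
  also have "\<dots> = ?n' \<cdot> (?K \<cdot> iota \<Gamma> p)"
    unfolding i(4)[symmetric] using M(1-3) n i K n' * by (intro square_extend[OF nK]) simp_all
  finally have im: "iota \<Gamma> q \<cdot> m = ?K \<cdot> iota \<Gamma> p"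
    using m i i' n n' K by - (rule kernel_eq[OF n'(4)], simp_all)
  have "iker q \<cdot> m = nker \<Gamma> q \<cdot> (iota \<Gamma> q \<cdot> m)"
    using i' m * by (simp add: iker_def)
  also have "\<dots> = f \<cdot> iker p"
    unfolding im iker_def using K i * by (intro square_extend[OF K(4)]) simp_all
  finally show "iker q \<cdot> gal_map \<Gamma> p f q = f \<cdot> iker p" using gm by simp
qed

text \<open>Let \<open>u = \<langle>f, g\<rangle>\<close> and \<open>v = \<langle>f, f\<rangle>\<close> be the induced arrows into \<open>Eq(q)\<close>. Restricted along \<open>i\<^sub>p\<close> both
  are annihilated by \<open>\<eta>\<close>, because \<open>\<eta> u i\<^sub>p = I(u) \<eta>\<^sub>E i\<^sub>p = 0\<close>, and both have first projection \<open>f i\<^sub>p\<close>.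
  As \<open>d\<close> is a trivial covering, \<open>d\<close> and \<open>\<eta>\<close> are jointly monic, so the second projections agree too.\<close>

lemma iker_independent:
  assumes f: "(p, (f, b), q) \<in> Arr (NExt \<Gamma>)" and g: "(p, (g, b), q) \<in> Arr (NExt \<Gamma>)"
  shows "f \<cdot> iker p = g \<cdot> iker p"
proof -
  have *: "normal_extension \<Gamma> p" "normal_extension \<Gamma> q" "p \<in> Arr C" "q \<in> Arr C"
    "f \<in> Arr C" "Dom C f = Dom C p" "Cod C f = Dom C q" "g \<in> Arr C" "Dom C g = Dom C p" "Cod C g = Dom C q"
    "q \<cdot> f = q \<cdot> g"
    using f g normal_Arr[of p] normal_Arr[of q] unfolding Arr_NExt by simp_all
  note P = kernel_pair[OF *(4)] and i = iker[OF *(1)]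
  note D = pullbackD[OF P]
  let ?d = "eq_d C q" and ?c = "eq_c C q"
  obtain u where u: "u \<in> Arr C" "Dom C u = Dom C p" "Cod C u = eq_obj C q" "?d \<cdot> u = f" "?c \<cdot> u = g"
    using pullback_lift[OF P, of f g] * by auto
  obtain v where v: "v \<in> Arr C" "Dom C v = Dom C p" "Cod C v = eq_obj C q" "?d \<cdot> v = f" "?c \<cdot> v = f"
    using pullback_lift[OF P, of f f] * by auto
  have z: "is_zero_arr C (\<eta> (eq_obj C q) \<cdot> (w \<cdot> iker p))" if "w \<in> Arr C" "Dom C w = Dom C p" "Cod C w = eq_obj C q" for w
  proof -
    have "I w \<cdot> (\<eta> (Dom C p) \<cdot> iker p) = \<eta> (eq_obj C q) \<cdot> (w \<cdot> iker p)"
      using \<eta>_natural_comp[of w "iker p"] that i by simp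
    moreover have "is_zero_arr C (I w \<cdot> (\<eta> (Dom C p) \<cdot> iker p))"
      using zero_comp[OF i(4), of "I w"] that i * by simp
    ultimately show ?thesis by simp
  qed
  have T: "is_pullback C (I ?d) (\<eta> (Dom C q)) (\<eta> (eq_obj C q)) ?d"
    using trivial_eq_d[OF *(2)] * by (simp add: trivial_covering)
  have "u \<cdot> iker p = v \<cdot> iker p"
  proof (rule pullback_eq[OF T])
    show "\<eta> (eq_obj C q) \<cdot> (u \<cdot> iker p) = \<eta> (eq_obj C q) \<cdot> (v \<cdot> iker p)"
      using z[of u] z[of v] u v i * by - (rule zero_arr_unique, simp_all)
    show "?d \<cdot> (u \<cdot> iker p) = ?d \<cdot> (v \<cdot> iker p)"
      using eq_extend[OF u(4), of "iker p"] eq_extend[OF v(4), of "iker p"] u v i * by simp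
  qed (use u v i * in simp_all)
  then have "?c \<cdot> (u \<cdot> iker p) = ?c \<cdot> (v \<cdot> iker p)" by simp
  then show ?thesis
    using eq_extend[OF u(5), of "iker p"] eq_extend[OF v(5), of "iker p"] u v i * by simp
qed

lemma gal_map_eqI:
  assumes "(p, (f, b), q) \<in> Arr (NExt \<Gamma>)" "m \<in> Arr C" "Dom C m = gal_obj \<Gamma> p" "Cod C m = gal_obj \<Gamma> q"
    "iker q \<cdot> m = f \<cdot> iker p"
  shows "gal_map \<Gamma> p f q = m"
  using gal_map[OF assms(1)] assms by - (rule iker_eq[of q], simp_all add: Arr_NExt)

section \<open>The fundamental group as a Kan extension\<close>

lemma wuniv:
  assumes "B \<in> Obj C"
  shows "normal_extension \<Gamma> (wuniv \<Gamma> B)" "Cod C (wuniv \<Gamma> B) = B"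
    "normal_extension \<Gamma> p \<Longrightarrow> Cod C p = B \<Longrightarrow>
      \<exists>e\<in>Arr C. Dom C e = Dom C (wuniv \<Gamma> B) \<and> Cod C e = Dom C p \<and> p \<cdot> e = wuniv \<Gamma> B"
proof -
  have "\<exists>u. weakly_universal \<Gamma> u \<and> Cod C u = B" using ex_weakly_universal assms by blast
  from someI_ex[OF this] have u: "weakly_universal \<Gamma> (wuniv \<Gamma> B)" "Cod C (wuniv \<Gamma> B) = B"
    by (simp_all add: wuniv_def)
  then show "normal_extension \<Gamma> (wuniv \<Gamma> B)" "Cod C (wuniv \<Gamma> B) = B"
    by (simp_all add: weakly_universal_def)
  show "\<exists>e\<in>Arr C. Dom C e = Dom C (wuniv \<Gamma> B) \<and> Cod C e = Dom C p \<and> p \<cdot> e = wuniv \<Gamma> B"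
    if "normal_extension \<Gamma> p" "Cod C p = B"
    using u that unfolding weakly_universal_def hom_def by auto
qed

text \<open>The pullback of the weakly universal extension of the codomain is a normal extension of the
  domain.\<close>

lemma wuniv_lift:
  assumes f: "f \<in> Arr C"
  shows "(wuniv \<Gamma> (Dom C f), (wuniv_lift \<Gamma> f, f), wuniv \<Gamma> (Cod C f)) \<in> Arr (NExt \<Gamma>)"
proof -
  let ?v = "wuniv \<Gamma> (Dom C f)" and ?u = "wuniv \<Gamma> (Cod C f)"
  note v = wuniv[OF Dom_Obj[OF f]] and u = wuniv[OF Cod_Obj[OF f]]
  note A = normal_Arr[OF v(1)] normal_Arr[OF u(1)]
  obtain g q where P: "is_pullback C ?u f g q"
    using ex_pullback[OF complete A(2) f] u(2) by auto
  note D = pullbackD[OF P]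
  obtain e where e: "e \<in> Arr C" "Dom C e = Dom C ?v" "Cod C e = Dom C q" "q \<cdot> e = ?v"
    using v(3)[OF normal_extension_stable[OF u(1) P]] D by auto
  have "?u \<cdot> (g \<cdot> e) = f \<cdot> (q \<cdot> e)"
    using D(1-8) e by (intro square_extend[OF D(9)]) simp_all
  then have "(?v, (g \<cdot> e, f), ?u) \<in> Arr (NExt \<Gamma>)"
    using D(1-8) e u v f by (simp add: Arr_NExt)
  then show ?thesis
    unfolding wuniv_lift_def Let_def Base by (rule someI)
qed

lemma wuniv_over:
  assumes p: "normal_extension \<Gamma> p"
  shows "(wuniv \<Gamma> (Cod C p), (wuniv_over \<Gamma> p, Ide C (Cod C p)), p) \<in> Arr (NExt \<Gamma>)"
proof -
  note pA = normal_Arr[OF p]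
  let ?u = "wuniv \<Gamma> (Cod C p)"
  note u = wuniv[OF Cod_Obj[OF pA]]
  have "\<exists>h. h \<in> hom C (Dom C ?u) (Dom C p) \<and> p \<cdot> h = ?u"
    using u(3)[OF p] by (auto simp: hom_def)
  from someI_ex[OF this] have "wuniv_over \<Gamma> p \<in> hom C (Dom C ?u) (Dom C p) \<and> p \<cdot> wuniv_over \<Gamma> p = ?u"
    by (simp add: wuniv_over_def Let_def)
  then show ?thesis
    using u p pA normal_Arr[OF u(1)] by (simp add: Arr_NExt hom_def)
qed

lemma pi1_simps: "FObj (pi1 \<Gamma>) B = gal_obj \<Gamma> (wuniv \<Gamma> B)"
  "FArr (pi1 \<Gamma>) f = gal_map \<Gamma> (wuniv \<Gamma> (Dom C f)) (wuniv_lift \<Gamma> f) (wuniv \<Gamma> (Cod C f))"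
  by (simp_all add: pi1_def underlying_def fundamental_group_def Gal_def gal_group_def)

lemma kappa: "normal_extension \<Gamma> p \<Longrightarrow> kappa \<Gamma> p = gal_map \<Gamma> (wuniv \<Gamma> (Cod C p)) (wuniv_over \<Gamma> p) p"
  by (simp add: kappa_def in_NExt underlying_def Gal_def)

lemma pi1_map:
  assumes f: "f \<in> Arr C"
  shows "FArr (pi1 \<Gamma>) f \<in> Arr C" "Dom C (FArr (pi1 \<Gamma>) f) = gal_obj \<Gamma> (wuniv \<Gamma> (Dom C f))"
    "Cod C (FArr (pi1 \<Gamma>) f) = gal_obj \<Gamma> (wuniv \<Gamma> (Cod C f))"
    "iker (wuniv \<Gamma> (Cod C f)) \<cdot> FArr (pi1 \<Gamma>) f = wuniv_lift \<Gamma> f \<cdot> iker (wuniv \<Gamma> (Dom C f))"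
  using gal_map[OF wuniv_lift[OF f]] by (simp_all add: pi1_simps)

text \<open>A lift of a composite and the composite of lifts lie over the same arrow, and so do a lift of an
  identity and the identity; hence they induce the same arrow of Galois groups.\<close>

lemma pi1_functor: "is_functor C X (pi1 \<Gamma>)"
proof (rule is_functorI[OF category X_category])
  fix B assume "B \<in> Obj C"
  then show "FObj (pi1 \<Gamma>) B \<in> Obj X"
    using gal_incl(3)[OF wuniv(1)] by (simp add: pi1_simps)
next
  fix f assume f: "f \<in> Arr C"
  have "FArr (pi1 \<Gamma>) f \<in> Arr X"
    using pi1_map[OF f] gal_incl(3)[OF wuniv(1)] f by (simp add: Arr_X)
  then show "FArr (pi1 \<Gamma>) f \<in> Arr X \<and> Dom X (FArr (pi1 \<Gamma>) f) = FObj (pi1 \<Gamma>) (Dom C f) \<and>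
      Cod X (FArr (pi1 \<Gamma>) f) = FObj (pi1 \<Gamma>) (Cod C f)"
    using pi1_map[OF f] by (simp add: X_simps pi1_simps(1))
next
  fix B assume B: "B \<in> Obj C"
  let ?u = "wuniv \<Gamma> B" and ?l = "wuniv_lift \<Gamma> (Ide C B)"
  note u = wuniv[OF B] and G = gal_incl(3)[OF wuniv(1)[OF B]]
  note uA = normal_Arr[OF u(1)]
  note i = iker[OF u(1)]
  have N: "(?u, (?l, Ide C B), ?u) \<in> Arr (NExt \<Gamma>)"
    using wuniv_lift[of "Ide C B"] B by simp
  have N': "(?u, (Ide C (Dom C ?u), Ide C B), ?u) \<in> Arr (NExt \<Gamma>)"
    using u(1,2) uA by (simp add: Arr_NExt B)
  have "gal_map \<Gamma> ?u ?l ?u = Ide C (gal_obj \<Gamma> ?u)"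
    using i G iker_independent[OF N N'] by (intro gal_map_eqI[OF N]) simp_all
  then show "FArr (pi1 \<Gamma>) (Ide C B) = Ide X (FObj (pi1 \<Gamma>) B)"
    using B G by (simp add: pi1_simps X_simps)
next
  fix f g assume fg: "f \<in> Arr C" "g \<in> Arr C" "Cod C f = Dom C g"
  let ?u = "wuniv \<Gamma> (Dom C f)" and ?v = "wuniv \<Gamma> (Dom C g)" and ?w = "wuniv \<Gamma> (Cod C g)"
  let ?lf = "wuniv_lift \<Gamma> f" and ?lg = "wuniv_lift \<Gamma> g" and ?l = "wuniv_lift \<Gamma> (g \<cdot> f)"
  note mf = pi1_map[OF fg(1)] and mg = pi1_map[OF fg(2)] and m = pi1_map[of "g \<cdot> f"]
  note Nf = wuniv_lift[OF fg(1)] and Ng = wuniv_lift[OF fg(2)]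
  have N: "(?u, (?l, g \<cdot> f), ?w) \<in> Arr (NExt \<Gamma>)"
    using wuniv_lift[of "g \<cdot> f"] fg by simp
  interpret N: category "NExt \<Gamma>" using NExt_category by (simp add: category_def)
  have N': "(?u, (?lg \<cdot> ?lf, g \<cdot> f), ?w) \<in> Arr (NExt \<Gamma>)"
    using N.comp_Arr[OF Nf Ng] fg by (simp add: NExt_simps)
  note u = wuniv(1)[OF Dom_Obj[OF fg(1)]] and v = wuniv(1)[OF Dom_Obj[OF fg(2)]] and w = wuniv(1)[OF Cod_Obj[OF fg(2)]]
  note iu = iker[OF u] and iv = iker[OF v] and iw = iker[OF w]
  have lf: "?lf \<in> Arr C" "Dom C ?lf = Dom C ?u" "Cod C ?lf = Dom C ?v"
    and lg: "?lg \<in> Arr C" "Dom C ?lg = Dom C ?v" "Cod C ?lg = Dom C ?w"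
    using Nf Ng fg by (simp_all add: Arr_NExt)
  let ?f = "FArr (pi1 \<Gamma>) f" and ?g = "FArr (pi1 \<Gamma>) g"
  have "iker ?w \<cdot> (?g \<cdot> ?f) = ?lg \<cdot> (iker ?v \<cdot> ?f)"
    using mf(1-3) mg(1-3) fg iw(1-3) iv(1-3) lg by (intro square_extend[OF mg(4)]) simp_all
  also have "\<dots> = (?lg \<cdot> ?lf) \<cdot> iker ?u"
    using mf(4) fg lf lg iu by simp
  also have "\<dots> = ?l \<cdot> iker ?u"
    by (rule iker_independent[OF N' N])
  finally have "gal_map \<Gamma> ?u ?l ?w = ?g \<cdot> ?f"
    using mf mg fg by (intro gal_map_eqI[OF N]) simp_all
  moreover have "?g \<cdot>\<^bsub>X\<^esub> ?f = ?g \<cdot> ?f"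
    using mf mg fg gal_incl(3)[OF u] gal_incl(3)[OF v] gal_incl(3)[OF w] by (intro X_simps(4)) (simp_all add: Arr_X)
  ultimately show "FArr (pi1 \<Gamma>) (g \<cdot> f) = FArr (pi1 \<Gamma>) g \<cdot>\<^bsub>X\<^esub> FArr (pi1 \<Gamma>) f"
    using fg by (simp add: pi1_simps(2)[of "g \<cdot> f"])
qed

lemma CodF_simps: "FObj (CodF \<Gamma>) = Cod C" "FArr (CodF \<Gamma>) (p, (f, b), q) = b"
  by (simp_all add: CodF_def)

lemma CodF_functor: "is_functor (NExt \<Gamma>) C (CodF \<Gamma>)"
proof (rule is_functorI[OF NExt_category category])
  fix x y assume "x \<in> Arr (NExt \<Gamma>)" "y \<in> Arr (NExt \<Gamma>)" "Cod (NExt \<Gamma>) x = Dom (NExt \<Gamma>) y"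
  then show "FArr (CodF \<Gamma>) (y \<cdot>\<^bsub>NExt \<Gamma>\<^esub> x) = FArr (CodF \<Gamma>) y \<cdot> FArr (CodF \<Gamma>) x"
    by (cases x; cases y) (auto simp: NExt_simps CodF_simps)
next
  fix x assume "x \<in> Arr (NExt \<Gamma>)"
  then show "FArr (CodF \<Gamma>) x \<in> Arr C \<and> Dom C (FArr (CodF \<Gamma>) x) = FObj (CodF \<Gamma>) (Dom (NExt \<Gamma>) x) \<and>
      Cod C (FArr (CodF \<Gamma>) x) = FObj (CodF \<Gamma>) (Cod (NExt \<Gamma>) x)"
    by (cases x) (auto simp: NExt_simps CodF_simps Arr_NExt)
qed (auto simp: NExt_simps CodF_simps in_NExt normal_Arr)

lemma ker_map_eqI:
  assumes "(p, (f, b), q) \<in> Arr (NExt \<Gamma>)" "m \<in> Arr C" "Dom C m = Dom C (nker \<Gamma> p)" "Cod C m = Dom C (nker \<Gamma> q)"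
    "nker \<Gamma> q \<cdot> m = f \<cdot> nker \<Gamma> p"
  shows "ker_map p f q = m"
  using ker_map[OF assms(1)] assms by - (rule nker_eq[of q], simp_all add: Arr_NExt)

lemma KerF_functor: "is_functor (NExt \<Gamma>) X (KerF \<Gamma>)"
proof (rule is_functorI[OF NExt_category X_category])
  fix p assume "p \<in> Obj (NExt \<Gamma>)"
  then show "FObj (KerF \<Gamma>) p \<in> Obj X" using nker(2) by (simp add: in_NExt KerF_simps)
next
  fix x assume x: "x \<in> Arr (NExt \<Gamma>)"
  obtain p f b q where x_def: "x = (p, (f, b), q)" by (metis prod.exhaust)
  note N = x[unfolded x_def]
  have "ker_map p f q \<in> Arr X"
    using ker_map[OF N] N nker(2) by (simp add: Arr_X Arr_NExt)
  then show "FArr (KerF \<Gamma>) x \<in> Arr X \<and> Dom X (FArr (KerF \<Gamma>) x) = FObj (KerF \<Gamma>) (Dom (NExt \<Gamma>) x) \<and>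
      Cod X (FArr (KerF \<Gamma>) x) = FObj (KerF \<Gamma>) (Cod (NExt \<Gamma>) x)"
    using ker_map[OF N] by (simp add: x_def KerF_simps NExt_simps X_simps)
next
  interpret N: category "NExt \<Gamma>" using NExt_category by (simp add: category_def)
  fix p assume p: "p \<in> Obj (NExt \<Gamma>)"
  then have "(p, (Ide C (Dom C p), Ide C (Cod C p)), p) \<in> Arr (NExt \<Gamma>)"
    using N.Ide_Arr[OF p] by (simp add: NExt_simps)
  then have "ker_map p (Ide C (Dom C p)) p = Ide C (Dom C (nker \<Gamma> p))"
    using p by (intro ker_map_eqI) (simp_all add: in_NExt)
  then show "FArr (KerF \<Gamma>) (Ide (NExt \<Gamma>) p) = Ide X (FObj (KerF \<Gamma>) p)"
    using p nker(2) by (simp add: NExt_simps KerF_simps X_simps in_NExt)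
next
  interpret N: category "NExt \<Gamma>" using NExt_category by (simp add: category_def)
  fix x y assume x: "x \<in> Arr (NExt \<Gamma>)" and y: "y \<in> Arr (NExt \<Gamma>)" and xy: "Cod (NExt \<Gamma>) x = Dom (NExt \<Gamma>) y"
  obtain p f b q where x_def: "x = (p, (f, b), q)" by (metis prod.exhaust)
  obtain g c r where y_def: "y = (q, (g, c), r)" using xy by (cases y) (auto simp: x_def NExt_simps)
  note Nx = x[unfolded x_def] and Ny = y[unfolded y_def]
  note kx = ker_map[OF Nx] and ky = ker_map[OF Ny]
  have N: "(p, (g \<cdot> f, c \<cdot> b), r) \<in> Arr (NExt \<Gamma>)"
    using N.comp_Arr[OF x y xy] by (simp add: NExt_simps x_def y_def)
  have *: "normal_extension \<Gamma> p" "normal_extension \<Gamma> q" "normal_extension \<Gamma> r" "f \<in> Arr C" "g \<in> Arr C"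
    "Dom C f = Dom C p" "Cod C f = Dom C q" "Dom C g = Dom C q" "Cod C g = Dom C r"
    using Nx Ny by (simp_all add: Arr_NExt)
  let ?f = "ker_map p f q" and ?g = "ker_map q g r"
  have "nker \<Gamma> r \<cdot> (?g \<cdot> ?f) = g \<cdot> (nker \<Gamma> q \<cdot> ?f)"
    using kx(1-3) ky(1-3) * by (intro square_extend[OF ky(4)]) simp_all
  then have "ker_map p (g \<cdot> f) r = ?g \<cdot> ?f"
    using kx ky(1-3) * by (intro ker_map_eqI[OF N]) simp_all
  moreover have "?g \<cdot>\<^bsub>X\<^esub> ?f = ?g \<cdot> ?f"
    using kx ky * nker(2) by (intro X_simps(4)) (simp_all add: Arr_X)
  ultimately show "FArr (KerF \<Gamma>) (y \<cdot>\<^bsub>NExt \<Gamma>\<^esub> x) = FArr (KerF \<Gamma>) y \<cdot>\<^bsub>X\<^esub> FArr (KerF \<Gamma>) x"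
    by (simp add: x_def y_def KerF_simps NExt_simps)
qed

lemma kappa_arr:
  assumes p: "normal_extension \<Gamma> p"
  shows "kappa \<Gamma> p \<in> Arr C" "Dom C (kappa \<Gamma> p) = gal_obj \<Gamma> (wuniv \<Gamma> (Cod C p))"
    "Cod C (kappa \<Gamma> p) = gal_obj \<Gamma> p"
    "iker p \<cdot> kappa \<Gamma> p = wuniv_over \<Gamma> p \<cdot> iker (wuniv \<Gamma> (Cod C p))"
  using gal_map[OF wuniv_over[OF p]] by (simp_all add: kappa[OF p])

lemma delta:
  assumes p: "normal_extension \<Gamma> p"
  shows "delta \<Gamma> p = iota \<Gamma> p \<cdot> kappa \<Gamma> p" "delta \<Gamma> p \<in> Arr X"
    "Dom C (delta \<Gamma> p) = gal_obj \<Gamma> (wuniv \<Gamma> (Cod C p))" "Cod C (delta \<Gamma> p) = Dom C (nker \<Gamma> p)"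
    "nker \<Gamma> p \<cdot> delta \<Gamma> p = wuniv_over \<Gamma> p \<cdot> iker (wuniv \<Gamma> (Cod C p))"
proof -
  note i = iota[OF p] and k = kappa_arr[OF p]
  have G: "gal_obj \<Gamma> p \<in> Obj X" "gal_obj \<Gamma> (wuniv \<Gamma> (Cod C p)) \<in> Obj X"
    using gal_incl(3)[OF p] gal_incl(3)[OF wuniv(1)] normal_Arr[OF p] by simp_all
  have "iota \<Gamma> p \<cdot>\<^bsub>X\<^esub> kappa \<Gamma> p = iota \<Gamma> p \<cdot> kappa \<Gamma> p"
    using i(1-3) k(1-3) G nker(2)[OF p] by (intro X_simps(4)) (simp_all add: Arr_X)
  then show d: "delta \<Gamma> p = iota \<Gamma> p \<cdot> kappa \<Gamma> p"
    using p by (simp add: delta_def vcomp_def in_NExt)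
  show "delta \<Gamma> p \<in> Arr X"
    "Dom C (delta \<Gamma> p) = gal_obj \<Gamma> (wuniv \<Gamma> (Cod C p))" "Cod C (delta \<Gamma> p) = Dom C (nker \<Gamma> p)"
    using i(1-3) k(1-3) G nker(2)[OF p] by (simp_all add: d Arr_X)
  show "nker \<Gamma> p \<cdot> delta \<Gamma> p = wuniv_over \<Gamma> p \<cdot> iker (wuniv \<Gamma> (Cod C p))"
    using k i p by (simp add: d iker_def)
qed

text \<open>After composing with the kernel of \<open>q\<close>, the two sides come from the two ways around the square
  formed by \<open>(f, b)\<close>, a lift of \<open>b\<close> and the comparisons with the weakly universal extensions. These are
  morphisms of normal extensions over the same arrow \<open>b\<close>.\<close>

lemma delta_natural: "is_nat_trans (NExt \<Gamma>) X (comp_functor (pi1 \<Gamma>) (CodF \<Gamma>)) (KerF \<Gamma>) (delta \<Gamma>)"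
proof (rule nat_transI[OF comp_functor[OF CodF_functor pi1_functor] KerF_functor])
  show "delta \<Gamma> \<in> extensional (Obj (NExt \<Gamma>))" by (simp add: delta_def vcomp_def)
next
  fix p assume "p \<in> Obj (NExt \<Gamma>)"
  then show "delta \<Gamma> p \<in> Arr X \<and> Dom X (delta \<Gamma> p) = FObj (comp_functor (pi1 \<Gamma>) (CodF \<Gamma>)) p \<and>
      Cod X (delta \<Gamma> p) = FObj (KerF \<Gamma>) p"
    using delta[of p] by (simp add: in_NExt X_simps CodF_simps pi1_simps KerF_simps)
next
  fix x assume x: "x \<in> Arr (NExt \<Gamma>)"
  obtain p f b q where x_def: "x = (p, (f, b), q)" by (metis prod.exhaust)
  note N = x[unfolded x_def]
  interpret N: category "NExt \<Gamma>" using NExt_category by (simp add: category_def)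
  have *: "normal_extension \<Gamma> p" "normal_extension \<Gamma> q" "f \<in> Arr C" "Dom C f = Dom C p" "Cod C f = Dom C q"
    "b \<in> Arr C" "Dom C b = Cod C p" "Cod C b = Cod C q"
    using N by (simp_all add: Arr_NExt)
  note dp = delta[OF *(1)] and dq = delta[OF *(2)] and K = ker_map[OF N] and b = pi1_map[OF *(6)]
  let ?u = "wuniv \<Gamma> (Cod C p)" and ?v = "wuniv \<Gamma> (Cod C q)"
  let ?hp = "wuniv_over \<Gamma> p" and ?hq = "wuniv_over \<Gamma> q" and ?l = "wuniv_lift \<Gamma> b"
  note Np = wuniv_over[OF *(1)] and Nq = wuniv_over[OF *(2)]
  have Nl: "(?u, (?l, b), ?v) \<in> Arr (NExt \<Gamma>)" using wuniv_lift[OF *(6)] * by simp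
  have uv: "normal_extension \<Gamma> ?u" "normal_extension \<Gamma> ?v" using Nl by (simp_all add: Arr_NExt)
  have A: "?hp \<in> Arr C" "Dom C ?hp = Dom C ?u" "Cod C ?hp = Dom C p"
    "?hq \<in> Arr C" "Dom C ?hq = Dom C ?v" "Cod C ?hq = Dom C q" "?l \<in> Arr C" "Dom C ?l = Dom C ?u" "Cod C ?l = Dom C ?v"
    using Np Nq Nl by (simp_all add: Arr_NExt)
  have N1: "(?u, (f \<cdot> ?hp, b), q) \<in> Arr (NExt \<Gamma>)"
    using N.comp_Arr[OF Np N] * by (simp add: NExt_simps)
  have N2: "(?u, (?hq \<cdot> ?l, b), q) \<in> Arr (NExt \<Gamma>)"
    using N.comp_Arr[OF Nl Nq] * by (simp add: NExt_simps)
  have dA: "delta \<Gamma> p \<in> Arr C" "delta \<Gamma> q \<in> Arr C" using dp(2) dq(2) by (simp_all add: Arr_X)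
  note iu = iker[OF uv(1)] and iv = iker[OF uv(2)]
  have "nker \<Gamma> q \<cdot> (ker_map p f q \<cdot> delta \<Gamma> p) = f \<cdot> (nker \<Gamma> p \<cdot> delta \<Gamma> p)"
    using K(1-3) dA dp(3,4) * by (intro square_extend[OF K(4)]) simp_all
  also have "\<dots> = (f \<cdot> ?hp) \<cdot> iker ?u"
    unfolding dp(5) using * A iu by simp
  also have "\<dots> = (?hq \<cdot> ?l) \<cdot> iker ?u"
    by (rule iker_independent[OF N1 N2])
  also have "\<dots> = ?hq \<cdot> (iker ?v \<cdot> FArr (pi1 \<Gamma>) b)"
    using b(4) * A iu by simp
  also have "\<dots> = nker \<Gamma> q \<cdot> (delta \<Gamma> q \<cdot> FArr (pi1 \<Gamma>) b)"
    using dA dq(3,4) b(1-3) iv(1-3) A * by (intro square_extend[OF dq(5)[symmetric]]) simp_all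
  finally have e: "ker_map p f q \<cdot> delta \<Gamma> p = delta \<Gamma> q \<cdot> FArr (pi1 \<Gamma>) b"
    using K(1-3) dA dp(3,4) dq(3,4) b(1-3) * by - (rule nker_eq[of q], simp_all)
  have "ker_map p f q \<in> Arr X" "FArr (pi1 \<Gamma>) b \<in> Arr X"
    using K b * nker(2) gal_incl(3) uv by (simp_all add: Arr_X)
  then have "ker_map p f q \<cdot>\<^bsub>X\<^esub> delta \<Gamma> p = ker_map p f q \<cdot> delta \<Gamma> p"
    "delta \<Gamma> q \<cdot>\<^bsub>X\<^esub> FArr (pi1 \<Gamma>) b = delta \<Gamma> q \<cdot> FArr (pi1 \<Gamma>) b"
    using dp(2-4) dq(2-4) K b * by (auto intro!: X_simps(4))
  then show "FArr (KerF \<Gamma>) x \<cdot>\<^bsub>X\<^esub> delta \<Gamma> (Dom (NExt \<Gamma>) x) =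
      delta \<Gamma> (Cod (NExt \<Gamma>) x) \<cdot>\<^bsub>X\<^esub> FArr (comp_functor (pi1 \<Gamma>) (CodF \<Gamma>)) x"
    using e by (simp add: x_def NExt_simps KerF_simps CodF_simps)
qed

lemma kappa_wuniv:
  assumes B: "B \<in> Obj C"
  shows "kappa \<Gamma> (wuniv \<Gamma> B) = Ide C (gal_obj \<Gamma> (wuniv \<Gamma> B))"
proof -
  let ?u = "wuniv \<Gamma> B"
  note u = wuniv[OF B] and G = gal_incl(3)[OF wuniv(1)[OF B]]
  note i = iker[OF u(1)] and uA = normal_Arr[OF u(1)]
  have N: "(?u, (wuniv_over \<Gamma> ?u, Ide C B), ?u) \<in> Arr (NExt \<Gamma>)"
    using wuniv_over[OF u(1)] u(2) by simp
  have N': "(?u, (Ide C (Dom C ?u), Ide C B), ?u) \<in> Arr (NExt \<Gamma>)"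
    using u(1,2) uA by (simp add: Arr_NExt B)
  have "gal_map \<Gamma> ?u (wuniv_over \<Gamma> ?u) ?u = Ide C (gal_obj \<Gamma> ?u)"
    using i G iker_independent[OF N N'] by (intro gal_map_eqI[OF N]) simp_all
  then show ?thesis using kappa[OF u(1)] u(2) by simp
qed

context
  fixes S :: "('o, 'a, 'o, 'a) func" and \<gamma> :: "'a \<Rightarrow> 'a"
  assumes S: "is_functor C X S"
    and \<gamma>: "is_nat_trans (NExt \<Gamma>) X (comp_functor S (CodF \<Gamma>)) (KerF \<Gamma>) \<gamma>"
begin

lemma S_obj: "B \<in> Obj C \<Longrightarrow> FObj S B \<in> Obj X"
  using functorD(3)[OF S] .

lemma S_arr:
  assumes "f \<in> Arr C"
  shows "FArr S f \<in> Arr X" "FArr S f \<in> Arr C" "Dom C (FArr S f) = FObj S (Dom C f)" "Cod C (FArr S f) = FObj S (Cod C f)"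
  using functorD(4-6)[OF S assms] by (auto simp: X_simps Arr_X)

lemma gamma:
  assumes p: "normal_extension \<Gamma> p"
  shows "\<gamma> p \<in> Arr X" "\<gamma> p \<in> Arr C" "Dom C (\<gamma> p) = FObj S (Cod C p)" "Cod C (\<gamma> p) = Dom C (nker \<Gamma> p)"
  using nat_transD(4-6)[OF \<gamma>, of p] p by (auto simp: in_NExt CodF_simps KerF_simps X_simps Arr_X)

text \<open>Composing with the monic \<open>ker(q)\<close> turns naturality of \<open>\<gamma>\<close> into an equation of arrows into the
  domain of \<open>q\<close>.\<close>

lemma gamma_natural:
  assumes N: "(p, (f, b), q) \<in> Arr (NExt \<Gamma>)"
  shows "f \<cdot> (nker \<Gamma> p \<cdot> \<gamma> p) = nker \<Gamma> q \<cdot> (\<gamma> q \<cdot> FArr S b)"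
proof -
  have *: "normal_extension \<Gamma> p" "normal_extension \<Gamma> q" "f \<in> Arr C" "Dom C f = Dom C p" "Cod C f = Dom C q"
    "b \<in> Arr C" "Dom C b = Cod C p" "Cod C b = Cod C q"
    using N by (simp_all add: Arr_NExt)
  note gp = gamma[OF *(1)] and gq = gamma[OF *(2)] and K = ker_map[OF N] and Sb = S_arr[OF *(6)]
  have KX: "ker_map p f q \<in> Arr X" using K nker(2) * by (simp add: Arr_X)
  have "ker_map p f q \<cdot>\<^bsub>X\<^esub> \<gamma> p = \<gamma> q \<cdot>\<^bsub>X\<^esub> FArr S b"
    using nat_transD(7)[OF \<gamma> N] by (simp add: NExt_simps KerF_simps CodF_simps)
  moreover have "ker_map p f q \<cdot>\<^bsub>X\<^esub> \<gamma> p = ker_map p f q \<cdot> \<gamma> p"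
    using KX gp K by (intro X_simps(4)) simp_all
  moreover have "\<gamma> q \<cdot>\<^bsub>X\<^esub> FArr S b = \<gamma> q \<cdot> FArr S b"
    using gq Sb * by (intro X_simps(4)) simp_all
  ultimately have "nker \<Gamma> q \<cdot> (ker_map p f q \<cdot> \<gamma> p) = nker \<Gamma> q \<cdot> (\<gamma> q \<cdot> FArr S b)" by simp
  moreover have "nker \<Gamma> q \<cdot> (ker_map p f q \<cdot> \<gamma> p) = f \<cdot> (nker \<Gamma> p \<cdot> \<gamma> p)"
    using K(1-3) gp * by (intro square_extend[OF K(4)]) simp_all
  ultimately show ?thesis by simp
qed

text \<open>The component of \<open>\<gamma>\<close> at a normal extension \<open>t : I(E) \<rightarrow> 0\<close> is fixed by the zero endomorphism
  \<open>z\<close> of \<open>t\<close>, hence zero. Naturality at \<open>(\<eta>\<^sub>E, 0) : p \<rightarrow> t\<close> carries this over to \<open>p\<close>.\<close>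

lemma eta_gamma_zero:
  assumes p: "normal_extension \<Gamma> p"
  shows "is_zero_arr C (\<eta> (Dom C p) \<cdot> (nker \<Gamma> p \<cdot> \<gamma> p))"
proof -
  let ?E = "Dom C p"
  have pA: "p \<in> Arr C" and E: "?E \<in> Obj C" using normal_Arr[OF p] by simp_all
  obtain t where t: "t \<in> Arr C" "Dom C t = IO ?E" "Cod C t = zero"
    using zero_object_maps[OF zero_C, of "IO ?E"] E by (metis IO X_Obj)
  have tn: "normal_extension \<Gamma> t" using normal_extension_to_zero[OF E t] .
  note gt = gamma[OF tn] and gp = gamma[OF p]
  have to_zero: "x = y" if "x \<in> Arr C" "y \<in> Arr C" "Dom C x = Dom C y" "Cod C x = zero" "Cod C y = zero" for x y
    using zero_C that terminal_eq[of zero x "Dom C x" y] by (simp add: is_zero_object_def hom_def)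
  obtain z where z: "is_zero_arr C z" "z \<in> Arr C" "Dom C z = IO ?E" "Cod C z = IO ?E"
    by (rule zero_arr_ex[of "IO ?E" "IO ?E"]) (use E in simp_all)
  have "(t, (z, Ide C zero), t) \<in> Arr (NExt \<Gamma>)"
    using tn t z to_zero[of "t \<cdot> z" "t"] by (simp add: Arr_NExt)
  from gamma_natural[OF this] have "z \<cdot> (nker \<Gamma> t \<cdot> \<gamma> t) = nker \<Gamma> t \<cdot> \<gamma> t"
    using functorD(7)[OF S, of zero] S_obj[of zero] gt tn t by (simp add: X_simps)
  moreover have "is_zero_arr C (z \<cdot> (nker \<Gamma> t \<cdot> \<gamma> t))"
    using z gt tn t by (intro comp_zero) simp_all
  ultimately have zt: "is_zero_arr C (nker \<Gamma> t \<cdot> \<gamma> t)" by simp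
  obtain b where b: "b \<in> Arr C" "Dom C b = Cod C p" "Cod C b = zero"
    using zero_object_maps[OF zero_C Cod_Obj[OF pA]] by metis
  have "(p, (\<eta> ?E, b), t) \<in> Arr (NExt \<Gamma>)"
    using p tn t b E pA to_zero[of "t \<cdot> \<eta> ?E" "b \<cdot> p"] by (simp add: Arr_NExt)
  from gamma_natural[OF this]
  have "\<eta> ?E \<cdot> (nker \<Gamma> p \<cdot> \<gamma> p) = (nker \<Gamma> t \<cdot> \<gamma> t) \<cdot> FArr S b"
    using gt tn S_arr[OF b(1)] b t by simp
  moreover have "is_zero_arr C ((nker \<Gamma> t \<cdot> \<gamma> t) \<cdot> FArr S b)"
    using gt tn S_arr[OF b(1)] b t by (intro comp_zero[OF zt]) simp_all
  ultimately show ?thesis by simp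
qed

text \<open>The component at \<open>B\<close> is the factorisation of \<open>\<gamma>\<^sub>u\<close> through \<open>\<iota>\<^sub>u\<close>, for \<open>u\<close> weakly universal over
  \<open>B\<close>. The required equations hold after composing with a monic, by naturality of \<open>\<gamma>\<close> at the chosen
  lift of \<open>f\<close> and at the chosen arrow from \<open>u\<close> to \<open>p\<close>.\<close>

lemma ex_factorisation:
  "\<exists>\<alpha>. is_nat_trans C X S (pi1 \<Gamma>) \<alpha> \<and> vcomp (NExt \<Gamma>) X (delta \<Gamma>) (whisker (NExt \<Gamma>) \<alpha> (CodF \<Gamma>)) = \<gamma>"
proof -
  have "\<exists>h. h \<in> Arr C \<and> Dom C h = FObj S B \<and> Cod C h = gal_obj \<Gamma> (wuniv \<Gamma> B) \<and>
      iota \<Gamma> (wuniv \<Gamma> B) \<cdot> h = \<gamma> (wuniv \<Gamma> B)" if B: "B \<in> Obj C" for B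
  proof -
    note u = wuniv(1,2)[OF B]
    obtain h where "h \<in> Arr C" "Dom C h = Dom C (\<gamma> (wuniv \<Gamma> B))" "Cod C h = gal_obj \<Gamma> (wuniv \<Gamma> B)"
      "iota \<Gamma> (wuniv \<Gamma> B) \<cdot> h = \<gamma> (wuniv \<Gamma> B)"
      using iota_lift[OF u(1) gamma(2,4)[OF u(1)] eta_gamma_zero[OF u(1)]] by blast
    then show ?thesis using gamma(3)[OF u(1)] u(2) by auto
  qed
  then obtain a where a: "\<And>B. B \<in> Obj C \<Longrightarrow> a B \<in> Arr C \<and> Dom C (a B) = FObj S B \<and>
      Cod C (a B) = gal_obj \<Gamma> (wuniv \<Gamma> B) \<and> iota \<Gamma> (wuniv \<Gamma> B) \<cdot> a B = \<gamma> (wuniv \<Gamma> B)"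
    by metis
  have aX: "a B \<in> Arr X" if "B \<in> Obj C" for B
    using a[OF that] S_obj[OF that] gal_incl(3)[OF wuniv(1)[OF that]] by (simp add: Arr_X)
  have ia: "iker (wuniv \<Gamma> B) \<cdot> a B = nker \<Gamma> (wuniv \<Gamma> B) \<cdot> \<gamma> (wuniv \<Gamma> B)" if B: "B \<in> Obj C" for B
    using a[OF B] iota[OF wuniv(1)[OF B]] wuniv(1)[OF B] by (simp add: iker_def)
  let ?a = "restrict a (Obj C)"
  have "is_nat_trans C X S (pi1 \<Gamma>) ?a"
  proof (rule nat_transI[OF S pi1_functor])
    fix B assume "B \<in> Obj C"
    then show "?a B \<in> Arr X \<and> Dom X (?a B) = FObj S B \<and> Cod X (?a B) = FObj (pi1 \<Gamma>) B"
      using a aX by (simp add: X_simps pi1_simps)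
  next
    fix f assume f: "f \<in> Arr C"
    let ?A = "Dom C f" and ?B = "Cod C f"
    have AB: "?A \<in> Obj C" "?B \<in> Obj C" using f by simp_all
    let ?v = "wuniv \<Gamma> ?A" and ?u = "wuniv \<Gamma> ?B" and ?l = "wuniv_lift \<Gamma> f" and ?f = "FArr (pi1 \<Gamma>) f"
    note v = wuniv(1,2)[OF AB(1)] and u = wuniv(1,2)[OF AB(2)] and N = wuniv_lift[OF f]
    note pf = pi1_map[OF f] and aA = a[OF AB(1)] and aB = a[OF AB(2)] and Sf = S_arr[OF f]
    note iv = iker[OF v(1)] and iu = iker[OF u(1)] and gu = gamma[OF u(1)]
    have l: "?l \<in> Arr C" "Dom C ?l = Dom C ?v" "Cod C ?l = Dom C ?u" using N by (simp_all add: Arr_NExt)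
    have "iker ?u \<cdot> (?f \<cdot> a ?A) = ?l \<cdot> (iker ?v \<cdot> a ?A)"
      using pf(1-3) aA iu(1-3) iv(1-3) l by (intro square_extend[OF pf(4)]) simp_all
    also have "\<dots> = nker \<Gamma> ?u \<cdot> (\<gamma> ?u \<cdot> FArr S f)"
      unfolding ia[OF AB(1)] by (rule gamma_natural[OF N])
    also have "\<dots> = iker ?u \<cdot> (a ?B \<cdot> FArr S f)"
      using aB Sf iu(1-3) gu u by (intro square_extend[OF ia[OF AB(2), symmetric]]) simp_all
    finally have "?f \<cdot> a ?A = a ?B \<cdot> FArr S f"
      using pf(1-3) aA aB Sf by - (rule iker_eq[OF u(1)], simp_all)
    moreover have "?f \<in> Arr X" using pf gal_incl(3)[OF u(1)] gal_incl(3)[OF v(1)] by (simp add: Arr_X)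
    then have "?f \<cdot>\<^bsub>X\<^esub> a ?A = ?f \<cdot> a ?A" "a ?B \<cdot>\<^bsub>X\<^esub> FArr S f = a ?B \<cdot> FArr S f"
      using pf aA aB Sf aX AB by (auto intro!: X_simps(4))
    ultimately show "FArr (pi1 \<Gamma>) f \<cdot>\<^bsub>X\<^esub> ?a (Dom C f) = ?a (Cod C f) \<cdot>\<^bsub>X\<^esub> FArr S f"
      using f by simp
  qed simp
  moreover have "vcomp (NExt \<Gamma>) X (delta \<Gamma>) (whisker (NExt \<Gamma>) ?a (CodF \<Gamma>)) = \<gamma>"
  proof (rule extensionalityI)
    show "vcomp (NExt \<Gamma>) X (delta \<Gamma>) (whisker (NExt \<Gamma>) ?a (CodF \<Gamma>)) \<in> extensional (Obj (NExt \<Gamma>))"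
      by (simp add: vcomp_def)
    show "\<gamma> \<in> extensional (Obj (NExt \<Gamma>))" using nat_transD(3)[OF \<gamma>] .
    fix p assume "p \<in> Obj (NExt \<Gamma>)"
    then have p: "normal_extension \<Gamma> p" by (simp add: in_NExt)
    let ?B = "Cod C p"
    have B: "?B \<in> Obj C" using normal_Arr[OF p] by simp
    let ?u = "wuniv \<Gamma> ?B" and ?h = "wuniv_over \<Gamma> p"
    note u = wuniv(1,2)[OF B] and d = delta[OF p] and aB = a[OF B] and gp = gamma[OF p]
    note N = wuniv_over[OF p] and iu = iker[OF wuniv(1)[OF B]]
    have h: "?h \<in> Arr C" "Dom C ?h = Dom C ?u" "Cod C ?h = Dom C p" using N by (simp_all add: Arr_NExt)
    have dA: "delta \<Gamma> p \<in> Arr C" using d(2) by (simp add: Arr_X)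
    have "nker \<Gamma> p \<cdot> (delta \<Gamma> p \<cdot> a ?B) = ?h \<cdot> (iker ?u \<cdot> a ?B)"
      using dA d(3,4) aB h iu(1-3) p by (intro square_extend[OF d(5)]) simp_all
    also have "\<dots> = nker \<Gamma> p \<cdot> \<gamma> p"
      unfolding ia[OF B] gamma_natural[OF N] using functorD(7)[OF S B] gp S_obj[OF B] by (simp add: X_simps)
    finally have "delta \<Gamma> p \<cdot> a ?B = \<gamma> p"
      using dA d(3,4) aB gp by - (rule nker_eq[OF p], simp_all)
    moreover have "delta \<Gamma> p \<cdot>\<^bsub>X\<^esub> a ?B = delta \<Gamma> p \<cdot> a ?B"
      using d(2,3) aB aX[OF B] by (intro X_simps(4)) simp_all
    ultimately show "vcomp (NExt \<Gamma>) X (delta \<Gamma>) (whisker (NExt \<Gamma>) ?a (CodF \<Gamma>)) p = \<gamma> p"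
      using p B by (simp add: vcomp_def whisker_def in_NExt CodF_simps)
  qed
  ultimately show ?thesis by blast
qed

text \<open>Over \<open>u\<close> weakly universal the component \<open>\<kappa>\<^sub>u\<close> is the identity, so \<open>\<delta>\<^sub>u\<close> is the monic \<open>\<iota>\<^sub>u\<close>, and
  every object is the codomain of such an extension.\<close>

lemma factorisation_unique:
  assumes \<alpha>: "is_nat_trans C X S (pi1 \<Gamma>) \<alpha>" "vcomp (NExt \<Gamma>) X (delta \<Gamma>) (whisker (NExt \<Gamma>) \<alpha> (CodF \<Gamma>)) = \<gamma>"
    and \<beta>: "is_nat_trans C X S (pi1 \<Gamma>) \<beta>" "vcomp (NExt \<Gamma>) X (delta \<Gamma>) (whisker (NExt \<Gamma>) \<beta> (CodF \<Gamma>)) = \<gamma>"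
  shows "\<alpha> = \<beta>"
proof (rule extensionalityI[OF nat_transD(3)[OF \<alpha>(1)] nat_transD(3)[OF \<beta>(1)]])
  fix B assume B: "B \<in> Obj C"
  let ?u = "wuniv \<Gamma> B"
  note u = wuniv(1,2)[OF B]
  note d = delta[OF u(1)] and i = iota[OF u(1)]
  have du: "delta \<Gamma> ?u = iota \<Gamma> ?u"
    using d(1) i kappa_wuniv[OF B] by simp
  have *: "iota \<Gamma> ?u \<cdot> \<xi> B = \<gamma> ?u \<and> \<xi> B \<in> Arr C \<and> Dom C (\<xi> B) = FObj S B \<and> Cod C (\<xi> B) = gal_obj \<Gamma> ?u"
    if \<xi>: "is_nat_trans C X S (pi1 \<Gamma>) \<xi>" "vcomp (NExt \<Gamma>) X (delta \<Gamma>) (whisker (NExt \<Gamma>) \<xi> (CodF \<Gamma>)) = \<gamma>" for \<xi>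
  proof -
    have "\<xi> B \<in> Arr X" "Dom X (\<xi> B) = FObj S B" "Cod X (\<xi> B) = gal_obj \<Gamma> ?u"
      using nat_transD(4-6)[OF \<xi>(1) B] by (simp_all add: pi1_simps)
    then have x: "\<xi> B \<in> Arr X" "\<xi> B \<in> Arr C" "Dom C (\<xi> B) = FObj S B" "Cod C (\<xi> B) = gal_obj \<Gamma> ?u"
      by (simp_all add: X_simps Arr_X)
    have "delta \<Gamma> ?u \<cdot>\<^bsub>X\<^esub> \<xi> B = \<gamma> ?u"
      using fun_cong[OF \<xi>(2), of ?u] u by (simp add: vcomp_def whisker_def in_NExt CodF_simps)
    moreover have "delta \<Gamma> ?u \<cdot>\<^bsub>X\<^esub> \<xi> B = delta \<Gamma> ?u \<cdot> \<xi> B"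
      using d(2,3) u x by (intro X_simps(4)) simp_all
    ultimately show ?thesis using x du by simp
  qed
  show "\<alpha> B = \<beta> B"
    using *[OF \<alpha>] *[OF \<beta>] by - (rule iota_eq[OF u(1)], simp_all)
qed

end

lemma fundamental_group_kan_extension:
  "is_right_kan_extension (NExt \<Gamma>) C X (CodF \<Gamma>) (KerF \<Gamma>) (pi1 \<Gamma>) (delta \<Gamma>)"
  unfolding is_right_kan_extension_def
proof (intro conjI allI impI CodF_functor KerF_functor pi1_functor delta_natural)
  fix S \<gamma> assume "is_functor C X S \<and> is_nat_trans (NExt \<Gamma>) X (comp_functor S (CodF \<Gamma>)) (KerF \<Gamma>) \<gamma>"
  then have S: "is_functor C X S" "is_nat_trans (NExt \<Gamma>) X (comp_functor S (CodF \<Gamma>)) (KerF \<Gamma>) \<gamma>"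
    by blast+
  show "\<exists>!\<alpha>. is_nat_trans C X S (pi1 \<Gamma>) \<alpha> \<and>
      vcomp (NExt \<Gamma>) X (delta \<Gamma>) (whisker (NExt \<Gamma>) \<alpha> (CodF \<Gamma>)) = \<gamma>"
    using ex_factorisation[OF S] factorisation_unique[OF S] by blast
qed

end

theorem theorem6p3:
  fixes \<Gamma> :: "('o, 'a, 'o, 'a) galois"
  assumes "is_galois_structure \<Gamma>"
    and "admissible \<Gamma>"
    and "finitely_complete (Base \<Gamma>)"
    and "pointed (Base \<Gamma>)"
    and "is_full_subcategory (Target \<Gamma>) (Base \<Gamma>)"
    and "is_inclusion (Target \<Gamma>) (RightAdj \<Gamma>)"
    and "pullback_stable (Base \<Gamma>) {p. monadic_extension \<Gamma> p}"
    and "\<forall>B\<in>Obj (Base \<Gamma>). \<exists>u. weakly_universal \<Gamma> u \<and> Cod (Base \<Gamma>) u = B"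
    and "\<forall>E\<in>Obj (Base \<Gamma>). \<forall>z t. is_zero_object (Target \<Gamma>) z \<and>
           t \<in> hom (Target \<Gamma>) (FObj (LeftAdj \<Gamma>) E) z \<longrightarrow> t \<in> FibF \<Gamma>"
  shows "is_right_kan_extension (NExt \<Gamma>) (Base \<Gamma>) (Target \<Gamma>)
           (CodF \<Gamma>) (KerF \<Gamma>) (pi1 \<Gamma>) (delta \<Gamma>)"
proof -
  have "is_category (Base \<Gamma>)"
    using assms(5) by (simp add: is_full_subcategory_def)
  then interpret reflective_galois "Base \<Gamma>" \<Gamma>
    using assms by unfold_locales auto
  show ?thesis by (rule fundamental_group_kan_extension)
qed

end
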